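(* Let $\mathcal F$ be a finite set of finite tournaments, each with at least two vertices. The following three problems are polynomial-time equivalent: (1) the $\mathcal F$-free orientation completion problem; (2) $\mathrm{CSP}(\mathfrak B_{\mathcal F},\mathbf 0,\mathbf 1)$; (3) $\mathrm{CSP}(D_{\mathcal F},U)$.
   Context: An oriented graph is a loopless digraph with no pair $x,y$ such that both $(x,y)$ and $(y,x)$ are edges (such a pair is a symmetric edge of a digraph); a tournament is an oriented graph in which every two distinct vertices are adjacent. An oriented graph is $\mathcal F$-free if no tournament of $\mathcal F$ embeds into it as an induced subdigraph. The $\mathcal F$-free orientation completion problem: given a finite loopless digraph $D$, decide whether one can remove from each symmetric edge exactly one of its two directions so that the result is $\mathcal F$-free. $D_{\mathcal F}=(V;E)$ is the Fraïssé limit of the class of finite $\mathcal F$-free oriented graphs (the unique countably infinite homogeneous digraph whose finite induced subdigraphs are, up to isomorphism, exactly the finite $\mathcal F$-free oriented graphs); $U=E\cup E^{-1}$, and $(D_{\mathcal F},U)$ is the structure on $V$ with relations $E$ and $U$. Let $m_{\mathcal F}$ be the maximum number of vertices of a tournament in $\mathcal F$. For a tournament $T$ on $\{1,\dots,n\}$, $b_T\in\{0,1\}^{\binom n2}$ is indexed by pairs $i<j$ with $(b_T)_{ij}=1$ iff $(i,j)\in E(T)$. $\mathfrak B_{\mathcal F}$ has domain $\{0,1\}$ and for each $n\in\{2,\dots,m_{\mathcal F}\}$ the relation $P_n=\{b_T: T$ an $\mathcal F$-free tournament on $\{1,\dots,n\}\}$; $(\mathfrak B_{\mathcal F},\mathbf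 0,\mathbf 1)$ is its expansion by $\mathbf 0=\{0\}$, $\mathbf 1=\{1\}$. $\mathrm{CSP}(\mathfrak B)$ is the problem of deciding whether a given finite structure of the signature of $\mathfrak B$ has a homomorphism to $\mathfrak B$. *)

theory Defs
  imports "HOL-Library.Countable_Set" "HOL-Computational_Algebra.Polynomial"
begin

section \<open>Digraphs, tournaments and orientation completions\<close>

type_synonym 'a digraph = "'a set \<times> 'a rel"

abbreviation verts :: "'a digraph \<Rightarrow> 'a set" where "verts \<equiv> fst"
abbreviation edges :: "'a digraph \<Rightarrow> 'a rel" where "edges \<equiv> snd"

definition digraph :: "'a digraph \<Rightarrow> bool" where
  "digraph G \<longleftrightarrow> edges G \<subseteq> verts G \<times> verts G"

text \<open>Asymmetry of the edge relation excludes symmetric edges and loops.\<close>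

definition oriented_graph :: "'a digraph \<Rightarrow> bool" where
  "oriented_graph G \<longleftrightarrow> digraph G \<and> asym (edges G)"

definition tournament :: "'a digraph \<Rightarrow> bool" where
  "tournament G \<longleftrightarrow> oriented_graph G \<and> total_on (verts G) (edges G)"

definition induced :: "'a digraph \<Rightarrow> 'a set \<Rightarrow> 'a digraph" where
  "induced G A = (A, edges G \<inter> A \<times> A)"

definition digraph_iso :: "('a \<Rightarrow> 'b) \<Rightarrow> 'a digraph \<Rightarrow> 'b digraph \<Rightarrow> bool" where
  "digraph_iso f G H \<longleftrightarrow> bij_betw f (verts G) (verts H) \<and>
     (\<forall>x\<in>verts G. \<forall>y\<in>verts G. (x, y) \<in> edges G \<longleftrightarrow> (f x, f y) \<in> edges H)"

definition embeds :: "'a digraph \<Rightarrow> 'b digraph \<Rightarrow> bool" where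
  "embeds G H \<longleftrightarrow> (\<exists>A f. A \<subseteq> verts H \<and> digraph_iso f G (induced H A))"

definition free_of :: "'b digraph set \<Rightarrow> 'a digraph \<Rightarrow> bool" where
  "free_of F G \<longleftrightarrow> (\<forall>T\<in>F. \<not> embeds T G)"

text \<open>\<open>R\<close> arises from \<open>E\<close> by removing exactly one direction of each symmetric
  edge, and nothing else.\<close>

definition completion :: "'a rel \<Rightarrow> 'a rel \<Rightarrow> bool" where
  "completion E R \<longleftrightarrow> R \<subseteq> E \<and>
     (\<forall>x y. (x, y) \<in> E \<longrightarrow>
        (if (y, x) \<in> E then ((x, y) \<in> R \<longleftrightarrow> (y, x) \<notin> R) else (x, y) \<in> R))"

section \<open>The Fraisse limit\<close>

definition homogeneous :: "'a digraph \<Rightarrow> bool" where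
  "homogeneous G \<longleftrightarrow>
     (\<forall>A B f. finite A \<and> A \<subseteq> verts G \<and> B \<subseteq> verts G \<and>
        digraph_iso f (induced G A) (induced G B) \<longrightarrow>
        (\<exists>g. digraph_iso g G G \<and> (\<forall>x\<in>A. g x = f x)))"

text \<open>Every finite digraph is isomorphic to one whose vertices are natural numbers.\<close>

definition fraisse_limit :: "'b digraph set \<Rightarrow> 'a digraph \<Rightarrow> bool" where
  "fraisse_limit F G \<longleftrightarrow>
     digraph G \<and> countable (verts G) \<and> infinite (verts G) \<and> homogeneous G \<and>
     (\<forall>H :: nat digraph. digraph H \<and> finite (verts H) \<longrightarrow>
        (embeds H G \<longleftrightarrow> oriented_graph H \<and> free_of F H))"

section \<open>Relational structures\<close>

text \<open>A signature is the list of arities of its relation symbols; a structure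
  interprets the \<open>i\<close>-th symbol by a set of lists of length \<open>ar ! i\<close>.\<close>

type_synonym 'a rel_structure = "'a set \<times> 'a list set list"

definition structure_of :: "nat list \<Rightarrow> 'a rel_structure \<Rightarrow> bool" where
  "structure_of ar A \<longleftrightarrow> length (snd A) = length ar \<and>
     (\<forall>i<length ar. \<forall>t\<in>snd A ! i. length t = ar ! i \<and> set t \<subseteq> fst A)"

definition homomorphism :: "('a \<Rightarrow> 'b) \<Rightarrow> 'a rel_structure \<Rightarrow> 'b rel_structure \<Rightarrow> bool" where
  "homomorphism h A B \<longleftrightarrow> h ` fst A \<subseteq> fst B \<and>
     (\<forall>i<length (snd A). \<forall>t\<in>snd A ! i. map h t \<in> snd B ! i)"

definition edge_tuples :: "'a rel \<Rightarrow> 'a list set" where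
  "edge_tuples E = {[x, y] | x y. (x, y) \<in> E}"

section \<open>Problems as languages of bit strings\<close>

text \<open>Instances have domain \<open>{..<n}\<close>. The encoding is \<open>n\<close> in unary, a separator,
  and for each relation its characteristic bit string, the tuples being listed in
  lexicographic order. Strings that do not encode an instance belong to no problem.\<close>

definition encode :: "nat \<Rightarrow> nat list \<Rightarrow> nat list set list \<Rightarrow> bool list" where
  "encode n ar Rs = replicate n True @ [False] @
     concat (map2 (\<lambda>k R. map (\<lambda>t. t \<in> R) (product_lists (replicate k [0..<n]))) ar Rs)"

definition CSP :: "nat list \<Rightarrow> 'a rel_structure \<Rightarrow> bool list set" where
  "CSP ar B = {encode n ar Rs | n Rs.
     structure_of ar ({..<n}, Rs) \<and> (\<exists>h. homomorphism h ({..<n}, Rs) B)}"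

definition orientation_completion :: "'b digraph set \<Rightarrow> bool list set" where
  "orientation_completion F = {encode n [2] [edge_tuples E] | n E.
     digraph ({..<n}, E) \<and> irrefl E \<and>
     (\<exists>R. completion E R \<and> free_of F ({..<n}, R))}"

section \<open>The structures of the theorem\<close>

text \<open>For the empty set of tournaments the maximum is taken to be 0.\<close>

definition max_order :: "'b digraph set \<Rightarrow> nat" where
  "max_order F = Max (insert 0 ((\<lambda>T. card (verts T)) ` F))"

definition tournament_code :: "nat \<Rightarrow> nat rel \<Rightarrow> nat list" where
  "tournament_code n E =
     [if (i, j) \<in> E then 1 else 0. i \<leftarrow> [1..<Suc n], j \<leftarrow> [Suc i..<Suc n]]"

definition P_rel :: "'b digraph set \<Rightarrow> nat \<Rightarrow> nat list set" where
  "P_rel F n = {tournament_code n E | E. tournament ({1..n}, E) \<and> free_of F ({1..n}, E)}"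

definition B01_signature :: "'b digraph set \<Rightarrow> nat list" where
  "B01_signature F = map (\<lambda>n. n choose 2) [2..<Suc (max_order F)] @ [1, 1]"

definition B01 :: "'b digraph set \<Rightarrow> nat rel_structure" where
  "B01 F = ({0, 1}, map (P_rel F) [2..<Suc (max_order F)] @ [{[0]}, {[1]}])"

definition with_U :: "'a digraph \<Rightarrow> 'a rel_structure" where
  "with_U G = (verts G, [edge_tuples (edges G), edge_tuples (edges G \<union> (edges G)\<inverse>)])"

section \<open>Polynomial-time reductions\<close>

text \<open>Deterministic Turing machines with several two-way infinite tapes. Symbols
  and states are natural numbers: 0 is the blank, 1 and 2 are the input bits, 0 is the
  initial state and \<open>nstates\<close> the halting state. A transition maps the state
  and the scanned symbols to a new state and, for each tape, a symbol to be written and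
  a head movement.\<close>

record tm =
  ntapes :: nat
  nsyms :: nat
  nstates :: nat
  delta :: "nat \<Rightarrow> nat list \<Rightarrow> nat \<times> (nat \<times> int) list"

definition wf_tm :: "tm \<Rightarrow> bool" where
  "wf_tm M \<longleftrightarrow> 2 \<le> ntapes M \<and> 3 \<le> nsyms M \<and>
     (\<forall>q<nstates M. \<forall>ss. length ss = ntapes M \<and> set ss \<subseteq> {..<nsyms M} \<longrightarrow>
        fst (delta M q ss) \<le> nstates M \<and>
        length (snd (delta M q ss)) = ntapes M \<and>
        set (snd (delta M q ss)) \<subseteq> {..<nsyms M} \<times> {-1, 0, 1})"

text \<open>Tape contents are stored relative to the head, which always scans cell 0.\<close>

type_synonym tape = "int \<Rightarrow> nat"

definition act :: "nat \<times> int \<Rightarrow> tape \<Rightarrow> tape" where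
  "act a t = (\<lambda>i. (t(0 := fst a)) (i + snd a))"

definition step :: "tm \<Rightarrow> nat \<times> tape list \<Rightarrow> nat \<times> tape list" where
  "step M c = (case c of (q, ts) \<Rightarrow>
     if nstates M \<le> q then c
     else (case delta M q (map (\<lambda>t. t 0) ts) of (q', as) \<Rightarrow> (q', map2 act as ts)))"

definition bit_sym :: "bool \<Rightarrow> nat" where
  "bit_sym b = (if b then 2 else 1)"

definition input_tape :: "bool list \<Rightarrow> tape" where
  "input_tape x = (\<lambda>i. if 0 \<le> i \<and> i < int (length x) then bit_sym (x ! nat i) else 0)"

definition init :: "tm \<Rightarrow> bool list \<Rightarrow> nat \<times> tape list" where
  "init M x = (0, input_tape x # replicate (ntapes M - 1) (\<lambda>_. 0))"

text \<open>The output is the bit string on the second tape from the head up to the first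
  blank to its right.\<close>

definition output_is :: "tape \<Rightarrow> bool list \<Rightarrow> bool" where
  "output_is t y \<longleftrightarrow> (\<forall>i<length y. t (int i) = bit_sym (y ! i)) \<and> t (int (length y)) = 0"

definition poly_time :: "(bool list \<Rightarrow> bool list) \<Rightarrow> bool" where
  "poly_time f \<longleftrightarrow> (\<exists>M (p :: nat poly). wf_tm M \<and>
     (\<forall>x. \<exists>k \<le> poly p (length x). \<exists>ts.
        (step M ^^ k) (init M x) = (nstates M, ts) \<and> output_is (ts ! 1) (f x)))"

definition poly_reducible :: "bool list set \<Rightarrow> bool list set \<Rightarrow> bool" where
  "poly_reducible L L' \<longleftrightarrow> (\<exists>f. poly_time f \<and> (\<forall>x. x \<in> L \<longleftrightarrow> f x \<in> L'))"

definition poly_equivalent :: "bool list set \<Rightarrow> bool list set \<Rightarrow> bool" where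
  "poly_equivalent L L' \<longleftrightarrow> poly_reducible L L' \<and> poly_reducible L' L"

end

theory Submission
  imports Defs
begin

text \<open>
  All three problems amount to orienting the edges of a finite graph, some of them in a prescribed
  direction, so that no forbidden tournament appears. A graph becomes a Boolean instance whose
  variables are pairs of vertices and whose constraints are the cliques; a homomorphism into the limit
  pulls back an orientation, and every free orientation embeds into the limit. Conversely, suppose
  that for some number \<open>k\<close> of vertices there are both free and non-free tournaments. Two
  free tournaments at minimal distance whose interval contains a non-free one yield an implication
  between the directions of two edges, and composing copies of it gives an equality gadget, which ties
  the edge of a Boolean variable to the clique edges of its constraints. If there is no such \<open>k\<close>,
  the Boolean constraints are trivial. The reductions are first-order definable, hence computed by
  loop programs, and these are simulated by Turing machines whose states are program continuations.
\<close>

section \<open>Counter programs and Turing machines\<close>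

datatype ctr = Flag | Aux | Var nat | Co nat

datatype instr = Inc ctr | Dec ctr | InR | InL | Out bool | OutL | OutR

datatype test = Zero ctr | Sym nat | OutBlank | Neg test | Both test test

datatype com = Skip | Do instr | Seq com com | Cond test com com | While test com

record state =
  ipos :: int
  otape :: tape
  opos :: int
  cnt :: "ctr \<Rightarrow> nat"

fun exec :: "instr \<Rightarrow> state \<Rightarrow> state" where
  "exec (Inc c) s = s\<lparr>cnt := (cnt s)(c := Suc (cnt s c))\<rparr>"
| "exec (Dec c) s = s\<lparr>cnt := (cnt s)(c := cnt s c - 1)\<rparr>"
| "exec InR s = s\<lparr>ipos := ipos s + 1\<rparr>"
| "exec InL s = s\<lparr>ipos := ipos s - 1\<rparr>"
| "exec (Out b) s = s\<lparr>otape := (otape s)(opos s := bit_sym b), opos := opos s + 1\<rparr>"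
| "exec OutL s = s\<lparr>opos := opos s - 1\<rparr>"
| "exec OutR s = s\<lparr>opos := opos s + 1\<rparr>"

fun holds :: "bool list \<Rightarrow> state \<Rightarrow> test \<Rightarrow> bool" where
  "holds x s (Zero c) \<longleftrightarrow> cnt s c = 0"
| "holds x s (Sym a) \<longleftrightarrow> input_tape x (ipos s) = a"
| "holds x s OutBlank \<longleftrightarrow> otape s (opos s) = 0"
| "holds x s (Neg t) \<longleftrightarrow> \<not> holds x s t"
| "holds x s (Both t u) \<longleftrightarrow> holds x s t \<and> holds x s u"

fun next_com :: "(test \<Rightarrow> bool) \<Rightarrow> com \<Rightarrow> com \<times> instr option" where
  "next_com h Skip = (Skip, None)"
| "next_com h (Do i) = (Skip, Some i)"
| "next_com h (Seq c d) =
    (if c = Skip then (d, None) else (Seq (fst (next_com h c)) d, snd (next_com h c)))"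
| "next_com h (Cond t c d) = (if h t then c else d, None)"
| "next_com h (While t c) = (if h t then Seq c (While t c) else Skip, None)"

definition exec_opt :: "instr option \<Rightarrow> state \<Rightarrow> state" where
  "exec_opt io s = (case io of None \<Rightarrow> s | Some i \<Rightarrow> exec i s)"

definition cstep :: "bool list \<Rightarrow> com \<times> state \<Rightarrow> com \<times> state" where
  "cstep x cs = (case next_com (holds x (snd cs)) (fst cs) of (c, io) \<Rightarrow> (c, exec_opt io (snd cs)))"

subsection \<open>Timed execution\<close>

text \<open>Since \<open>Skip\<close> is a fixed point of \<open>cstep\<close>, \<open>k\<close> is only an upper bound on the running time.\<close>

definition run :: "bool list \<Rightarrow> com \<Rightarrow> state \<Rightarrow> nat \<Rightarrow> state \<Rightarrow> bool" where
  "run x c s k s' \<longleftrightarrow> (cstep x ^^ k) (c, s) = (Skip, s')"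

lemma cstep_Skip_pow: "(cstep x ^^ k) (Skip, s) = (Skip, s)"
  by (induction k) (auto simp: cstep_def exec_opt_def)

lemma run_mono:
  assumes "run x c s k s'" "k \<le> k'"
  shows "run x c s k' s'"
proof -
  have "(cstep x ^^ k') (c, s) = (cstep x ^^ (k' - k + k)) (c, s)"
    using assms(2) by simp
  also have "\<dots> = (cstep x ^^ (k' - k)) ((cstep x ^^ k) (c, s))"
    unfolding funpow_add by simp
  finally show ?thesis
    using assms(1) by (simp add: run_def cstep_Skip_pow)
qed

lemma run_Skip: "run x Skip s k s"
  by (simp add: run_def cstep_Skip_pow)

lemma run_Suc: "cstep x (c, s) = (c', s') \<Longrightarrow> run x c' s' k s'' \<Longrightarrow> run x c s (Suc k) s''"
  by (simp add: run_def funpow_Suc_right del: funpow.simps)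

lemma run_Do: "run x (Do i) s (Suc 0) (exec i s)"
  by (simp add: run_def cstep_def exec_opt_def)

lemma run_Seq:
  assumes "run x c s k s'" "run x d s' l s''"
  shows "run x (Seq c d) s (k + l + 1) s''"
  using assms(1)
proof (induction k arbitrary: c s)
  case 0
  then have "c = Skip" "s' = s" by (auto simp: run_def)
  moreover have "cstep x (Seq Skip d, s) = (d, s)" by (simp add: cstep_def exec_opt_def)
  ultimately show ?case using run_Suc[of x "Seq Skip d" s d s l s''] assms(2) by simp
next
  case (Suc k)
  show ?case
  proof (cases "c = Skip")
    case True
    then have "s' = s" using Suc.prems by (simp add: run_def cstep_Skip_pow del: funpow.simps)
    moreover have "cstep x (Seq Skip d, s) = (d, s)" by (simp add: cstep_def exec_opt_def)
    ultimately have "run x (Seq c d) s (Suc l) s''"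
      using run_Suc[of x "Seq Skip d" s d s l s''] assms(2) True by simp
    then show ?thesis by (rule run_mono) simp
  next
    case False
    obtain c' t where ct: "cstep x (c, s) = (c', t)" by fastforce
    then have "run x c' t k s'"
      using Suc.prems by (simp add: run_def funpow_Suc_right del: funpow.simps)
    from Suc.IH[OF this] have "run x (Seq c' d) t (k + l + 1) s''" .
    moreover have "cstep x (Seq c d, s) = (Seq c' d, t)"
      using ct False by (auto simp: cstep_def split: prod.splits)
    ultimately show ?thesis
      using run_Suc[of x "Seq c d" s "Seq c' d" t "k + l + 1" s''] by simp
  qed
qed

lemma run_Cond:
  assumes "holds x s t \<Longrightarrow> run x c s k s'" "\<not> holds x s t \<Longrightarrow> run x d s k s'"
  shows "run x (Cond t c d) s (Suc k) s'"
  using assms by (cases "holds x s t") (auto intro!: run_Suc simp: cstep_def exec_opt_def)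

lemma run_While:
  assumes "\<And>i. i < N \<Longrightarrow> holds x (S i) t \<and> run x c (S i) T (S (Suc i))"
    and "\<not> holds x (S N) t"
  shows "run x (While t c) (S 0) (N * (T + 2) + 1) (S N)"
  using assms
proof (induction N arbitrary: S)
  case 0
  then show ?case by (auto intro!: run_Suc run_Skip simp: cstep_def exec_opt_def)
next
  case (Suc N)
  have "run x (While t c) (S (Suc 0)) (N * (T + 2) + 1) (S (Suc N))"
    using Suc.IH[of "\<lambda>i. S (Suc i)"] Suc.prems by simp
  then have "run x (Seq c (While t c)) (S 0) (T + (N * (T + 2) + 1) + 1) (S (Suc N))"
    using Suc.prems(1)[of 0] run_Seq by blast
  moreover have "cstep x (While t c, S 0) = (Seq c (While t c), S 0)"
    using Suc.prems(1)[of 0] by (simp add: cstep_def exec_opt_def)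
  ultimately have "run x (While t c) (S 0) (Suc (T + (N * (T + 2) + 1) + 1)) (S (Suc N))"
    using run_Suc by blast
  then show ?case by (rule run_mono) simp
qed

subsection \<open>Simulation by a Turing machine\<close>

fun idx :: "ctr \<Rightarrow> nat" where
  "idx Flag = 0"
| "idx Aux = 1"
| "idx (Var j) = 2 * j + 2"
| "idx (Co j) = 2 * j + 3"

definition ctr_of :: "nat \<Rightarrow> ctr" where
  "ctr_of r = (if r = 0 then Flag else if r = 1 then Aux
     else if even r then Var (r div 2 - 1) else Co (r div 2 - 1))"

lemma ctr_of_idx [simp]: "ctr_of (idx c) = c"
  by (cases c) (auto simp: ctr_of_def)

lemma idx_ctr_of: "idx (ctr_of r) = r"
  by (auto simp: ctr_of_def elim!: evenE oddE)

lemma ctr_of_eq_iff: "ctr_of r = c \<longleftrightarrow> r = idx c"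
  using ctr_of_idx idx_ctr_of by metis

primrec instr_bound :: "nat \<Rightarrow> instr \<Rightarrow> bool" where
  "instr_bound K (Inc c) \<longleftrightarrow> idx c < K"
| "instr_bound K (Dec c) \<longleftrightarrow> idx c < K"
| "instr_bound K InR \<longleftrightarrow> True"
| "instr_bound K InL \<longleftrightarrow> True"
| "instr_bound K (Out b) \<longleftrightarrow> True"
| "instr_bound K OutL \<longleftrightarrow> True"
| "instr_bound K OutR \<longleftrightarrow> True"

primrec test_bound :: "nat \<Rightarrow> test \<Rightarrow> bool" where
  "test_bound K (Zero c) \<longleftrightarrow> idx c < K"
| "test_bound K (Sym a) \<longleftrightarrow> True"
| "test_bound K OutBlank \<longleftrightarrow> True"
| "test_bound K (Neg t) \<longleftrightarrow> test_bound K t"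
| "test_bound K (Both t u) \<longleftrightarrow> test_bound K t \<and> test_bound K u"

primrec com_bound :: "nat \<Rightarrow> com \<Rightarrow> bool" where
  "com_bound K Skip \<longleftrightarrow> True"
| "com_bound K (Do i) \<longleftrightarrow> instr_bound K i"
| "com_bound K (Seq c d) \<longleftrightarrow> com_bound K c \<and> com_bound K d"
| "com_bound K (Cond t c d) \<longleftrightarrow> test_bound K t \<and> com_bound K c \<and> com_bound K d"
| "com_bound K (While t c) \<longleftrightarrow> test_bound K t \<and> com_bound K c"

definition tapes :: "nat \<Rightarrow> bool list \<Rightarrow> state \<Rightarrow> tape list" where
  "tapes K x s = (\<lambda>i. input_tape x (i + ipos s)) # (\<lambda>i. otape s (i + opos s)) #
     map (\<lambda>r i. if i = - int (cnt s (ctr_of r)) then 1 else 0) [0..<K]"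

fun scan_holds :: "nat list \<Rightarrow> test \<Rightarrow> bool" where
  "scan_holds ss (Zero c) \<longleftrightarrow> ss ! (idx c + 2) = 1"
| "scan_holds ss (Sym a) \<longleftrightarrow> ss ! 0 = a"
| "scan_holds ss OutBlank \<longleftrightarrow> ss ! 1 = 0"
| "scan_holds ss (Neg t) \<longleftrightarrow> \<not> scan_holds ss t"
| "scan_holds ss (Both t u) \<longleftrightarrow> scan_holds ss t \<and> scan_holds ss u"

fun scan_act :: "nat list \<Rightarrow> instr \<Rightarrow> nat \<Rightarrow> nat \<times> int" where
  "scan_act ss (Inc c) r = (ss ! r, if r = idx c + 2 then 1 else 0)"
| "scan_act ss (Dec c) r = (ss ! r, if r = idx c + 2 \<and> ss ! r \<noteq> 1 then -1 else 0)"
| "scan_act ss InR r = (ss ! r, if r = 0 then 1 else 0)"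
| "scan_act ss InL r = (ss ! r, if r = 0 then -1 else 0)"
| "scan_act ss (Out b) r = (if r = 1 then (bit_sym b, 1) else (ss ! r, 0))"
| "scan_act ss OutL r = (ss ! r, if r = 1 then -1 else 0)"
| "scan_act ss OutR r = (ss ! r, if r = 1 then 1 else 0)"

definition scan_acts :: "nat \<Rightarrow> nat list \<Rightarrow> instr option \<Rightarrow> (nat \<times> int) list" where
  "scan_acts K ss io =
     map (\<lambda>r. case io of None \<Rightarrow> (ss ! r, 0) | Some i \<Rightarrow> scan_act ss i r) [0..<K + 2]"

lemma nth_tapes:
  "tapes K x s ! 0 = (\<lambda>i. input_tape x (i + ipos s))"
  "tapes K x s ! Suc 0 = (\<lambda>i. otape s (i + opos s))"
  "r < K \<Longrightarrow> tapes K x s ! Suc (Suc r) = (\<lambda>i. if i = - int (cnt s (ctr_of r)) then 1 else 0)"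
  by (auto simp: tapes_def)

lemma length_tapes [simp]: "length (tapes K x s) = K + 2"
  by (simp add: tapes_def)

lemma scan_holds_tapes:
  "test_bound K t \<Longrightarrow> scan_holds (map (\<lambda>t. t 0) (tapes K x s)) t \<longleftrightarrow> holds x s t"
  by (induction t) (auto simp: nth_tapes)

lemma act_shift: "act (f p, m) (\<lambda>i. f (i + p)) = (\<lambda>i. f (i + (p + m)))"
proof
  fix i
  show "act (f p, m) (\<lambda>i. f (i + p)) i = f (i + (p + m))"
  proof (cases "i = - m")
    case False
    then have "i + m \<noteq> 0" by simp
    then show ?thesis by (simp add: act_def add.commute add.left_commute)
  qed (simp add: act_def)
qed

lemma act_tapes:
  assumes "case io of None \<Rightarrow> True | Some i \<Rightarrow> instr_bound K i"
  shows "map2 act (scan_acts K (map (\<lambda>t. t 0) (tapes K x s)) io) (tapes K x s) =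
    tapes K x (exec_opt io s)"
proof (rule nth_equalityI)
  define ss where "ss = map (\<lambda>t. t 0) (tapes K x s)"
  fix r assume "r < length (map2 act (scan_acts K (map (\<lambda>t. t 0) (tapes K x s)) io) (tapes K x s))"
  then have r: "r < K + 2" by (simp add: scan_acts_def)
  have ss: "ss ! r = (tapes K x s ! r) 0" using r by (simp add: ss_def)
  have acts: "scan_acts K ss io ! r = (case io of None \<Rightarrow> (ss ! r, 0) | Some i \<Rightarrow> scan_act ss i r)"
    using r nth_upt[of 0 r "K + 2"]
    by (simp only: scan_acts_def nth_map length_upt add_0 diff_zero)
  have none: "act (ss ! r, 0) (tapes K x s ! r) = tapes K x s ! r"
    by (auto simp: ss act_def)
  have some: "act (scan_act ss i r) (tapes K x s ! r) = tapes K x (exec i s) ! r"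
    if i: "instr_bound K i" for i
  proof -
    consider (inp) "r = 0" | (out) "r = Suc 0" | (ctr) r' where "r = Suc (Suc r')" "r' < K"
      using r by (metis Suc_less_eq add_2_eq_Suc' not0_implies_Suc)
    then show ?thesis
    proof cases
      case inp
      have *: "act (input_tape x (ipos s), m) (\<lambda>i. input_tape x (i + ipos s)) =
        (\<lambda>i. input_tape x (i + (ipos s + m)))" for m
        by (rule act_shift)
      show ?thesis using ss unfolding inp
        by (cases i) (simp_all add: nth_tapes *)
    next
      case out
      have *: "act (otape s (opos s), m) (\<lambda>i. otape s (i + opos s)) =
        (\<lambda>i. otape s (i + (opos s + m)))" for m
        by (rule act_shift)
      show ?thesis using ss unfolding out
        by (cases i) (simp_all add: nth_tapes *, auto simp: act_def fun_eq_iff add.commute add.left_commute)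
    next
      case ctr
      then show ?thesis using ss i
        by (cases i) (auto simp: act_def nth_tapes fun_eq_iff ctr_of_eq_iff)
    qed
  qed
  have "act (scan_acts K ss io ! r) (tapes K x s ! r) = tapes K x (exec_opt io s) ! r"
    unfolding acts using none some assms by (cases io) (simp_all add: exec_opt_def)
  then show "map2 act (scan_acts K (map (\<lambda>t. t 0) (tapes K x s)) io) (tapes K x s) ! r =
    tapes K x (exec_opt io s) ! r"
    using r by (simp add: scan_acts_def ss_def del: upt_Suc)
qed (simp add: scan_acts_def)

fun conts :: "com \<Rightarrow> com set" where
  "conts Skip = {Skip}"
| "conts (Do i) = {Do i, Skip}"
| "conts (Seq c d) = (\<lambda>c'. Seq c' d) ` conts c \<union> conts d"
| "conts (Cond t c d) = {Cond t c d} \<union> conts c \<union> conts d"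
| "conts (While t c) = {While t c, Skip} \<union> (\<lambda>c'. Seq c' (While t c)) ` conts c"

lemma finite_conts: "finite (conts c)"
  by (induction c) auto

lemma conts_refl: "c \<in> conts c"
  by (induction c) auto

lemma Skip_conts: "Skip \<in> conts c"
  by (induction c) auto

lemma next_com_conts: "d \<in> conts c \<Longrightarrow> fst (next_com h d) \<in> conts c"
proof (induction c arbitrary: d)
  case (Seq c1 c2)
  then show ?case by (auto simp: conts_refl split: if_splits)
next
  case (While t c)
  then show ?case by (auto simp: conts_refl split: if_splits)
qed (auto simp: conts_refl split: if_splits)

lemma conts_bound:
  assumes "com_bound K c" "d \<in> conts c"
  shows "com_bound K d"
proof -
  define B where "B = Collect (com_bound K)"
  have B: "d \<in> B \<longleftrightarrow> com_bound K d" for d by (simp add: B_def)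
  have "c \<in> B \<longrightarrow> conts c \<subseteq> B"
    by (induction c) (auto simp: B[of "Skip"] B[of "Do _"] B[of "Seq _ _"] B[of "Cond _ _ _"] B[of "While _ _"]
        simp flip: B)
  then show ?thesis using assms B by blast
qed

lemma next_com_cong:
  assumes "com_bound K c" "\<And>t. test_bound K t \<Longrightarrow> h t = h' t"
  shows "next_com h c = next_com h' c"
  using assms(1) by (induction c) (simp_all add: assms(2))

lemma next_com_bound:
  "com_bound K c \<Longrightarrow> case snd (next_com h c) of None \<Rightarrow> True | Some i \<Rightarrow> instr_bound K i"
  by (induction c) simp_all

definition init_state :: state where
  "init_state = \<lparr>ipos = 0, otape = (\<lambda>_. 0), opos = 0, cnt = (\<lambda>_. 0)\<rparr>"

lemma scan_acts_wf:
  assumes "length ss = K + 2" "set ss \<subseteq> {..<3}"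
  shows "length (scan_acts K ss io) = K + 2" "set (scan_acts K ss io) \<subseteq> {..<3} \<times> {-1, 0, 1}"
proof -
  show "set (scan_acts K ss io) \<subseteq> {..<3} \<times> {-1, 0, 1}"
  proof
    fix z assume "z \<in> set (scan_acts K ss io)"
    then obtain r where r: "r < K + 2"
        "z = (case io of None \<Rightarrow> (ss ! r, 0) | Some i \<Rightarrow> scan_act ss i r)"
      unfolding scan_acts_def set_map set_upt by force
    have "ss ! r < 3" using subsetD[OF assms(2) nth_mem[of r ss]] assms(1) r(1) by simp
    moreover have "scan_act ss i r \<in> {..<3} \<times> {-1, 0, 1}" if "ss ! r < 3" for i
      using that by (cases i) (simp_all add: bit_sym_def)
    ultimately show "z \<in> {..<3} \<times> {-1, 0, 1}" using r(2) by (cases io) simp_all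
  qed
qed (simp add: scan_acts_def)

theorem poly_time_com:
  assumes "com_bound K c"
    and "\<And>x. \<exists>s'. run x c init_state ((length x + 2) ^ a) s' \<and> output_is (\<lambda>i. otape s' (i + opos s')) (f x)"
  shows "poly_time f"
proof -
  define C where "C = conts c - {Skip}"
  have "finite C" by (simp add: C_def finite_conts)
  then obtain g0 where g0: "bij_betw g0 C {0..<card C}"
    using ex_bij_betw_finite_nat by blast
  define Q where "Q = Suc (card C)"
  define code where "code d = (if d = Skip then Q else Suc (g0 d))" for d
  have code_less: "0 < code d \<and> code d \<le> Q \<and> (code d = Q \<longleftrightarrow> d = Skip)" if "d \<in> conts c" for d
  proof (cases "d = Skip")
    case False
    then have "g0 d < card C" using that g0 by (auto simp: C_def bij_betw_def)
    then show ?thesis using False by (simp add: code_def Q_def)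
  qed (simp add: code_def Q_def)
  have code_inj: "inj_on code (conts c)"
  proof (rule inj_onI)
    fix d e assume de: "d \<in> conts c" "e \<in> conts c" "code d = code e"
    show "d = e"
    proof (cases "d = Skip \<or> e = Skip")
      case True then show ?thesis using code_less[of d] code_less[of e] de by auto
    next
      case False
      then have "d \<in> C" "e \<in> C" "g0 d = g0 e" using de by (auto simp: C_def code_def)
      then show ?thesis using g0 by (auto simp: bij_betw_def inj_on_def)
    qed
  qed
  define dec where "dec q = (if q \<in> code ` conts c then the_inv_into (conts c) code q else Skip)" for q
  have dec_code: "dec (code d) = d" if "d \<in> conts c" for d
    using that code_inj by (simp add: dec_def the_inv_into_f_f)
  have dec_conts: "dec q \<in> conts c" for q
    using the_inv_into_into[OF code_inj] Skip_conts by (auto simp: dec_def)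
  define dl where "dl q ss = (if q = 0 then (code c, map (\<lambda>r. (if r < 2 then ss ! r else 1, 0)) [0..<K + 2])
     else (code (fst (next_com (scan_holds ss) (dec q))),
       scan_acts K ss (snd (next_com (scan_holds ss) (dec q)))))"
    for q :: nat and ss
  define M where "M = \<lparr>ntapes = K + 2, nsyms = 3, nstates = Q, delta = dl\<rparr>"
  have wf: "wf_tm M"
    unfolding wf_tm_def
  proof (intro conjI allI impI)
    fix q ss assume q: "q < nstates M" and "length ss = ntapes M \<and> set ss \<subseteq> {..<nsyms M}"
    then have ss: "length ss = K + 2" "set ss \<subseteq> {..<3}" by (auto simp: M_def)
    have s3: "ss ! r < 3" if "r < K + 2" for r
      using subsetD[OF ss(2) nth_mem[of r ss]] ss(1) that by simp
    show "fst (delta M q ss) \<le> nstates M"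
      using code_less[OF conts_refl] code_less[OF next_com_conts[OF dec_conts]]
      by (simp add: M_def dl_def)
    show "length (snd (delta M q ss)) = ntapes M"
      using scan_acts_wf(1)[OF ss] by (simp add: M_def dl_def del: upt_Suc)
    show "set (snd (delta M q ss)) \<subseteq> {..<nsyms M} \<times> {-1, 0, 1}"
      using scan_acts_wf(2)[OF ss] s3 by (auto simp: M_def dl_def simp del: upt_Suc)
  qed (auto simp: M_def)
  have sim: "step M (code d, tapes K x s) = (code (fst (cstep x (d, s))), tapes K x (snd (cstep x (d, s))))
     \<and> fst (cstep x (d, s)) \<in> conts c"
    if d: "d \<in> conts c" for d x s
  proof (cases "d = Skip")
    case True
    then show ?thesis using d by (simp add: step_def M_def code_def cstep_def exec_opt_def)
  next
    case False
    let ?ss = "map (\<lambda>t. t 0) (tapes K x s)"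
    obtain d' io where n: "next_com (holds x s) d = (d', io)" by fastforce
    have bd: "com_bound K d" using conts_bound[OF assms(1) d] .
    have n': "next_com (scan_holds ?ss) d = (d', io)"
      using next_com_cong[OF bd] scan_holds_tapes n by metis
    have "map2 act (scan_acts K ?ss io) (tapes K x s) = tapes K x (exec_opt io s)"
      using next_com_bound[OF bd, of "holds x s"] n by (intro act_tapes) auto
    moreover have "code d < Q" "code d \<noteq> 0" using code_less[OF d] False by auto
    ultimately have "step M (code d, tapes K x s) = (code d', tapes K x (exec_opt io s))"
      using n' by (simp add: step_def M_def dl_def dec_code[OF d])
    moreover have "d' \<in> conts c" using next_com_conts[OF d, of "holds x s"] n by simp
    ultimately show ?thesis using n by (simp add: cstep_def)
  qed
  have sims: "(step M ^^ k) (code c, tapes K x s) =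
      (code (fst ((cstep x ^^ k) (c, s))), tapes K x (snd ((cstep x ^^ k) (c, s)))) \<and>
      fst ((cstep x ^^ k) (c, s)) \<in> conts c" for k x s
  proof (induction k)
    case (Suc k)
    then show ?case using sim[of "fst ((cstep x ^^ k) (c, s))" x "snd ((cstep x ^^ k) (c, s))"] by simp
  qed (simp add: conts_refl)
  have init: "step M (init M x) = (code c, tapes K x init_state)" for x
  proof -
    have len: "length (snd (init M x)) = K + 2" by (simp add: init_def M_def)
    have "map2 act (map (\<lambda>r. (if r < 2 then map (\<lambda>t. t 0) (snd (init M x)) ! r else 1, 0)) [0..<K + 2]) (snd (init M x))
      = tapes K x init_state"
    proof (rule nth_equalityI)
      fix r assume "r < length (map2 act (map (\<lambda>r. (if r < 2 then map (\<lambda>t. t 0) (snd (init M x)) ! r else 1, 0)) [0..<K + 2]) (snd (init M x)))"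
      then have r: "r < K + 2" by (simp add: len)
      consider "r = 0" | "r = Suc 0" | r' where "r = Suc (Suc r')" "r' < K"
        using r by (metis Suc_less_eq add_2_eq_Suc' not0_implies_Suc)
      then show "map2 act (map (\<lambda>r. (if r < 2 then map (\<lambda>t. t 0) (snd (init M x)) ! r else 1, 0)) [0..<K + 2]) (snd (init M x)) ! r
        = tapes K x init_state ! r"
      proof cases
        case 3
        then show ?thesis using r len
          by (simp add: nth_tapes del: upt_Suc) (auto simp: act_def init_def M_def init_state_def fun_eq_iff)
      qed (use r len in \<open>simp_all add: nth_tapes del: upt_Suc\<close>,
           auto simp: act_def init_def M_def init_state_def fun_eq_iff)
    qed (simp add: len)
    moreover have "step M (init M x) = (code c, map2 act (map (\<lambda>r. (if r < 2 then map (\<lambda>t. t 0) (snd (init M x)) ! r else 1, 0)) [0..<K + 2]) (snd (init M x)))"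
    proof -
      have dl0: "dl 0 ss = (code c, map (\<lambda>r. (if r < 2 then ss ! r else 1, 0)) [0..<K + 2])" for ss
        by (simp add: dl_def)
      have "step M (0, ts) = (code c, map2 act (map (\<lambda>r. (if r < 2 then map (\<lambda>t. t 0) ts ! r else 1, 0)) [0..<K + 2]) ts)"
        for ts
        unfolding step_def by (simp add: M_def Q_def dl0 del: upt_Suc)
      moreover have "init M x = (0, snd (init M x))" by (simp add: init_def)
      ultimately show ?thesis by metis
    qed
    ultimately show ?thesis by simp
  qed
  show ?thesis
    unfolding poly_time_def
  proof (rule exI[of _ M], rule exI[of _ "[:2, 1:] ^ a + 1"], intro conjI allI)
    show "wf_tm M" by (rule wf)
    fix x
    obtain s' where s': "run x c init_state ((length x + 2) ^ a) s'"
        "output_is (\<lambda>i. otape s' (i + opos s')) (f x)"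
      using assms(2) by blast
    let ?k = "(length x + 2) ^ a"
    have "(step M ^^ Suc ?k) (init M x) = (nstates M, tapes K x s')"
      using sims[of ?k x init_state] s'(1) init
      by (simp add: funpow_Suc_right run_def code_def M_def del: funpow.simps)
    moreover have "Suc ?k \<le> poly ([:2, 1:] ^ a + 1) (length x)"
      by (simp add: add.commute)
    moreover have "output_is (tapes K x s' ! 1) (f x)"
      using s'(2) by (simp add: nth_tapes)
    ultimately show "\<exists>k\<le>poly ([:2, 1:] ^ a + 1) (length x). \<exists>ts.
        (step M ^^ k) (init M x) = (nstates M, ts) \<and> output_is (ts ! 1) (f x)"
      by blast
  qed
qed

subsection \<open>Loop programs over the input\<close>

text \<open>The environment is the list of the values of the enclosing loop variables, outermost first;
  \<open>mem\<close> consists of a flag, the position of the input head and the output written so far.\<close>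

datatype prog = Stay | Then prog prog | For prog | Less nat nat | Flip | SetFlag bool
  | IfFlag prog prog | Move | Rewind | Read | AtEnd | Emit bool

type_synonym mem = "bool \<times> nat \<times> bool list"

fun sem :: "bool list \<Rightarrow> nat \<Rightarrow> prog \<Rightarrow> nat list \<Rightarrow> mem \<Rightarrow> mem" where
  "sem x n Stay \<sigma> m = m"
| "sem x n (Then p q) \<sigma> m = sem x n q \<sigma> (sem x n p \<sigma> m)"
| "sem x n (For p) \<sigma> m = fold (\<lambda>i. sem x n p (\<sigma> @ [i])) [0..<n] m"
| "sem x n (Less v w) \<sigma> (b, i, ys) = (\<sigma> ! v < \<sigma> ! w, i, ys)"
| "sem x n Flip \<sigma> (b, i, ys) = (\<not> b, i, ys)"
| "sem x n (SetFlag c) \<sigma> (b, i, ys) = (c, i, ys)"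
| "sem x n (IfFlag p q) \<sigma> (b, i, ys) = (if b then sem x n p \<sigma> (b, i, ys) else sem x n q \<sigma> (b, i, ys))"
| "sem x n Move \<sigma> (b, i, ys) = (b, if i < length x then Suc i else i, ys)"
| "sem x n Rewind \<sigma> (b, i, ys) = (b, 0, ys)"
| "sem x n Read \<sigma> (b, i, ys) = (i < length x \<and> x ! i, i, ys)"
| "sem x n AtEnd \<sigma> (b, i, ys) = (length x \<le> i, i, ys)"
| "sem x n (Emit c) \<sigma> (b, i, ys) = (b, i, ys @ [c])"

fun wf_prog :: "nat \<Rightarrow> prog \<Rightarrow> bool" where
  "wf_prog k (Then p q) \<longleftrightarrow> wf_prog k p \<and> wf_prog k q"
| "wf_prog k (For p) \<longleftrightarrow> wf_prog (Suc k) p"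
| "wf_prog k (Less v w) \<longleftrightarrow> v < k \<and> w < k"
| "wf_prog k (IfFlag p q) \<longleftrightarrow> wf_prog k p \<and> wf_prog k q"
| "wf_prog k _ \<longleftrightarrow> True"

fun depth :: "prog \<Rightarrow> nat" where
  "depth (Then p q) = max (depth p) (depth q)"
| "depth (For p) = Suc (depth p)"
| "depth (IfFlag p q) = max (depth p) (depth q)"
| "depth _ = 0"

definition set_flag :: "bool \<Rightarrow> com" where
  "set_flag b = (if b then Cond (Zero Flag) (Do (Inc Flag)) Skip
     else Cond (Zero Flag) Skip (Do (Dec Flag)))"

fun compile :: "nat \<Rightarrow> prog \<Rightarrow> com" where
  "compile k Stay = Skip"
| "compile k (Then p q) = Seq (compile k p) (compile k q)"
| "compile k (For p) = Seq
     (While (Neg (Zero (Co k)))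
       (Seq (compile (Suc k) p) (Seq (Do (Inc (Var k))) (Do (Dec (Co k))))))
     (While (Neg (Zero (Var k))) (Seq (Do (Dec (Var k))) (Do (Inc (Co k)))))"
| "compile k (Less v w) = (if v = w then set_flag False else
     Seq (While (Both (Neg (Zero (Var v))) (Neg (Zero (Var w))))
           (Seq (Do (Dec (Var v))) (Seq (Do (Dec (Var w))) (Do (Inc Aux)))))
     (Seq (Cond (Zero (Var w)) (set_flag False) (set_flag True))
       (While (Neg (Zero Aux)) (Seq (Do (Dec Aux)) (Seq (Do (Inc (Var v))) (Do (Inc (Var w))))))))"
| "compile k Flip = Cond (Zero Flag) (Do (Inc Flag)) (Do (Dec Flag))"
| "compile k (SetFlag b) = set_flag b"
| "compile k (IfFlag p q) = Cond (Zero Flag) (compile k q) (compile k p)"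
| "compile k Move = Cond (Sym 0) Skip (Do InR)"
| "compile k Rewind = Seq (Do InL) (Seq (While (Neg (Sym 0)) (Do InL)) (Do InR))"
| "compile k Read = Cond (Sym 2) (set_flag True) (set_flag False)"
| "compile k AtEnd = Cond (Sym 0) (set_flag True) (set_flag False)"
| "compile k (Emit b) = Do (Out b)"

text \<open>A loop variable with value \<open>v\<close> is kept as the pair of counters \<open>v\<close> and \<open>n - v\<close>, so that
  both ends of its range are recognised by a zero test.\<close>

definition ctrs :: "nat \<Rightarrow> nat \<Rightarrow> nat list \<Rightarrow> bool \<Rightarrow> ctr \<Rightarrow> nat" where
  "ctrs n l \<sigma> b c = (case c of Flag \<Rightarrow> of_bool b | Aux \<Rightarrow> 0
     | Var j \<Rightarrow> if j < length \<sigma> then \<sigma> ! j else 0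
     | Co j \<Rightarrow> if j < l then n - (if j < length \<sigma> then \<sigma> ! j else 0) else 0)"

definition represent :: "nat \<Rightarrow> nat \<Rightarrow> nat list \<Rightarrow> mem \<Rightarrow> state" where
  "represent n l \<sigma> m = (case m of (b, i, ys) \<Rightarrow>
     \<lparr>ipos = int i, otape = input_tape ys, opos = int (length ys), cnt = ctrs n l \<sigma> b\<rparr>)"

lemma ctrs_simps [simp]:
  "ctrs n l \<sigma> b Flag = of_bool b"
  "ctrs n l \<sigma> b Aux = 0"
  "ctrs n l \<sigma> b (Var j) = (if j < length \<sigma> then \<sigma> ! j else 0)"
  "ctrs n l \<sigma> b (Co j) = (if j < l then n - (if j < length \<sigma> then \<sigma> ! j else 0) else 0)"
  by (auto simp: ctrs_def)

lemma ctrs_snoc: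
  assumes "length \<sigma> < l" "v \<le> n"
  shows "ctrs n l (\<sigma> @ [v]) b = (ctrs n l \<sigma> b)(Var (length \<sigma>) := v, Co (length \<sigma>) := n - v)"
proof
  fix c show "ctrs n l (\<sigma> @ [v]) b c = ((ctrs n l \<sigma> b)(Var (length \<sigma>) := v, Co (length \<sigma>) := n - v)) c"
    using assms by (cases c) (auto simp: nth_append)
qed

lemma ctrs_flag: "(ctrs n l \<sigma> b)(Flag := of_bool b') = ctrs n l \<sigma> b'"
proof
  fix c show "((ctrs n l \<sigma> b)(Flag := of_bool b')) c = ctrs n l \<sigma> b' c" by (cases c) auto
qed

lemma represent_simps [simp]:
  "ipos (represent n l \<sigma> (b, i, ys)) = int i"
  "otape (represent n l \<sigma> (b, i, ys)) = input_tape ys"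
  "opos (represent n l \<sigma> (b, i, ys)) = int (length ys)"
  "cnt (represent n l \<sigma> (b, i, ys)) = ctrs n l \<sigma> b"
  by (auto simp: represent_def)

definition timed :: "bool list \<Rightarrow> com \<Rightarrow> state \<Rightarrow> nat \<Rightarrow> state \<Rightarrow> bool" where
  "timed x c s a s' \<longleftrightarrow> run x c s ((length x + 2) ^ a) s'"

lemma timed_mono: "timed x c s a s' \<Longrightarrow> a \<le> b \<Longrightarrow> timed x c s b s'"
  unfolding timed_def by (erule run_mono) (simp add: power_increasing)

lemma timed_Skip: "timed x Skip s a s"
  by (simp add: timed_def run_Skip)

lemma timed_Do: "timed x (Do i) s a (exec i s)"
  unfolding timed_def by (rule run_mono[OF run_Do]) simp

lemma timed_Do': "exec i s = s' \<Longrightarrow> timed x (Do i) s a s'"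
  using timed_Do by metis

lemma timed_Seq:
  assumes "timed x c s a s'" "timed x d s' b s''"
  shows "timed x (Seq c d) s (a + b + 2) s''"
  unfolding timed_def
proof (rule run_mono[OF run_Seq[OF assms[unfolded timed_def]]])
  define L where "L = length x + 2"
  have "1 \<le> L ^ a" "1 \<le> L ^ b" by (simp_all add: L_def)
  then have "L ^ a \<le> L ^ a * L ^ b" "L ^ b \<le> L ^ a * L ^ b" "1 \<le> L ^ a * L ^ b"
    by (simp_all add: Suc_le_eq)
  then have "L ^ a + L ^ b + 1 \<le> 3 * (L ^ a * L ^ b)" by linarith
  also have "\<dots> \<le> (L * L) * (L ^ a * L ^ b)"
    by (rule mult_le_mono1) (simp add: L_def algebra_simps)
  also have "\<dots> = L ^ (a + b + 2)" by (simp add: power_add power2_eq_square)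
  finally show "(length x + 2) ^ a + (length x + 2) ^ b + 1 \<le> (length x + 2) ^ (a + b + 2)"
    unfolding L_def .
qed

lemma timed_Cond:
  assumes "holds x s t \<Longrightarrow> timed x c s a s'" "\<not> holds x s t \<Longrightarrow> timed x d s a s'"
  shows "timed x (Cond t c d) s (a + 1) s'"
  unfolding timed_def
proof (rule run_mono[OF run_Cond])
  have "2 * (length x + 2) ^ a \<le> (length x + 2) * (length x + 2) ^ a"
    by (rule mult_le_mono1) simp
  moreover have "1 \<le> (length x + 2) ^ a" by simp
  ultimately show "Suc ((length x + 2) ^ a) \<le> (length x + 2) ^ (a + 1)"
    by (simp only: power_add power_one_right mult.commute)
qed (use assms in \<open>auto simp: timed_def\<close>)

lemma timed_While_gen:
  assumes "\<And>i. i < N \<Longrightarrow> holds x (S i) t \<and> timed x c (S i) a (S (Suc i))"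
    and "\<not> holds x (S N) t" "N \<le> (length x + 2) ^ e"
    and "S 0 = s" "S N = s'"
  shows "timed x (While t c) s (a + e + 2) s'"
  unfolding timed_def assms(4,5)[symmetric]
proof (rule run_mono[OF run_While])
  define L where "L = length x + 2"
  have "1 \<le> L ^ a" "1 \<le> L ^ e" by (simp_all add: L_def)
  then have "L ^ e \<le> L ^ a * L ^ e" "1 \<le> L ^ a * L ^ e" by (simp_all add: Suc_le_eq)
  moreover have "N * (L ^ a + 2) + 1 \<le> L ^ e * (L ^ a + 2) + 1"
    using assms(3) by (simp add: L_def del: mult_Suc_right add_2_eq_Suc')
  moreover have "L ^ e * (L ^ a + 2) + 1 = L ^ a * L ^ e + 2 * L ^ e + 1"
    by (simp add: algebra_simps)
  ultimately have "N * (L ^ a + 2) + 1 \<le> 4 * (L ^ a * L ^ e)" by linarith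
  also have "\<dots> \<le> (L * L) * (L ^ a * L ^ e)"
    by (rule mult_le_mono1) (simp add: L_def algebra_simps)
  also have "\<dots> = L ^ (a + e + 2)" by (simp add: power_add power2_eq_square)
  finally show "N * ((length x + 2) ^ a + 2) + 1 \<le> (length x + 2) ^ (a + e + 2)"
    unfolding L_def .
qed (use assms in \<open>auto simp: timed_def\<close>)

lemma timed_While:
  assumes "\<And>i. i < N \<Longrightarrow> holds x (S i) t \<and> timed x c (S i) a (S (Suc i))"
    and "\<not> holds x (S N) t" "N \<le> length x + 1"
    and "S 0 = s" "S N = s'"
  shows "timed x (While t c) s (a + 3) s'"
proof -
  have "N \<le> (length x + 2) ^ 1" using assms(3) by simp
  from timed_While_gen[OF assms(1,2) this assms(4,5)] show ?thesis by (simp add: eval_nat_numeral)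
qed

lemma timed_set_flag_cnt:
  assumes "cnt s Flag = of_bool b"
  shows "timed x (set_flag c) s 1 (s\<lparr>cnt := (cnt s)(Flag := of_bool c)\<rparr>)"
proof -
  let ?s = "s\<lparr>cnt := (cnt s)(Flag := of_bool c)\<rparr>"
  have same: "?s = s" if "b = c"
  proof -
    have "(cnt s)(Flag := of_bool c) = cnt s" using that assms by (simp add: fun_upd_idem)
    then show ?thesis by (cases s) simp
  qed
  have "timed x (set_flag c) s (0 + 1) ?s"
  proof (cases c)
    case True
    have "timed x (Cond (Zero Flag) (Do (Inc Flag)) Skip) s (0 + 1) ?s"
    proof (rule timed_Cond)
      assume "holds x s (Zero Flag)"
      then show "timed x (Do (Inc Flag)) s 0 ?s" using True by (intro timed_Do') simp
    next
      assume "\<not> holds x s (Zero Flag)"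
      then have "?s = s" using True assms same by (cases b) simp_all
      then show "timed x Skip s 0 ?s" by (metis timed_Skip)
    qed
    then show ?thesis using True by (simp add: set_flag_def)
  next
    case False
    have "timed x (Cond (Zero Flag) Skip (Do (Dec Flag))) s (0 + 1) ?s"
    proof (rule timed_Cond)
      assume "\<not> holds x s (Zero Flag)"
      then show "timed x (Do (Dec Flag)) s 0 ?s" using False assms by (intro timed_Do') (cases b; simp)
    next
      assume "holds x s (Zero Flag)"
      then have "?s = s" using False assms same by (cases b) simp_all
      then show "timed x Skip s 0 ?s" by (metis timed_Skip)
    qed
    then show ?thesis using False by (simp add: set_flag_def)
  qed
  then show ?thesis by simp
qed

lemma timed_set_flag: "timed x (set_flag b) (represent n l \<sigma> (b', i, ys)) 1 (represent n l \<sigma> (b, i, ys))"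
proof -
  have "(represent n l \<sigma> (b', i, ys))\<lparr>cnt := (cnt (represent n l \<sigma> (b', i, ys)))(Flag := of_bool b)\<rparr>
    = represent n l \<sigma> (b, i, ys)"
    by (simp add: represent_def ctrs_flag)
  then show ?thesis using timed_set_flag_cnt[of "represent n l \<sigma> (b', i, ys)" b' x b] by simp
qed

fun expo :: "prog \<Rightarrow> nat" where
  "expo (Then p q) = expo p + expo q + 2"
| "expo (For p) = (expo p + (0 + 0 + 2) + 2 + 3) + ((0 + 0 + 2) + 3) + 2"
| "expo (IfFlag p q) = expo p + expo q + 1"
| "expo _ = 30"

lemma sem_ipos: "fst (snd m) \<le> length x \<Longrightarrow> fst (snd (sem x n p \<sigma> m)) \<le> length x"
proof (induction x n p \<sigma> m rule: sem.induct)
  case (3 x n p \<sigma> m)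
  have "set is \<subseteq> {..<n} \<Longrightarrow> fst (snd m) \<le> length x \<Longrightarrow>
      fst (snd (fold (\<lambda>i. sem x n p (\<sigma> @ [i])) is m)) \<le> length x" for "is" m
    using 3(1) by (induction "is" arbitrary: m) auto
  then show ?case using 3(2) by (simp add: atLeast0LessThan)
qed auto

lemma compile_correct:
  assumes "wf_prog (length \<sigma>) p" "set \<sigma> \<subseteq> {..n}" "length \<sigma> + depth p \<le> l"
    and "n \<le> length x" "fst (snd m) \<le> length x"
  shows "timed x (compile (length \<sigma>) p) (represent n l \<sigma> m) (expo p) (represent n l \<sigma> (sem x n p \<sigma> m))"
  using assms
proof (induction p arbitrary: \<sigma> m)
  case Stay
  then show ?case by (simp add: timed_Skip)
next
  case (Then p q)
  then have "timed x (compile (length \<sigma>) p) (represent n l \<sigma> m) (expo p) (represent n l \<sigma> (sem x n p \<sigma> m))"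
    by simp
  moreover have "timed x (compile (length \<sigma>) q) (represent n l \<sigma> (sem x n p \<sigma> m)) (expo q)
      (represent n l \<sigma> (sem x n q \<sigma> (sem x n p \<sigma> m)))"
    using Then sem_ipos by simp
  ultimately show ?case using timed_Seq by simp
next
  case (For p)
  define k where "k = length \<sigma>"
  have k: "k < l" using For.prems by (simp add: k_def)
  have snoc: "ctrs n l (\<sigma> @ [v]) b = (ctrs n l \<sigma> b)(Var k := v, Co k := n - v)" if "v \<le> n" for v b
    using ctrs_snoc that k by (simp add: k_def)
  define ms where "ms j = fold (\<lambda>i. sem x n p (\<sigma> @ [i])) [0..<j] m" for j
  have ms: "fst (snd (ms j)) \<le> length x" for j
    using sem_ipos For.prems(5) by (induction j) (auto simp: ms_def)
  have ms_Suc: "ms (Suc j) = sem x n p (\<sigma> @ [j]) (ms j)" for j by (simp add: ms_def)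
  define S where "S j = represent n l (\<sigma> @ [j]) (ms j)" for j
  have upd: "exec (Dec (Co k)) (exec (Inc (Var k)) (represent n l (\<sigma> @ [j]) m')) = represent n l (\<sigma> @ [Suc j]) m'"
    if "j < n" for j m'
    using that k by (cases m') (auto simp: represent_def snoc fun_upd_twist Suc_diff_Suc)
  have W1: "timed x (While (Neg (Zero (Co k))) (Seq (compile (Suc k) p) (Seq (Do (Inc (Var k))) (Do (Dec (Co k))))))
      (S 0) (expo p + (0 + 0 + 2) + 2 + 3) (S n)"
  proof (rule timed_While[where S = S and N = n])
    fix j assume j: "j < n"
    have A: "timed x (compile (length (\<sigma> @ [j])) p) (S j) (expo p) (represent n l (\<sigma> @ [j]) (ms (Suc j)))"
      unfolding S_def ms_Suc using For.prems ms j by (intro For.IH) auto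
    have B: "timed x (Seq (Do (Inc (Var k))) (Do (Dec (Co k)))) (represent n l (\<sigma> @ [j]) (ms (Suc j))) (0 + 0 + 2) (S (Suc j))"
      unfolding S_def upd[OF j, symmetric] by (rule timed_Seq[OF timed_Do timed_Do])
    show "holds x (S j) (Neg (Zero (Co k))) \<and>
        timed x (Seq (compile (Suc k) p) (Seq (Do (Inc (Var k))) (Do (Dec (Co k))))) (S j) (expo p + (0 + 0 + 2) + 2) (S (Suc j))"
      using timed_Seq[OF A B] j k by (cases "ms j") (simp add: S_def k_def)
  next
    show "\<not> holds x (S n) (Neg (Zero (Co k)))" using k by (cases "ms n") (auto simp: S_def k_def)
  qed (use For.prems in auto)
  have W2: "timed x (While (Neg (Zero (Var k))) (Seq (Do (Dec (Var k))) (Do (Inc (Co k))))) (S n)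
     ((0 + 0 + 2) + 3) (represent n l (\<sigma> @ [0]) (ms n))"
  proof (rule timed_While[where S = "\<lambda>j. represent n l (\<sigma> @ [n - j]) (ms n)" and N = n])
    fix j assume j: "j < n"
    have "exec (Inc (Co k)) (exec (Dec (Var k)) (represent n l (\<sigma> @ [n - j]) (ms n))) = represent n l (\<sigma> @ [n - Suc j]) (ms n)"
      using j k by (cases "ms n") (auto simp: represent_def snoc fun_upd_twist Suc_diff_Suc)
    then have "timed x (Seq (Do (Dec (Var k))) (Do (Inc (Co k)))) (represent n l (\<sigma> @ [n - j]) (ms n)) (0 + 0 + 2)
        (represent n l (\<sigma> @ [n - Suc j]) (ms n))"
      using timed_Seq[OF timed_Do timed_Do] by metis
    then show "holds x (represent n l (\<sigma> @ [n - j]) (ms n)) (Neg (Zero (Var k))) \<and>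
       timed x (Seq (Do (Dec (Var k))) (Do (Inc (Co k)))) (represent n l (\<sigma> @ [n - j]) (ms n)) (0 + 0 + 2)
        (represent n l (\<sigma> @ [n - Suc j]) (ms n))"
      using j by (cases "ms n") (auto simp: k_def)
  next
    show "\<not> holds x (represent n l (\<sigma> @ [n - n]) (ms n)) (Neg (Zero (Var k)))"
      by (cases "ms n") (auto simp: k_def)
  qed (use For.prems in \<open>auto simp: S_def\<close>)
  have zero: "represent n l (\<sigma> @ [0]) m' = represent n l \<sigma> m'" for m'
  proof -
    have "(ctrs n l \<sigma> b)(Var k := 0, Co k := n) = ctrs n l \<sigma> b" for b
      using k by (auto simp: fun_eq_iff k_def)
    then show ?thesis using k by (cases m') (auto simp: represent_def snoc)
  qed
  have "timed x (compile k (For p)) (represent n l (\<sigma> @ [0]) (ms 0)) (expo (For p)) (represent n l \<sigma> (ms n))"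
    using timed_Seq[OF W1 W2] by (simp add: S_def zero)
  then show ?case by (simp add: k_def zero ms_def)
next
  case (Less v w)
  obtain b i ys where m: "m = (b, i, ys)" by (cases m)
  have vw: "v < length \<sigma>" "w < length \<sigma>" using Less.prems by auto
  show ?case
  proof (cases "v = w")
    case True
    then show ?thesis using timed_mono[OF timed_set_flag] by (simp add: m)
  next
    case False
    define N where "N = min (\<sigma> ! v) (\<sigma> ! w)"
    define S where "S b j = (represent n l \<sigma> (b, i, ys))
      \<lparr>cnt := (ctrs n l \<sigma> b)(Var v := \<sigma> ! v - j, Var w := \<sigma> ! w - j, Aux := j)\<rparr>" for b j
    have "\<sigma> ! v \<le> n" using subsetD[OF Less.prems(2) nth_mem[OF vw(1)]] by simp
    then have N: "N \<le> length x + 1" using Less.prems(4) by (simp add: N_def)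
    have S0: "S b' 0 = represent n l \<sigma> (b', i, ys)" for b'
    proof -
      have "(ctrs n l \<sigma> b')(Var v := \<sigma> ! v, Var w := \<sigma> ! w, Aux := 0) = ctrs n l \<sigma> b'"
        using vw by (auto simp: fun_eq_iff)
      then show ?thesis by (simp add: S_def represent_def)
    qed
    have 1: "timed x (While (Both (Neg (Zero (Var v))) (Neg (Zero (Var w))))
           (Seq (Do (Dec (Var v))) (Seq (Do (Dec (Var w))) (Do (Inc Aux))))) (S b 0) ((0 + (0 + 0 + 2) + 2) + 3) (S b N)"
    proof (rule timed_While[where S = "S b" and N = N])
      fix j assume j: "j < N"
      have "exec (Inc Aux) (exec (Dec (Var w)) (exec (Dec (Var v)) (S b j))) = S b (Suc j)"
        using False by (auto simp: S_def represent_def fun_upd_twist)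
      then have "timed x (Seq (Do (Dec (Var v))) (Seq (Do (Dec (Var w))) (Do (Inc Aux)))) (S b j)
         (0 + (0 + 0 + 2) + 2) (S b (Suc j))"
        using timed_Seq[OF timed_Do timed_Seq[OF timed_Do timed_Do]] by metis
      then show "holds x (S b j) (Both (Neg (Zero (Var v))) (Neg (Zero (Var w)))) \<and>
         timed x (Seq (Do (Dec (Var v))) (Seq (Do (Dec (Var w))) (Do (Inc Aux)))) (S b j)
         (0 + (0 + 0 + 2) + 2) (S b (Suc j))"
        using j False by (auto simp: S_def N_def)
    next
      show "\<not> holds x (S b N) (Both (Neg (Zero (Var v))) (Neg (Zero (Var w))))"
        using False by (auto simp: S_def N_def)
    qed (use N in auto)
    define b' where "b' = (\<sigma> ! v < \<sigma> ! w)"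
    have flag: "timed x (set_flag c) (S b N) 1 (S c N)" for c
    proof -
      have "(S b N)\<lparr>cnt := (cnt (S b N))(Flag := of_bool c)\<rparr> = S c N"
        by (simp add: S_def represent_def fun_upd_twist flip: ctrs_flag[of n l \<sigma> b c])
      then show ?thesis using timed_set_flag_cnt[of "S b N" b x c] by (simp add: S_def)
    qed
    have "cnt (S b N) (Var w) = 0 \<longleftrightarrow> \<not> b'" by (auto simp: S_def N_def b'_def)
    then have 2: "timed x (Cond (Zero (Var w)) (set_flag False) (set_flag True)) (S b N) (1 + 1) (S b' N)"
      using flag[of b'] by (intro timed_Cond) (auto simp del: One_nat_def)
    have 3: "timed x (While (Neg (Zero Aux)) (Seq (Do (Dec Aux)) (Seq (Do (Inc (Var v))) (Do (Inc (Var w))))))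
       (S b' N) ((0 + (0 + 0 + 2) + 2) + 3) (S b' 0)"
    proof (rule timed_While[where S = "\<lambda>j. S b' (N - j)" and N = N])
      fix j assume j: "j < N"
      have *: "Suc (\<sigma> ! v - (N - j)) = \<sigma> ! v - (N - Suc j)" "Suc (\<sigma> ! w - (N - j)) = \<sigma> ! w - (N - Suc j)"
        using j by (auto simp: N_def)
      have "exec (Inc (Var w)) (exec (Inc (Var v)) (exec (Dec Aux) (S b' (N - j)))) = S b' (N - Suc j)"
        unfolding S_def *[symmetric] using False by (simp add: represent_def fun_upd_twist)
      then have "timed x (Seq (Do (Dec Aux)) (Seq (Do (Inc (Var v))) (Do (Inc (Var w))))) (S b' (N - j))
         (0 + (0 + 0 + 2) + 2) (S b' (N - Suc j))"
        using timed_Seq[OF timed_Do timed_Seq[OF timed_Do timed_Do]] by metis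
      then show "holds x (S b' (N - j)) (Neg (Zero Aux)) \<and>
         timed x (Seq (Do (Dec Aux)) (Seq (Do (Inc (Var v))) (Do (Inc (Var w))))) (S b' (N - j))
         (0 + (0 + 0 + 2) + 2) (S b' (N - Suc j))"
        using j by (auto simp: S_def)
    next
      show "\<not> holds x (S b' (N - N)) (Neg (Zero Aux))" by (simp add: S_def)
    qed (use N in auto)
    show ?thesis
      using timed_mono[OF timed_Seq[OF 1 timed_Seq[OF 2 3]], of 30] False
      by (simp add: S0 m b'_def)
  qed
next
  case Flip
  obtain b i ys where m: "m = (b, i, ys)" by (cases m)
  have "timed x (compile (length \<sigma>) Flip) (represent n l \<sigma> m) (0 + 1) (represent n l \<sigma> (\<not> b, i, ys))"
    unfolding compile.simps
    by (rule timed_Cond)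
      (auto intro!: timed_Do' simp: m represent_def
        ctrs_flag[of n l \<sigma> False True, simplified] ctrs_flag[of n l \<sigma> True False, simplified])
  then show ?case using timed_mono by (fastforce simp: m)
next
  case (SetFlag b)
  then show ?case using timed_mono[OF timed_set_flag] by (cases m) simp
next
  case (IfFlag p q)
  obtain b i ys where m: "m = (b, i, ys)" by (cases m)
  have p: "timed x (compile (length \<sigma>) p) (represent n l \<sigma> m) (expo p) (represent n l \<sigma> (sem x n p \<sigma> m))"
    and q: "timed x (compile (length \<sigma>) q) (represent n l \<sigma> m) (expo q) (represent n l \<sigma> (sem x n q \<sigma> m))"
    using IfFlag by auto
  have "timed x (compile (length \<sigma>) (IfFlag p q)) (represent n l \<sigma> m) ((expo p + expo q) + 1)
     (represent n l \<sigma> (sem x n (IfFlag p q) \<sigma> m))"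
    unfolding compile.simps
    by (rule timed_Cond) (use timed_mono[OF p] timed_mono[OF q] in \<open>auto simp: m\<close>)
  then show ?case by simp
next
  case Move
  obtain b i ys where m: "m = (b, i, ys)" by (cases m)
  have "timed x (compile (length \<sigma>) Move) (represent n l \<sigma> m) (0 + 1) (represent n l \<sigma> (sem x n Move \<sigma> m))"
    unfolding compile.simps
    by (rule timed_Cond)
      (use Move.prems in \<open>auto intro!: timed_Do' simp: m represent_def input_tape_def bit_sym_def timed_Skip split: if_splits\<close>)
  then show ?case using timed_mono by fastforce
next
  case Rewind
  obtain b i ys where m: "m = (b, i, ys)" by (cases m)
  have i: "i \<le> length x" using Rewind.prems by (simp add: m)
  let ?r = "represent n l \<sigma> (b, i, ys)"
  have "timed x (Do InL) ?r 0 (?r\<lparr>ipos := int i - 1\<rparr>)"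
    by (rule timed_Do') (simp add: represent_def)
  moreover have "timed x (While (Neg (Sym 0)) (Do InL)) (?r\<lparr>ipos := int i - 1\<rparr>) (0 + 3) (?r\<lparr>ipos := -1\<rparr>)"
    by (rule timed_While[where S = "\<lambda>j. ?r\<lparr>ipos := int i - 1 - int j\<rparr>" and N = i])
      (use i in \<open>auto intro!: timed_Do' simp: input_tape_def bit_sym_def\<close>)
  moreover have "timed x (Do InR) (?r\<lparr>ipos := -1\<rparr>) 0 (represent n l \<sigma> (b, 0, ys))"
    by (rule timed_Do') (simp add: represent_def)
  ultimately have "timed x (compile (length \<sigma>) Rewind) ?r (0 + (0 + 3 + 0 + 2) + 2) (represent n l \<sigma> (b, 0, ys))"
    unfolding compile.simps by (blast intro: timed_Seq)
  then show ?case using timed_mono by (fastforce simp: m)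
next
  case Read
  obtain b i ys where m: "m = (b, i, ys)" by (cases m)
  have "timed x (compile (length \<sigma>) Read) (represent n l \<sigma> m) (1 + 1) (represent n l \<sigma> (sem x n Read \<sigma> m))"
    unfolding compile.simps
  proof (rule timed_Cond)
    assume "holds x (represent n l \<sigma> m) (Sym 2)"
    then have "sem x n Read \<sigma> m = (True, i, ys)"
      by (auto simp: m input_tape_def bit_sym_def split: if_splits)
    then show "timed x (set_flag True) (represent n l \<sigma> m) 1 (represent n l \<sigma> (sem x n Read \<sigma> m))"
      by (simp only: m timed_set_flag)
  next
    assume "\<not> holds x (represent n l \<sigma> m) (Sym 2)"
    then have "sem x n Read \<sigma> m = (False, i, ys)"
      by (auto simp: m input_tape_def bit_sym_def split: if_splits)
    then show "timed x (set_flag False) (represent n l \<sigma> m) 1 (represent n l \<sigma> (sem x n Read \<sigma> m))"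
      by (simp only: m timed_set_flag)
  qed
  then show ?case using timed_mono by fastforce
next
  case AtEnd
  obtain b i ys where m: "m = (b, i, ys)" by (cases m)
  have "timed x (compile (length \<sigma>) AtEnd) (represent n l \<sigma> m) (1 + 1) (represent n l \<sigma> (sem x n AtEnd \<sigma> m))"
    unfolding compile.simps
  proof (rule timed_Cond)
    assume "holds x (represent n l \<sigma> m) (Sym 0)"
    then have "sem x n AtEnd \<sigma> m = (True, i, ys)"
      by (auto simp: m input_tape_def bit_sym_def split: if_splits)
    then show "timed x (set_flag True) (represent n l \<sigma> m) 1 (represent n l \<sigma> (sem x n AtEnd \<sigma> m))"
      by (simp only: m timed_set_flag)
  next
    assume "\<not> holds x (represent n l \<sigma> m) (Sym 0)"
    then have "sem x n AtEnd \<sigma> m = (False, i, ys)"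
      by (auto simp: m input_tape_def bit_sym_def split: if_splits)
    then show "timed x (set_flag False) (represent n l \<sigma> m) 1 (represent n l \<sigma> (sem x n AtEnd \<sigma> m))"
      by (simp only: m timed_set_flag)
  qed
  then show ?case using timed_mono by fastforce
next
  case (Emit c)
  obtain b i ys where m: "m = (b, i, ys)" by (cases m)
  have "(input_tape ys)(int (length ys) := bit_sym c) = input_tape (ys @ [c])"
    by (auto simp: input_tape_def fun_eq_iff nth_append nat_less_iff)
  then show ?case by (auto intro!: timed_Do' simp: m represent_def)
qed

lemma compile_bound:
  "wf_prog k p \<Longrightarrow> k + depth p \<le> l \<Longrightarrow> com_bound (2 * l + 4) (compile k p)"
  by (induction k p rule: compile.induct) (auto simp: set_flag_def)

section \<open>Encodings\<close>

lemma structure_of_length: "structure_of ar (A, Rs) \<Longrightarrow> length Rs = length ar"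
  unfolding structure_of_def snd_conv by blast

lemma structure_of_mem:
  "structure_of ar (A, Rs) \<Longrightarrow> i < length ar \<Longrightarrow> t \<in> Rs ! i \<Longrightarrow> length t = ar ! i \<and> set t \<subseteq> A"
  unfolding structure_of_def snd_conv fst_conv by blast

definition tuples :: "nat \<Rightarrow> nat \<Rightarrow> nat list list" where
  "tuples n k = product_lists (replicate k [0..<n])"

lemma tuples_0 [simp]: "tuples n 0 = [[]]"
  by (simp add: tuples_def)

lemma tuples_Suc: "tuples n (Suc k) = concat (map (\<lambda>v. map ((#) v) (tuples n k)) [0..<n])"
  by (simp add: tuples_def)

lemma set_product_lists_replicate:
  "set (product_lists (replicate k xs)) = {t. length t = k \<and> set t \<subseteq> set xs}"
proof (induction k)
  case (Suc k)
  show ?case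
  proof (intro set_eqI)
    fix t show "t \<in> set (product_lists (replicate (Suc k) xs)) \<longleftrightarrow> t \<in> {t. length t = Suc k \<and> set t \<subseteq> set xs}"
      using Suc by (cases t) auto
  qed
qed auto

lemma set_tuples: "set (tuples n k) = {t. length t = k \<and> set t \<subseteq> {..<n}}"
  unfolding tuples_def set_product_lists_replicate by (simp add: atLeast0LessThan)

lemma distinct_tuples: "distinct (tuples n k)"
  unfolding tuples_def by (rule distinct_product_lists) simp

lemma length_tuples [simp]: "length (tuples n k) = n ^ k"
proof (induction k)
  case (Suc k)
  then show ?case by (simp add: tuples_Suc length_concat comp_def sum_list_triv)
qed simp

fun rank :: "nat \<Rightarrow> nat list \<Rightarrow> nat" where
  "rank n [] = 0"
| "rank n (v # t) = v * n ^ length t + rank n t"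

lemma nth_concat:
  "i < length xss \<Longrightarrow> j < length (xss ! i) \<Longrightarrow>
    concat xss ! (sum_list (map length (take i xss)) + j) = xss ! i ! j"
proof (induction xss arbitrary: i)
  case (Cons xs xss)
  then show ?case by (cases i) (auto simp: nth_append)
qed simp

lemma rank_tuples:
  "set t \<subseteq> {..<n} \<Longrightarrow> rank n t < n ^ length t \<and> tuples n (length t) ! rank n t = t"
proof (induction t)
  case (Cons v t)
  then have v: "v < n" and t: "rank n t < n ^ length t" "tuples n (length t) ! rank n t = t" by auto
  have "v * n ^ length t + rank n t < (v + 1) * n ^ length t" using t by simp
  also have "\<dots> \<le> n * n ^ length t" by (rule mult_le_mono1) (use v in simp)
  finally have 1: "rank n (v # t) < n ^ length (v # t)" by simp
  let ?xss = "map (\<lambda>v. map ((#) v) (tuples n (length t))) [0..<n]"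
  have "map length (take v ?xss) = replicate v (n ^ length t)"
    using v by (intro nth_equalityI) auto
  then have "sum_list (map length (take v ?xss)) = v * n ^ length t" by (simp add: sum_list_replicate)
  then have "concat ?xss ! (v * n ^ length t + rank n t) = ?xss ! v ! rank n t"
    using nth_concat[of v ?xss "rank n t"] v t by simp
  then show ?case using 1 v t by (simp add: tuples_Suc)
qed simp

abbreviation size_of :: "nat \<Rightarrow> nat list \<Rightarrow> nat" where
  "size_of n ar \<equiv> sum_list (map (\<lambda>k. n ^ k) ar)"

definition bits :: "nat \<Rightarrow> nat list \<Rightarrow> nat list set list \<Rightarrow> bool list" where
  "bits n ar Rs = concat (map2 (\<lambda>k R. map (\<lambda>t. t \<in> R) (tuples n k)) ar Rs)"

lemma encode_bits: "encode n ar Rs = replicate n True @ False # bits n ar Rs"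
  by (simp add: encode_def bits_def tuples_def)

lemma length_bits: "length Rs = length ar \<Longrightarrow> length (bits n ar Rs) = size_of n ar"
  by (induction ar Rs rule: list_induct2') (auto simp: bits_def)

lemma length_encode: "length Rs = length ar \<Longrightarrow> length (encode n ar Rs) = Suc n + size_of n ar"
  by (simp add: encode_bits length_bits)

lemma encode_lookup:
  assumes "length Rs = length ar" "i < length ar" "length t = ar ! i" "set t \<subseteq> {..<n}"
  shows "Suc n + size_of n (take i ar) + rank n t < length (encode n ar Rs)"
    and "encode n ar Rs ! (Suc n + size_of n (take i ar) + rank n t) \<longleftrightarrow> t \<in> Rs ! i"
proof -
  let ?xss = "map2 (\<lambda>k R. map (\<lambda>t. t \<in> R) (tuples n k)) ar Rs"
  have rank: "rank n t < n ^ (ar ! i)" "tuples n (ar ! i) ! rank n t = t"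
    using rank_tuples[OF assms(4)] assms(3) by auto
  have "map length (take i ?xss) = map (\<lambda>k. n ^ k) (take i ar)"
    using assms by (intro nth_equalityI) auto
  then have "bits n ar Rs ! (size_of n (take i ar) + rank n t) = ?xss ! i ! rank n t"
    unfolding bits_def using nth_concat[of i ?xss "rank n t"] assms rank by simp
  then show "encode n ar Rs ! (Suc n + size_of n (take i ar) + rank n t) \<longleftrightarrow> t \<in> Rs ! i"
    using rank assms by (simp add: encode_bits nth_append)
  have "size_of n ar = size_of n (take i ar) + n ^ (ar ! i) + size_of n (drop (Suc i) ar)"
    by (subst id_take_nth_drop[OF assms(2)]) simp
  then show "Suc n + size_of n (take i ar) + rank n t < length (encode n ar Rs)"
    using rank by (simp add: length_encode[OF assms(1)])
qed

lemma takeWhile_replicate_True: "takeWhile id (replicate m True @ False # w) = replicate m True"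
  by (induction m) auto

lemma encode_inj:
  assumes "encode n ar Rs = encode n' ar Rs'"
    and "structure_of ar ({..<n}, Rs)" "structure_of ar ({..<n'}, Rs')"
  shows "n = n'" "Rs = Rs'"
proof -
  have "length (takeWhile id (encode m ar S)) = m" for m S
    unfolding encode_bits takeWhile_replicate_True by simp
  from this[of n Rs] this[of n' Rs'] show n: "n = n'" unfolding assms(1) by (rule trans[OF sym])
  show "Rs = Rs'"
  proof (rule nth_equalityI)
    show len: "length Rs = length Rs'" using structure_of_length assms(2,3) by metis
    fix i assume "i < length Rs"
    then have i: "i < length ar" "length Rs = length ar" "length Rs' = length ar"
      using len structure_of_length[OF assms(2)] structure_of_length[OF assms(3)] by simp_all
    have "t \<in> Rs ! i \<longleftrightarrow> t \<in> Rs' ! i" if t: "length t = ar ! i" "set t \<subseteq> {..<n}" for t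
    proof -
      have "encode n ar Rs = encode n ar Rs'" using assms(1) n by metis
      then show ?thesis
        using encode_lookup(2)[OF i(2,1) t] encode_lookup(2)[OF i(3,1) t] by metis
    qed
    moreover have "length t = ar ! i \<and> set t \<subseteq> {..<n}" if "t \<in> Rs ! i" for t
      using structure_of_mem[OF assms(2) i(1) that] .
    moreover have "length t = ar ! i \<and> set t \<subseteq> {..<n}" if "t \<in> Rs' ! i" for t
      using structure_of_mem[OF assms(3) i(1) that] n by simp
    ultimately show "Rs ! i = Rs' ! i" by blast
  qed
qed

lemma bits_surj:
  "length w = size_of n ar \<Longrightarrow> \<exists>Rs. structure_of ar ({..<n}, Rs) \<and> bits n ar Rs = w"
proof (induction ar arbitrary: w)
  case Nil
  then show ?case by (simp add: structure_of_def bits_def)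
next
  case (Cons k ar)
  then have "length (drop (n ^ k) w) = size_of n ar" by simp
  from Cons.IH[OF this] obtain Rs where Rs: "structure_of ar ({..<n}, Rs)" "bits n ar Rs = drop (n ^ k) w"
    by blast
  define R where "R = {tuples n k ! i | i. i < n ^ k \<and> w ! i}"
  have "tuples n k ! i \<in> R \<longleftrightarrow> w ! i" if "i < n ^ k" for i
    using that distinct_tuples[of n k] by (auto simp: R_def nth_eq_iff_index_eq)
  then have "map (\<lambda>t. t \<in> R) (tuples n k) = take (n ^ k) w"
    using Cons.prems by (intro nth_equalityI) auto
  then have "bits n (k # ar) (R # Rs) = w" using Rs by (simp add: bits_def)
  moreover have "R \<subseteq> set (tuples n k)" by (auto simp: R_def)
  then have R: "t \<in> R \<Longrightarrow> length t = k \<and> set t \<subseteq> {..<n}" for t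
    unfolding set_tuples by auto
  have "structure_of (k # ar) ({..<n}, R # Rs)"
    unfolding structure_of_def snd_conv fst_conv
  proof (intro conjI allI impI ballI)
    show "length (R # Rs) = length (k # ar)" using structure_of_length[OF Rs(1)] by simp
    fix i t assume "i < length (k # ar)" "t \<in> (R # Rs) ! i"
    then show "length t = (k # ar) ! i" "set t \<subseteq> {..<n}"
      using R structure_of_mem[OF Rs(1)] by (cases i; simp)+
  qed
  ultimately show ?case by blast
qed

section \<open>Generated outputs\<close>

abbreviation fors :: "nat \<Rightarrow> prog \<Rightarrow> prog" where
  "fors d p \<equiv> (For ^^ d) p"

lemma wf_fors: "wf_prog (k + d) p \<Longrightarrow> wf_prog k (fors d p)"
  by (induction d arbitrary: k) auto

lemma fold_concat_map:
  "fold f (concat (map g xs)) m = fold (\<lambda>v. fold f (g v)) xs m"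
  by (induction xs arbitrary: m) auto

lemma sem_fors: "sem x n (fors d p) \<sigma> m = fold (\<lambda>t. sem x n p (\<sigma> @ t)) (tuples n d) m"
proof (induction d arbitrary: \<sigma> m)
  case (Suc d)
  have "sem x n (fors d p) \<tau> = fold (\<lambda>t. sem x n p (\<tau> @ t)) (tuples n d)" for \<tau>
    using Suc by blast
  then show ?case by (simp add: tuples_Suc fold_concat_map fold_map comp_def)
qed simp

lemma sem_fors_Move:
  assumes "i \<le> length x"
  shows "sem x n (fors d Move) \<sigma> (b, i, ys) = (b, min (length x) (i + n ^ d), ys)"
proof -
  have "i \<le> length x \<Longrightarrow> fold (\<lambda>t. sem x n Move (\<sigma> @ t)) ts (b, i, ys) = (b, min (length x) (i + length ts), ys)"
    for ts :: "nat list list" and i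
    by (induction ts arbitrary: i) (auto simp: min_def)
  then show ?thesis using assms by (simp add: sem_fors)
qed

fun moves :: "nat list \<Rightarrow> prog" where
  "moves [] = Stay"
| "moves (a # ar) = Then (fors a Move) (moves ar)"

lemma sem_moves:
  "i \<le> length x \<Longrightarrow> sem x n (moves ar) \<sigma> (b, i, ys) = (b, min (length x) (i + size_of n ar), ys)"
  by (induction ar arbitrary: i) (auto simp: sem_fors_Move min_def)

lemma wf_moves: "wf_prog k (moves ar)"
  by (induction ar) (auto intro: wf_fors)

fun seek :: "nat \<Rightarrow> nat list \<Rightarrow> prog" where
  "seek k [] = Stay"
| "seek k (v # vs) = Then (For (Then (Less k v) (IfFlag (fors (length vs) Move) Stay))) (seek k vs)"

lemma wf_seek: "set vs \<subseteq> {..<k} \<Longrightarrow> wf_prog k (seek k vs)"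
  by (induction vs) (auto intro: wf_fors)

lemma sem_seek:
  assumes "length \<sigma> = k" "set \<sigma> \<subseteq> {..<n}" "set vs \<subseteq> {..<k}" "i \<le> length x"
  shows "\<exists>b'. sem x n (seek k vs) \<sigma> (b, i, ys) = (b', min (length x) (i + rank n (map ((!) \<sigma>) vs)), ys)"
  using assms(3,4)
proof (induction vs arbitrary: i b)
  case (Cons v vs)
  define q where "q = Then (Less k v) (IfFlag (fors (length vs) Move) Stay)"
  have v: "v < k" using Cons by simp
  then have "\<sigma> ! v \<in> set \<sigma>" using assms(1) by simp
  then have vn: "\<sigma> ! v \<le> n" using assms(2) by auto
  have "\<exists>b'. fold (\<lambda>u. sem x n q (\<sigma> @ [u])) [0..<j] (b, i, ys) =
      (b', min (length x) (i + min j (\<sigma> ! v) * n ^ length vs), ys)" for j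
  proof (induction j)
    case (Suc j)
    then obtain b' where b': "fold (\<lambda>u. sem x n q (\<sigma> @ [u])) [0..<j] (b, i, ys) =
      (b', min (length x) (i + min j (\<sigma> ! v) * n ^ length vs), ys)" by blast
    have "sem x n q (\<sigma> @ [j]) (b', min (length x) (i + min j (\<sigma> ! v) * n ^ length vs), ys)
      = (j < \<sigma> ! v, min (length x) (i + min (Suc j) (\<sigma> ! v) * n ^ length vs), ys)"
      using v assms(1) by (auto simp: q_def nth_append sem_fors_Move min_def)
    then show ?case using b' by simp
  qed (use Cons in auto)
  from this[of n] vn obtain b' where "sem x n (For q) \<sigma> (b, i, ys) =
      (b', min (length x) (i + \<sigma> ! v * n ^ length vs), ys)"
    by (auto simp: min_absorb2)
  moreover obtain b'' where "sem x n (seek k vs) \<sigma> (b', min (length x) (i + \<sigma> ! v * n ^ length vs), ys)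
    = (b'', min (length x) (min (length x) (i + \<sigma> ! v * n ^ length vs) + rank n (map ((!) \<sigma>) vs)), ys)"
    using Cons.IH[of "min (length x) (i + \<sigma> ! v * n ^ length vs)" b'] Cons.prems by auto
  moreover have "min (length x) (min (length x) (i + \<sigma> ! v * n ^ length vs) + rank n (map ((!) \<sigma>) vs))
     = min (length x) (i + (\<sigma> ! v * n ^ length vs + rank n (map ((!) \<sigma>) vs)))"
    by (auto simp: min_def)
  ultimately show ?case by (auto simp: q_def)
qed simp

type_synonym rels = "nat list set list"

definition valid :: "nat list \<Rightarrow> nat \<Rightarrow> nat \<Rightarrow> rels \<Rightarrow> nat list \<Rightarrow> bool" where
  "valid ar k n Rs \<sigma> \<longleftrightarrow> structure_of ar ({..<n}, Rs) \<and> length \<sigma> = k \<and> set \<sigma> \<subseteq> {..<n}"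

definition definable :: "nat list \<Rightarrow> nat \<Rightarrow> (nat \<Rightarrow> rels \<Rightarrow> nat list \<Rightarrow> bool) \<Rightarrow> bool" where
  "definable ar k P \<longleftrightarrow> (\<exists>p. wf_prog k p \<and> (\<forall>n Rs \<sigma> b ys. valid ar k n Rs \<sigma> \<longrightarrow>
     sem (encode n ar Rs) n p \<sigma> (b, 0, ys) = (P n Rs \<sigma>, 0, ys)))"

definition generable :: "nat list \<Rightarrow> nat \<Rightarrow> (nat \<Rightarrow> rels \<Rightarrow> nat list \<Rightarrow> bool list) \<Rightarrow> bool" where
  "generable ar k G \<longleftrightarrow> (\<exists>p. wf_prog k p \<and> (\<forall>n Rs \<sigma> b ys. valid ar k n Rs \<sigma> \<longrightarrow>
     (\<exists>b'. sem (encode n ar Rs) n p \<sigma> (b, 0, ys) = (b', 0, ys @ G n Rs \<sigma>))))"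

lemma definable_cong:
  "definable ar k P \<Longrightarrow> (\<And>n Rs \<sigma>. valid ar k n Rs \<sigma> \<Longrightarrow> P n Rs \<sigma> = Q n Rs \<sigma>) \<Longrightarrow> definable ar k Q"
  unfolding definable_def by (elim ex_forward) simp

lemma definable_const: "definable ar k (\<lambda>n Rs \<sigma>. c)"
  unfolding definable_def by (intro exI[of _ "SetFlag c"]) auto

lemma definable_less: "v < k \<Longrightarrow> w < k \<Longrightarrow> definable ar k (\<lambda>n Rs \<sigma>. \<sigma> ! v < \<sigma> ! w)"
  unfolding definable_def by (intro exI[of _ "Less v w"]) auto

lemma definable_not:
  assumes "definable ar k P"
  shows "definable ar k (\<lambda>n Rs \<sigma>. \<not> P n Rs \<sigma>)"
proof -
  obtain p where "wf_prog k p" "\<And>n Rs \<sigma> b ys. valid ar k n Rs \<sigma> \<Longrightarrow>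
     sem (encode n ar Rs) n p \<sigma> (b, 0, ys) = (P n Rs \<sigma>, 0, ys)"
    using assms unfolding definable_def by blast
  then show ?thesis unfolding definable_def by (intro exI[of _ "Then p Flip"]) auto
qed

lemma definable_conj:
  assumes "definable ar k P" "definable ar k Q"
  shows "definable ar k (\<lambda>n Rs \<sigma>. P n Rs \<sigma> \<and> Q n Rs \<sigma>)"
proof -
  obtain p where "wf_prog k p" "\<And>n Rs \<sigma> b ys. valid ar k n Rs \<sigma> \<Longrightarrow>
     sem (encode n ar Rs) n p \<sigma> (b, 0, ys) = (P n Rs \<sigma>, 0, ys)"
    using assms(1) unfolding definable_def by blast
  moreover obtain q where "wf_prog k q" "\<And>n Rs \<sigma> b ys. valid ar k n Rs \<sigma> \<Longrightarrow>
     sem (encode n ar Rs) n q \<sigma> (b, 0, ys) = (Q n Rs \<sigma>, 0, ys)"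
    using assms(2) unfolding definable_def by blast
  ultimately show ?thesis unfolding definable_def by (intro exI[of _ "Then p (IfFlag q Stay)"]) auto
qed

lemma definable_disj:
  assumes "definable ar k P" "definable ar k Q"
  shows "definable ar k (\<lambda>n Rs \<sigma>. P n Rs \<sigma> \<or> Q n Rs \<sigma>)"
  using definable_not[OF definable_conj[OF definable_not[OF assms(1)] definable_not[OF assms(2)]]]
  by simp

lemma definable_eq:
  assumes "v < k" "w < k"
  shows "definable ar k (\<lambda>n Rs \<sigma>. \<sigma> ! v = \<sigma> ! w)"
  using definable_conj[OF definable_not[OF definable_less[OF assms]]
      definable_not[OF definable_less[OF assms(2,1)]]]
  by (rule definable_cong) auto

lemma definable_ball:
  assumes "finite A" "\<And>a. a \<in> A \<Longrightarrow> definable ar k (P a)"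
  shows "definable ar k (\<lambda>n Rs \<sigma>. \<forall>a\<in>A. P a n Rs \<sigma>)"
  using assms
proof (induction A)
  case (insert a A)
  have "definable ar k (\<lambda>n Rs \<sigma>. P a n Rs \<sigma> \<and> (\<forall>a\<in>A. P a n Rs \<sigma>))"
    using insert by (intro definable_conj) auto
  then show ?case by simp
qed (simp add: definable_const)

lemma definable_bex:
  assumes "finite A" "\<And>a. a \<in> A \<Longrightarrow> definable ar k (P a)"
  shows "definable ar k (\<lambda>n Rs \<sigma>. \<exists>a\<in>A. P a n Rs \<sigma>)"
  using definable_not[OF definable_ball[OF assms(1), of ar k "\<lambda>a n Rs \<sigma>. \<not> P a n Rs \<sigma>"]]
    definable_not assms(2) by simp

lemma definable_atom:
  assumes "i < length ar" "length vs = ar ! i" "set vs \<subseteq> {..<k}"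
  shows "definable ar k (\<lambda>n Rs \<sigma>. map ((!) \<sigma>) vs \<in> Rs ! i)"
  unfolding definable_def
proof (intro exI[of _ "Then (Then (For Move) Move) (Then (moves (take i ar)) (Then (seek k vs) (Then Read Rewind)))"]
    conjI allI impI)
  show "wf_prog k (Then (Then (For Move) Move) (Then (moves (take i ar)) (Then (seek k vs) (Then Read Rewind))))"
    using assms(3) by (simp add: wf_moves wf_seek)
  fix n Rs \<sigma> b ys assume v: "valid ar k n Rs \<sigma>"
  let ?x = "encode n ar Rs" and ?t = "map ((!) \<sigma>) vs"
  have \<sigma>: "length \<sigma> = k" "set \<sigma> \<subseteq> {..<n}" and Rs: "length Rs = length ar"
    using v structure_of_length by (auto simp: valid_def)
  have t: "length ?t = ar ! i" "set ?t \<subseteq> {..<n}"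
  proof -
    have "\<sigma> ! v \<in> {..<n}" if "v \<in> set vs" for v
      using subsetD[OF \<sigma>(2) nth_mem[of v \<sigma>]] that assms(3) \<sigma>(1) by auto
    then show "length ?t = ar ! i" "set ?t \<subseteq> {..<n}" using assms(2) by auto
  qed
  note look = encode_lookup[OF Rs assms(1) t]
  have len: "Suc n \<le> length ?x" using look(1) by simp
  have 1: "sem ?x n (Then (For Move) Move) \<sigma> (b, 0, ys) = (b, Suc n, ys)"
    using sem_fors_Move[of 0 ?x n 1 \<sigma> b ys] len by (simp add: Suc_le_eq)
  have 2: "sem ?x n (moves (take i ar)) \<sigma> (b, Suc n, ys) = (b, Suc n + size_of n (take i ar), ys)"
    using sem_moves[OF len, of n "take i ar" \<sigma> b ys] look(1) by (simp add: min_absorb2)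
  obtain b' where 3: "sem ?x n (seek k vs) \<sigma> (b, Suc n + size_of n (take i ar), ys) =
      (b', Suc n + size_of n (take i ar) + rank n ?t, ys)"
    using sem_seek[OF \<sigma> assms(3), of "Suc n + size_of n (take i ar)" ?x b ys] look(1)
    by (auto simp: min_absorb2)
  show "sem ?x n (Then (Then (For Move) Move) (Then (moves (take i ar)) (Then (seek k vs) (Then Read Rewind)))) \<sigma> (b, 0, ys)
    = (?t \<in> Rs ! i, 0, ys)"
    by (subst sem.simps(2), subst 1, subst sem.simps(2), subst 2, subst sem.simps(2), subst 3)
      (use look in auto)
qed

lemma generable_cong:
  "generable ar k G \<Longrightarrow> (\<And>n Rs \<sigma>. valid ar k n Rs \<sigma> \<Longrightarrow> G n Rs \<sigma> = H n Rs \<sigma>) \<Longrightarrow> generable ar k H"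
  unfolding generable_def by (elim ex_forward) simp

lemma generable_Nil: "generable ar k (\<lambda>n Rs \<sigma>. [])"
  unfolding generable_def by (intro exI[of _ Stay]) auto

lemma generable_append:
  assumes "generable ar k G" "generable ar k H"
  shows "generable ar k (\<lambda>n Rs \<sigma>. G n Rs \<sigma> @ H n Rs \<sigma>)"
proof -
  obtain p where p: "wf_prog k p" "\<And>n Rs \<sigma> b ys. valid ar k n Rs \<sigma> \<Longrightarrow>
     \<exists>b'. sem (encode n ar Rs) n p \<sigma> (b, 0, ys) = (b', 0, ys @ G n Rs \<sigma>)"
    using assms(1) unfolding generable_def by blast
  obtain q where q: "wf_prog k q" "\<And>n Rs \<sigma> b ys. valid ar k n Rs \<sigma> \<Longrightarrow>
     \<exists>b'. sem (encode n ar Rs) n q \<sigma> (b, 0, ys) = (b', 0, ys @ H n Rs \<sigma>)"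
    using assms(2) unfolding generable_def by blast
  have "\<exists>b'. sem (encode n ar Rs) n (Then p q) \<sigma> (b, 0, ys) = (b', 0, ys @ G n Rs \<sigma> @ H n Rs \<sigma>)"
    if v: "valid ar k n Rs \<sigma>" for n Rs \<sigma> b ys
  proof -
    obtain b1 where "sem (encode n ar Rs) n p \<sigma> (b, 0, ys) = (b1, 0, ys @ G n Rs \<sigma>)"
      using p(2)[OF v] by blast
    moreover obtain b2 where "sem (encode n ar Rs) n q \<sigma> (b1, 0, ys @ G n Rs \<sigma>) =
        (b2, 0, (ys @ G n Rs \<sigma>) @ H n Rs \<sigma>)"
      using q(2)[OF v] by blast
    ultimately show ?thesis by simp
  qed
  then show ?thesis using p(1) q(1) unfolding generable_def by (intro exI[of _ "Then p q"]) auto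
qed

lemma generable_concat:
  assumes "\<And>a. a \<in> set as \<Longrightarrow> generable ar k (G a)"
  shows "generable ar k (\<lambda>n Rs \<sigma>. concat (map (\<lambda>a. G a n Rs \<sigma>) as))"
  using assms by (induction as) (auto intro: generable_Nil generable_append)

lemma generable_bit:
  assumes "definable ar k P"
  shows "generable ar k (\<lambda>n Rs \<sigma>. [P n Rs \<sigma>])"
proof -
  obtain p where "wf_prog k p" "\<And>n Rs \<sigma> b ys. valid ar k n Rs \<sigma> \<Longrightarrow>
     sem (encode n ar Rs) n p \<sigma> (b, 0, ys) = (P n Rs \<sigma>, 0, ys)"
    using assms unfolding definable_def by blast
  then show ?thesis unfolding generable_def
    by (intro exI[of _ "Then p (IfFlag (Emit True) (Emit False))"]) auto
qed

lemma generable_for: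
  assumes "generable ar (k + d) G"
  shows "generable ar k (\<lambda>n Rs \<sigma>. concat (map (\<lambda>t. G n Rs (\<sigma> @ t)) (tuples n d)))"
proof -
  obtain p where p: "wf_prog (k + d) p" "\<And>n Rs \<sigma> b ys. valid ar (k + d) n Rs \<sigma> \<Longrightarrow>
     \<exists>b'. sem (encode n ar Rs) n p \<sigma> (b, 0, ys) = (b', 0, ys @ G n Rs \<sigma>)"
    using assms unfolding generable_def by blast
  have "\<exists>b'. sem (encode n ar Rs) n (fors d p) \<sigma> (b, 0, ys) =
      (b', 0, ys @ concat (map (\<lambda>t. G n Rs (\<sigma> @ t)) (tuples n d)))"
    if v: "valid ar k n Rs \<sigma>" for n Rs \<sigma> b ys
  proof -
    have "set ts \<subseteq> set (tuples n d) \<Longrightarrow> \<exists>b'. fold (\<lambda>t. sem (encode n ar Rs) n p (\<sigma> @ t)) ts (b, 0, ys) =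
      (b', 0, ys @ concat (map (\<lambda>t. G n Rs (\<sigma> @ t)) ts))" for ts
    proof (induction ts arbitrary: b ys)
      case (Cons t ts)
      have "valid ar (k + d) n Rs (\<sigma> @ t)"
        using Cons.prems v by (auto simp: valid_def set_tuples)
      from p(2)[OF this, of b ys] obtain b' where
        "sem (encode n ar Rs) n p (\<sigma> @ t) (b, 0, ys) = (b', 0, ys @ G n Rs (\<sigma> @ t))" by blast
      then show ?case using Cons.IH[of b' "ys @ G n Rs (\<sigma> @ t)"] Cons.prems by auto
    qed simp
    then show ?thesis by (simp add: sem_fors)
  qed
  then show ?thesis using wf_fors[OF p(1)] unfolding generable_def by blast
qed

subsection \<open>From generated outputs to reductions\<close>

text \<open>Running \<open>checks\<close> keeps the flag true iff the input has room for all the moves.\<close>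

fun checks :: "nat list \<Rightarrow> prog" where
  "checks [] = Stay"
| "checks (a # ar) = Then (fors a (IfFlag (Then AtEnd (Then Flip Move)) Stay)) (checks ar)"

lemma wf_checks: "wf_prog k (checks ar)"
  by (induction ar) (auto intro: wf_fors)

lemma sem_checks:
  assumes "i \<le> length x"
  shows "\<exists>j\<le>length x. (i + size_of n ar \<le> length x \<longrightarrow> j = i + size_of n ar) \<and>
    sem x n (checks ar) \<sigma> (True, i, ys) = (i + size_of n ar \<le> length x, j, ys)"
  using assms
proof (induction ar arbitrary: i)
  case (Cons a ar)
  define q where "q = IfFlag (Then AtEnd (Then Flip Move)) Stay"
  have False_step: "fold (\<lambda>t. sem x n q (\<sigma> @ t)) ts (False, i, ys) = (False, i, ys)" for ts i
    by (induction ts) (auto simp: q_def)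
  have step: "i \<le> length x \<Longrightarrow> \<exists>j\<le>length x. (i + length ts \<le> length x \<longrightarrow> j = i + length ts) \<and>
      fold (\<lambda>t. sem x n q (\<sigma> @ t)) ts (True, i, ys) = (i + length ts \<le> length x, j, ys)" for ts i
  proof (induction ts arbitrary: i)
    case (Cons t ts)
    show ?case
    proof (cases "i < length x")
      case True
      then have "sem x n q (\<sigma> @ t) (True, i, ys) = (True, Suc i, ys)" by (simp add: q_def)
      then show ?thesis using Cons.IH[of "Suc i"] True by auto
    next
      case False
      then have "sem x n q (\<sigma> @ t) (True, i, ys) = (False, i, ys)" using Cons.prems by (simp add: q_def)
      then show ?thesis using False Cons.prems False_step by auto
    qed
  qed simp
  have stay: "sem x n (checks ar) \<sigma> (False, i, ys) = (False, i, ys)" for i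
  proof (induction ar)
    case (Cons a ar)
    then show ?case using False_step by (simp add: sem_fors flip: q_def)
  qed simp
  obtain j where j: "j \<le> length x" "i + n ^ a \<le> length x \<longrightarrow> j = i + n ^ a"
    "sem x n (fors a q) \<sigma> (True, i, ys) = (i + n ^ a \<le> length x, j, ys)"
    using step[of i "tuples n a"] Cons.prems by (auto simp: sem_fors)
  show ?case
  proof (cases "i + n ^ a \<le> length x")
    case True
    then show ?thesis using j Cons.IH[of "i + n ^ a"] by (auto simp: q_def add.assoc)
  next
    case False
    then show ?thesis using j stay by (auto simp: q_def)
  qed
qed auto

definition main_prog :: "nat list \<Rightarrow> prog \<Rightarrow> prog" where
  "main_prog ar p = Then Rewind (Then (For Move) (Then AtEnd (IfFlag Stay
     (Then Move (Then (SetFlag True) (Then (checks ar)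
       (Then (IfFlag AtEnd Stay) (IfFlag (Then Rewind p) Stay))))))))"

definition prefix_length :: "bool list \<Rightarrow> nat" where
  "prefix_length x = length (takeWhile id x)"

definition prog_output :: "nat list \<Rightarrow> prog \<Rightarrow> bool list \<Rightarrow> bool list" where
  "prog_output ar p x =
     snd (snd (sem x (prefix_length x) (main_prog ar p) [] (False, prefix_length x, [])))"

lemma prefix_length_le: "prefix_length x \<le> length x"
  by (simp add: prefix_length_def length_takeWhile_le)

lemma prefix_length_encode: "prefix_length (encode n ar Rs) = n"
  unfolding prefix_length_def encode_bits takeWhile_replicate_True by simp

lemma prog_output_encode:
  assumes "wf_prog 0 p" "structure_of ar ({..<n}, Rs)"
    and "\<And>b ys. \<exists>b'. sem (encode n ar Rs) n p [] (b, 0, ys) = (b', 0, ys @ G)"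
  shows "prog_output ar p (encode n ar Rs) = G"
proof -
  let ?x = "encode n ar Rs"
  have len: "length ?x = Suc n + size_of n ar"
    using structure_of_length[OF assms(2)] by (rule length_encode)
  have mv: "sem ?x n (For Move) [] (b, 0, ys) = (b, n, ys)" for b ys
    using sem_fors_Move[of 0 ?x n 1 "[]" b ys] len by simp
  have ch: "sem ?x n (checks ar) [] (True, Suc n, ys) = (True, Suc n + size_of n ar, ys)" for ys
    using sem_checks[of "Suc n" ?x n ar "[]" ys] len by auto
  obtain b' where "sem ?x n p [] (True, 0, []) = (b', 0, [] @ G)" using assms(3) by blast
  then show ?thesis
    unfolding prog_output_def prefix_length_encode main_prog_def
    using len mv ch by (simp del: sem.simps(3))
qed

lemma prog_output_not_encode:
  assumes "\<And>n Rs. structure_of ar ({..<n}, Rs) \<Longrightarrow> x \<noteq> encode n ar Rs"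
  shows "prog_output ar p x = []"
proof -
  define n where "n = prefix_length x"
  have n: "n \<le> length x" by (simp add: n_def prefix_length_le)
  have mv: "sem x n (For Move) [] (b, 0, ys) = (b, n, ys)" for b ys
    using sem_fors_Move[of 0 x n 1 "[]" b ys] n by (simp add: min_absorb2)
  show ?thesis
  proof (cases "n = length x")
    case True
    then show ?thesis unfolding prog_output_def n_def[symmetric] main_prog_def
      using mv by (simp del: sem.simps(3))
  next
    case False
    then have nl: "n < length x" using n by simp
    obtain j where j: "j \<le> length x" "Suc n + size_of n ar \<le> length x \<longrightarrow> j = Suc n + size_of n ar"
      "sem x n (checks ar) [] (True, Suc n, []) = (Suc n + size_of n ar \<le> length x, j, [])"
      using sem_checks[of "Suc n" x n ar "[]" "[]"] nl by auto
    have "Suc n + size_of n ar \<noteq> length x"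
    proof
      assume len: "Suc n + size_of n ar = length x"
      have tk: "take n x = replicate n True"
      proof -
        have "takeWhile id x = take n x"
          unfolding n_def prefix_length_def by (rule takeWhile_eq_take)
        moreover have "takeWhile id x = replicate n True"
          using set_takeWhileD[of _ id x]
          by (intro replicate_eqI) (auto simp: n_def prefix_length_def)
        ultimately show ?thesis by simp
      qed
      have "\<not> x ! n" using nth_length_takeWhile[of id x] nl by (simp add: n_def prefix_length_def)
      then have "take n x @ x ! n # drop (Suc n) x = replicate n True @ False # drop (Suc n) x"
        unfolding tk by simp
      then have x: "x = replicate n True @ False # drop (Suc n) x"
        using id_take_nth_drop[OF nl] by (rule trans[rotated])
      obtain Rs where Rs: "structure_of ar ({..<n}, Rs)" "bits n ar Rs = drop (Suc n) x"
        using bits_surj[of "drop (Suc n) x" n ar] len[symmetric] by auto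
      have "encode n ar Rs = replicate n True @ False # drop (Suc n) x"
        unfolding encode_bits Rs(2) ..
      with x have "x = encode n ar Rs" by (rule trans[OF _ sym])
      then show False using assms[OF Rs(1)] by simp
    qed
    then show ?thesis unfolding prog_output_def n_def[symmetric] main_prog_def
      using mv nl j by (auto simp del: sem.simps(3))
  qed
qed

fun incs :: "nat \<Rightarrow> com" where
  "incs 0 = Skip"
| "incs (Suc j) = Seq (incs j) (Do (Inc (Co j)))"

lemma timed_incs:
  "timed x (incs m) s (2 * m)
     (s\<lparr>cnt := \<lambda>c. case c of Co j \<Rightarrow> if j < m then Suc (cnt s c) else cnt s c | _ \<Rightarrow> cnt s c\<rparr>)"
proof (induction m)
  case 0
  have "(\<lambda>c. case c of Co j \<Rightarrow> if j < (0::nat) then Suc (cnt s c) else cnt s c | _ \<Rightarrow> cnt s c) = cnt s"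
    by (auto split: ctr.split)
  then show ?case by (simp add: timed_Skip)
next
  case (Suc m)
  let ?s = "\<lambda>m. s\<lparr>cnt := \<lambda>c. case c of Co j \<Rightarrow> if j < m then Suc (cnt s c) else cnt s c | _ \<Rightarrow> cnt s c\<rparr>"
  have "exec (Inc (Co m)) (?s m) = ?s (Suc m)"
    by (auto simp: fun_eq_iff split: ctr.split)
  then have "timed x (Seq (incs m) (Do (Inc (Co m)))) s (2 * m + 0 + 2) (?s (Suc m))"
    using timed_Seq[OF Suc timed_Do[of x "Inc (Co m)" "?s m" 0]] by simp
  then show ?case by simp
qed

lemma incs_bound: "m \<le> l \<Longrightarrow> com_bound (2 * l + 4) (incs m)"
  by (induction m) auto

lemma run_opos: "run x c s k s' \<Longrightarrow> opos s' \<le> opos s + int k"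
proof -
  have 1: "opos (exec i s) \<le> opos s + 1" for i s by (cases i) auto
  have "opos (snd (cstep x cs)) \<le> opos (snd cs) + 1" for cs
    using 1 by (auto simp: cstep_def exec_opt_def split: prod.split option.split)
  then have "opos (snd ((cstep x ^^ k) cs)) \<le> opos (snd cs) + int k" for cs k
  proof (induction k)
    case (Suc k)
    then show ?case using Suc.prems[of "(cstep x ^^ k) cs"] Suc.IH by fastforce
  qed simp
  from this[of k "(c, s)"] show "run x c s k s' \<Longrightarrow> opos s' \<le> opos s + int k"
    by (simp add: run_def)
qed

definition main_com :: "nat list \<Rightarrow> prog \<Rightarrow> com" where
  "main_com ar p = Seq (While (Sym 2) (Seq (Do InR) (incs (depth (main_prog ar p)))))
     (Seq (compile 0 (main_prog ar p))
       (Seq (Do OutL) (Seq (While (Neg OutBlank) (Do OutL)) (Do OutR))))"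

lemma main_com_correct:
  assumes "wf_prog 0 p"
  shows "\<exists>a. \<forall>x. \<exists>s'. timed x (main_com ar p) init_state a s' \<and>
    output_is (\<lambda>i. otape s' (i + opos s')) (prog_output ar p x)"
proof -
  define q where "q = main_prog ar p"
  define l where "l = depth q"
  define A where "A = (0 + 2 * l + 2 + 3) + (expo q + (0 + ((0 + expo q + 2) + 0 + 2) + 2) + 2) + 2"
  have wf: "wf_prog 0 q" using assms wf_checks by (simp add: q_def main_prog_def)
  have "\<exists>s'. timed x (main_com ar p) init_state A s' \<and>
    output_is (\<lambda>i. otape s' (i + opos s')) (prog_output ar p x)" for x
  proof -
    define n where "n = prefix_length x"
    have n: "n \<le> length x" by (simp add: n_def prefix_length_le)
    have pre: "x ! i" if "i < n" for i
      using that nth_mem[of i "takeWhile id x"] set_takeWhileD[of "takeWhile id x ! i" id x]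
        takeWhile_nth[of i id x] by (auto simp: n_def prefix_length_def)
    have post: "\<not> x ! n" if "n < length x"
      using nth_length_takeWhile[of id x] that by (simp add: n_def prefix_length_def)
    define S where "S i = represent i l [] (False, i, [])" for i
    have ini: "init_state = S 0"
    proof -
      have "ctrs 0 l [] False c = 0" for c by (cases c) auto
      then show ?thesis
        by (simp add: init_state_def S_def represent_def input_tape_def fun_eq_iff)
    qed
    have 1: "timed x (While (Sym 2) (Seq (Do InR) (incs l))) init_state (0 + 2 * l + 2 + 3) (S n)"
    proof (rule timed_While[where S = S and N = n])
      fix i assume i: "i < n"
      let ?inc = "\<lambda>f c. case c of Co j \<Rightarrow> if j < l then Suc (f c) else f c | _ \<Rightarrow> f c"
      have "?inc (ctrs i l [] False) = ctrs (Suc i) l [] False"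
        by (auto simp: fun_eq_iff ctrs_def split: ctr.split)
      moreover have "cnt (exec InR (S i)) = ctrs i l [] False" by (simp add: S_def)
      ultimately have "?inc (cnt (exec InR (S i))) = ctrs (Suc i) l [] False" by (simp only:)
      then have "(exec InR (S i))\<lparr>cnt := ?inc (cnt (exec InR (S i)))\<rparr> =
          (exec InR (S i))\<lparr>cnt := ctrs (Suc i) l [] False\<rparr>" by (simp only:)
      also have "\<dots> = S (Suc i)" by (simp add: S_def represent_def)
      finally have "(exec InR (S i))\<lparr>cnt := ?inc (cnt (exec InR (S i)))\<rparr> = S (Suc i)" .
      then have "timed x (Seq (Do InR) (incs l)) (S i) (0 + 2 * l + 2) (S (Suc i))"
        using timed_Seq[OF timed_Do[of x InR "S i" 0] timed_incs[of x l]] by metis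
      then show "holds x (S i) (Sym 2) \<and> timed x (Seq (Do InR) (incs l)) (S i) (0 + 2 * l + 2) (S (Suc i))"
        using i n pre by (simp add: S_def input_tape_def bit_sym_def)
    next
      show "\<not> holds x (S n) (Sym 2)"
        using post by (auto simp: S_def input_tape_def bit_sym_def)
    qed (use n ini in auto)
    obtain b j ys where m: "sem x n q [] (False, n, []) = (b, j, ys)" by (cases "sem x n q [] (False, n, [])")
    have 2: "timed x (compile 0 q) (S n) (expo q) (represent n l [] (b, j, ys))"
      using compile_correct[of "[]" q n l x "(False, n, [])"] wf n by (simp add: l_def S_def m)
    have ys: "ys = prog_output ar p x" using m by (simp add: prog_output_def q_def n_def)
    have "opos (represent n l [] (b, j, ys)) \<le> opos (S n) + int ((length x + 2) ^ expo q)"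
      using 2 unfolding timed_def by (rule run_opos)
    then have ylen: "length ys \<le> (length x + 2) ^ expo q"
      by (simp add: S_def flip: of_nat_le_iff[where 'a = int])
    let ?r = "represent n l [] (b, j, ys)"
    have 3: "timed x (Do OutL) ?r 0 (?r\<lparr>opos := int (length ys) - 1\<rparr>)"
      by (rule timed_Do') simp
    have 4: "timed x (While (Neg OutBlank) (Do OutL)) (?r\<lparr>opos := int (length ys) - 1\<rparr>) (0 + expo q + 2)
        (?r\<lparr>opos := -1\<rparr>)"
      by (rule timed_While_gen[where S = "\<lambda>i. ?r\<lparr>opos := int (length ys) - 1 - int i\<rparr>" and N = "length ys"])
        (use ylen in \<open>auto intro!: timed_Do' simp: input_tape_def bit_sym_def\<close>)
    have 5: "timed x (Do OutR) (?r\<lparr>opos := -1\<rparr>) 0 (?r\<lparr>opos := 0\<rparr>)"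
      by (rule timed_Do') simp
    have "timed x (main_com ar p) init_state A (?r\<lparr>opos := 0\<rparr>)"
      unfolding main_com_def q_def[symmetric] l_def[symmetric] A_def
      by (rule timed_Seq[OF 1 timed_Seq[OF 2 timed_Seq[OF 3 timed_Seq[OF 4 5]]]])
    moreover have "output_is (\<lambda>i. otape (?r\<lparr>opos := 0\<rparr>) (i + opos (?r\<lparr>opos := 0\<rparr>))) ys"
      by (auto simp: output_is_def input_tape_def)
    ultimately show ?thesis using ys by blast
  qed
  then show ?thesis by blast
qed

theorem poly_time_prog_output:
  assumes "wf_prog 0 p"
  shows "poly_time (prog_output ar p)"
proof -
  obtain a where a: "\<And>x. \<exists>s'. timed x (main_com ar p) init_state a s' \<and>
      output_is (\<lambda>i. otape s' (i + opos s')) (prog_output ar p x)"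
    using main_com_correct[OF assms] by blast
  define l where "l = depth (main_prog ar p)"
  have "wf_prog 0 (main_prog ar p)" using assms wf_checks by (simp add: main_prog_def)
  then have "com_bound (2 * l + 4) (main_com ar p)"
    using compile_bound[of 0 "main_prog ar p" l] incs_bound[of l l]
    by (simp add: main_com_def l_def)
  then show ?thesis using a unfolding timed_def by (rule poly_time_com)
qed

theorem poly_reducible_generable:
  assumes "generable ar 0 G"
    and "\<And>x. x \<in> L \<Longrightarrow> \<exists>n Rs. structure_of ar ({..<n}, Rs) \<and> x = encode n ar Rs"
    and "[] \<notin> L'"
    and "\<And>n Rs. structure_of ar ({..<n}, Rs) \<Longrightarrow> encode n ar Rs \<in> L \<longleftrightarrow> G n Rs [] \<in> L'"
  shows "poly_reducible L L'"
proof -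
  obtain p where p: "wf_prog 0 p" "\<And>n Rs \<sigma> b ys. valid ar 0 n Rs \<sigma> \<Longrightarrow>
     \<exists>b'. sem (encode n ar Rs) n p \<sigma> (b, 0, ys) = (b', 0, ys @ G n Rs \<sigma>)"
    using assms(1) unfolding generable_def by blast
  have "x \<in> L \<longleftrightarrow> prog_output ar p x \<in> L'" for x
  proof (cases "\<exists>n Rs. structure_of ar ({..<n}, Rs) \<and> x = encode n ar Rs")
    case True
    then obtain n Rs where x: "structure_of ar ({..<n}, Rs)" "x = encode n ar Rs" by blast
    have "prog_output ar p x = G n Rs []"
      unfolding x(2) using p(1) x(1)
      by (rule prog_output_encode) (use p(2)[of n Rs "[]"] x(1) in \<open>auto simp: valid_def\<close>)
    then show ?thesis using assms(4) x by simp
  next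
    case False
    then show ?thesis using prog_output_not_encode[of ar x p] assms(2,3) by metis
  qed
  then show ?thesis using poly_time_prog_output[OF p(1)] unfolding poly_reducible_def by blast
qed

section \<open>Solutions of orientation problems\<close>

lemma asym_iff_all: "asym r \<longleftrightarrow> (\<forall>x y. (x, y) \<in> r \<longrightarrow> (y, x) \<notin> r)"
  by (auto intro: asymI dest: asymD)

lemma embeds_iff:
  "embeds G H \<longleftrightarrow> (\<exists>f. inj_on f (verts G) \<and> f ` verts G \<subseteq> verts H \<and>
     (\<forall>x\<in>verts G. \<forall>y\<in>verts G. (x, y) \<in> edges G \<longleftrightarrow> (f x, f y) \<in> edges H))"
  (is "_ \<longleftrightarrow> (\<exists>f. ?emb f)")
proof
  assume "embeds G H"
  then obtain A f where "A \<subseteq> verts H" "digraph_iso f G (induced H A)" unfolding embeds_def by blast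
  then have "?emb f" by (auto simp: digraph_iso_def induced_def bij_betw_def)
  then show "\<exists>f. ?emb f" by blast
next
  assume "\<exists>f. ?emb f"
  then obtain f where "?emb f" ..
  then have "digraph_iso f G (induced H (f ` verts G))" "f ` verts G \<subseteq> verts H"
    by (auto simp: digraph_iso_def induced_def bij_betw_def)
  then show "embeds G H" unfolding embeds_def by blast
qed

lemma embedsE:
  assumes "embeds G H"
  obtains f where "inj_on f (verts G)" "\<And>x. x \<in> verts G \<Longrightarrow> f x \<in> verts H"
    "\<And>x y. x \<in> verts G \<Longrightarrow> y \<in> verts G \<Longrightarrow> (x, y) \<in> edges G \<longleftrightarrow> (f x, f y) \<in> edges H"
proof -
  obtain f where f: "inj_on f (verts G) \<and> f ` verts G \<subseteq> verts H \<and>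
     (\<forall>x\<in>verts G. \<forall>y\<in>verts G. (x, y) \<in> edges G \<longleftrightarrow> (f x, f y) \<in> edges H)"
    using assms unfolding embeds_iff by (rule exE)
  show ?thesis
  proof (rule that[of f])
    show "inj_on f (verts G)" using f by (rule conjunct1)
    show "f x \<in> verts H" if "x \<in> verts G" for x using f that by blast
    show "(x, y) \<in> edges G \<longleftrightarrow> (f x, f y) \<in> edges H" if "x \<in> verts G" "y \<in> verts G" for x y
      using f that by simp
  qed
qed

lemma embedsI:
  assumes "inj_on f (verts G)" "\<And>x. x \<in> verts G \<Longrightarrow> f x \<in> verts H"
    "\<And>x y. x \<in> verts G \<Longrightarrow> y \<in> verts G \<Longrightarrow> (x, y) \<in> edges G \<longleftrightarrow> (f x, f y) \<in> edges H"
  shows "embeds G H"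
  unfolding embeds_iff by (intro exI[of _ f] conjI ballI) (use assms in auto)

lemma embeds_trans:
  assumes "embeds G H" "embeds H K"
  shows "embeds G K"
proof (rule embedsE[OF assms(1)], rule embedsE[OF assms(2)])
  fix f g
  assume f: "inj_on f (verts G)" "\<And>x. x \<in> verts G \<Longrightarrow> f x \<in> verts H"
      "\<And>x y. x \<in> verts G \<Longrightarrow> y \<in> verts G \<Longrightarrow> (x, y) \<in> edges G \<longleftrightarrow> (f x, f y) \<in> edges H"
    and g: "inj_on g (verts H)" "\<And>x. x \<in> verts H \<Longrightarrow> g x \<in> verts K"
      "\<And>x y. x \<in> verts H \<Longrightarrow> y \<in> verts H \<Longrightarrow> (x, y) \<in> edges H \<longleftrightarrow> (g x, g y) \<in> edges K"
  show ?thesis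
  proof (rule embedsI[of "g \<circ> f"])
    show "inj_on (g \<circ> f) (verts G)" using f(1,2) g(1) by (auto simp: inj_on_def)
  qed (use f g in auto)
qed

lemma free_of_embeds: "embeds G H \<Longrightarrow> free_of F H \<Longrightarrow> free_of F G"
  unfolding free_of_def using embeds_trans by blast

definition pull :: "('v \<Rightarrow> 'w) \<Rightarrow> 'v set \<Rightarrow> 'w rel \<Rightarrow> 'v rel" where
  "pull g V R = {(x, y). x \<in> V \<and> y \<in> V \<and> (g x, g y) \<in> R}"

lemma embeds_pull: "inj_on g V \<Longrightarrow> g ` V \<subseteq> W \<Longrightarrow> embeds (V, pull g V R) (W, R)"
  by (rule embedsI[of g]) (auto simp: pull_def)

text \<open>\<open>E\<close> contains the edges of prescribed direction, \<open>A\<close> all the edges.\<close>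

definition solution :: "'b digraph set \<Rightarrow> 'v set \<Rightarrow> 'v rel \<Rightarrow> 'v rel \<Rightarrow> 'v rel \<Rightarrow> bool" where
  "solution F V E A R \<longleftrightarrow> R \<subseteq> A \<union> A\<inverse> \<and> A \<subseteq> R \<union> R\<inverse> \<and> asym R \<and> E \<subseteq> R \<and> free_of F (V, R)"

lemma solution_pull:
  assumes "inj_on g V" "g ` V \<subseteq> W" "solution F W E A R"
  shows "solution F V (pull g V E) (pull g V A) (pull g V R)"
  using assms(3) free_of_embeds[OF embeds_pull[OF assms(1,2)], of F R]
  unfolding solution_def asym_iff_all by (auto simp: pull_def)

lemma pull_pull:
  assumes "bij_betw g V W" "E \<subseteq> W \<times> W"
  shows "pull (the_inv_into V g) W (pull g V E) = E"
proof -
  have "the_inv_into V g w \<in> V \<and> g (the_inv_into V g w) = w" if "w \<in> W" for w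
    using that assms(1) by (metis bij_betwE bij_betw_the_inv_into f_the_inv_into_f_bij_betw)
  then show ?thesis using assms(2) by (auto simp: pull_def)
qed

lemma solvable_pull:
  assumes "bij_betw g V W" "E \<subseteq> W \<times> W" "A \<subseteq> W \<times> W"
  shows "(\<exists>R. solution F V (pull g V E) (pull g V A) R) \<longleftrightarrow> (\<exists>R. solution F W E A R)"
proof
  assume "\<exists>R. solution F V (pull g V E) (pull g V A) R"
  then obtain R where R: "solution F V (pull g V E) (pull g V A) R" ..
  have "bij_betw (the_inv_into V g) W V" using assms(1) by (rule bij_betw_the_inv_into)
  then have "solution F W (pull (the_inv_into V g) W (pull g V E)) (pull (the_inv_into V g) W (pull g V A))
      (pull (the_inv_into V g) W R)"
    by (intro solution_pull[OF _ _ R]) (auto simp: bij_betw_def)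
  then show "\<exists>R. solution F W E A R" using assms by (auto simp: pull_pull)
next
  assume "\<exists>R. solution F W E A R"
  then show "\<exists>R. solution F V (pull g V E) (pull g V A) R"
    using solution_pull assms(1) by (metis bij_betw_def order_refl)
qed

definition solves :: "'b digraph set \<Rightarrow> 'v set \<Rightarrow> 'v rel \<Rightarrow> 'v rel \<Rightarrow> bool" where
  "solves F V E R \<longleftrightarrow> R \<subseteq> E \<and> E \<subseteq> R \<union> R\<inverse> \<and> asym R \<and> free_of F (V, R)"

lemma solves_solution: "solves F V E R \<longleftrightarrow> solution F V (E - E\<inverse>) E R"
  unfolding solves_def solution_def asym_iff_all by blast

lemma solves_completion: "irrefl E \<and> completion E R \<and> free_of F (V, R) \<longleftrightarrow> solves F V E R"
proof
  assume *: "irrefl E \<and> completion E R \<and> free_of F (V, R)"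
  have sub: "R \<subseteq> E" using * unfolding completion_def by (elim conjE)
  have free: "free_of F (V, R)" using * by (elim conjE)
  have c: "if (y, x) \<in> E then (x, y) \<in> R \<longleftrightarrow> (y, x) \<notin> R else (x, y) \<in> R" if "(x, y) \<in> E" for x y
    using * that unfolding completion_def by blast
  have "(x, y) \<in> R \<or> (y, x) \<in> R" if "(x, y) \<in> E" for x y
    using c[OF that] by (auto split: if_splits)
  then have cov: "E \<subseteq> R \<union> R\<inverse>" by auto
  have "(y, x) \<notin> R" if "(x, y) \<in> R" for x y
  proof -
    have "(x, y) \<in> E" using sub that by blast
    from c[OF this] show ?thesis using sub that by (auto split: if_splits)
  qed
  then show "solves F V E R" using sub free cov by (simp add: solves_def asym_iff_all)
next
  assume "solves F V E R"
  then have sub: "R \<subseteq> E" and cov: "E \<subseteq> R \<union> R\<inverse>" and as: "asym R" and free: "free_of F (V, R)"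
    by (simp_all add: solves_def)
  have irr: "(x, x) \<notin> E" for x using cov as unfolding asym_iff_all by blast
  have "completion E R"
    unfolding completion_def
  proof (intro conjI allI impI)
    fix x y assume "(x, y) \<in> E"
    moreover have "(x, y) \<in> R \<longrightarrow> (y, x) \<notin> R" using as by (simp add: asym_iff_all)
    ultimately show "if (y, x) \<in> E then (x, y) \<in> R \<longleftrightarrow> (y, x) \<notin> R else (x, y) \<in> R"
      using sub cov by (cases "(y, x) \<in> R") auto
  qed (rule sub)
  then show "irrefl E \<and> completion E R \<and> free_of F (V, R)" using free irr by (simp add: irrefl_def)
qed

lemma pull_id: "pull id W R = R \<inter> W \<times> W"
  by (auto simp: pull_def)

lemma solves_pull:
  assumes "inj_on g V" "g ` V \<subseteq> W" "solves F W E R"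
  shows "solves F V (pull g V E) (pull g V R)"
  using assms(3) free_of_embeds[OF embeds_pull[OF assms(1,2)], of F R]
  unfolding solves_def asym_iff_all by (auto simp: pull_def)

lemma solves_restrict: "solves F W E R \<Longrightarrow> V \<subseteq> W \<Longrightarrow> solves F V (E \<inter> V \<times> V) (R \<inter> V \<times> V)"
  using solves_pull[of id V W F E R] by (simp add: pull_id)

section \<open>The class of forbidden tournaments\<close>

lemma tournament_iff: "tournament (V, R) \<longleftrightarrow> R \<subseteq> V \<times> V \<and> asym R \<and>
    (\<forall>u\<in>V. \<forall>v\<in>V. u \<noteq> v \<longrightarrow> (u, v) \<in> R \<or> (v, u) \<in> R)"
  by (auto simp: tournament_def oriented_graph_def digraph_def total_on_def)

locale forbidden =
  fixes F :: "'b digraph set"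
  assumes finite_F: "finite F"
    and tournament_F: "T \<in> F \<Longrightarrow> tournament T"
    and finite_verts_F: "T \<in> F \<Longrightarrow> finite (verts T)"
    and card_F: "T \<in> F \<Longrightarrow> 2 \<le> card (verts T)"
begin

lemma max_order_ge: "T \<in> F \<Longrightarrow> card (verts T) \<le> max_order F"
  unfolding max_order_def using finite_F by (intro Max_ge) auto

text \<open>A tournament embeds into a clique, so freeness may be checked on any family of
  vertex sets that covers the cliques.\<close>

lemma free_of_cover:
  assumes "\<And>A. A \<subseteq> V \<Longrightarrow> finite A \<Longrightarrow> 2 \<le> card A \<Longrightarrow> card A \<le> max_order F \<Longrightarrow>
      (\<And>u v. u \<in> A \<Longrightarrow> v \<in> A \<Longrightarrow> u \<noteq> v \<Longrightarrow> (u, v) \<in> R \<or> (v, u) \<in> R) \<Longrightarrow>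
      \<exists>W. A \<subseteq> W \<and> free_of F (W, R \<inter> W \<times> W)"
  shows "free_of F (V, R)"
  unfolding free_of_def
proof (intro ballI notI)
  fix T assume T: "T \<in> F" and emb: "embeds T (V, R)"
  obtain f where f: "inj_on f (verts T)" "\<And>x. x \<in> verts T \<Longrightarrow> f x \<in> V"
      "\<And>x y. x \<in> verts T \<Longrightarrow> y \<in> verts T \<Longrightarrow> (x, y) \<in> edges T \<longleftrightarrow> (f x, f y) \<in> R"
    by (rule embedsE[OF emb], rule that) simp_all
  let ?A = "f ` verts T"
  have "(u, v) \<in> R \<or> (v, u) \<in> R" if "u \<in> ?A" "v \<in> ?A" "u \<noteq> v" for u v
  proof -
    obtain x y where "x \<in> verts T" "y \<in> verts T" "u = f x" "v = f y" "x \<noteq> y" using \<open>u \<in> ?A\<close> \<open>v \<in> ?A\<close> \<open>u \<noteq> v\<close> by auto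
    moreover have "total_on (verts T) (edges T)" using tournament_F[OF T] by (simp add: tournament_def)
    ultimately show ?thesis using f(3) by (metis total_on_def)
  qed
  moreover have "finite ?A" "2 \<le> card ?A" "card ?A \<le> max_order F"
    using f(1) finite_verts_F[OF T] card_F[OF T] max_order_ge[OF T] by (auto simp: card_image)
  moreover have "?A \<subseteq> V" using f(2) by auto
  ultimately obtain W where W: "?A \<subseteq> W" "free_of F (W, R \<inter> W \<times> W)" using assms[of ?A] by blast
  have "embeds T (W, R \<inter> W \<times> W)"
    by (rule embedsI[of f]) (use f W(1) in auto)
  then show False using W(2) T by (auto simp: free_of_def)
qed

lemma solves_glue:
  assumes "solves F V1 E1 R1" "solves F V2 E2 R2" "E1 \<subseteq> V1 \<times> V1" "E2 \<subseteq> V2 \<times> V2"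
    and "R1 \<inter> V2 \<times> V2 = R2 \<inter> V1 \<times> V1"
  shows "solves F (V1 \<union> V2) (E1 \<union> E2) (R1 \<union> R2)"
proof -
  have sub: "R1 \<subseteq> V1 \<times> V1" "R2 \<subseteq> V2 \<times> V2" using assms by (auto simp: solves_def)
  have res: "(R1 \<union> R2) \<inter> V1 \<times> V1 = R1" "(R1 \<union> R2) \<inter> V2 \<times> V2 = R2" using sub assms(5) by blast+
  have "free_of F (V1 \<union> V2, R1 \<union> R2)"
  proof (rule free_of_cover)
    fix A assume A: "A \<subseteq> V1 \<union> V2" "\<And>u v. u \<in> A \<Longrightarrow> v \<in> A \<Longrightarrow> u \<noteq> v \<Longrightarrow> (u, v) \<in> R1 \<union> R2 \<or> (v, u) \<in> R1 \<union> R2"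
    have "A \<subseteq> V1 \<or> A \<subseteq> V2"
    proof (rule ccontr)
      assume "\<not> (A \<subseteq> V1 \<or> A \<subseteq> V2)"
      then obtain u v where uv: "u \<in> A" "u \<notin> V1" "v \<in> A" "v \<notin> V2" by blast
      then have "u \<noteq> v" using A(1) by blast
      then show False using A(2)[OF uv(1,3)] uv sub by blast
    qed
    then show "\<exists>W. A \<subseteq> W \<and> free_of F (W, (R1 \<union> R2) \<inter> W \<times> W)"
      using res assms(1,2) unfolding solves_def by metis
  qed
  moreover have "(y, x) \<notin> R1 \<union> R2" if xy: "(x, y) \<in> R1 \<union> R2" for x y
  proof
    assume yx: "(y, x) \<in> R1 \<union> R2"
    have as: "asym R1" "asym R2" using assms by (auto simp: solves_def)
    consider "(x, y) \<in> R1" "(y, x) \<in> R1" | "(x, y) \<in> R2" "(y, x) \<in> R2"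
      | "(x, y) \<in> R1" "(y, x) \<in> R2" | "(x, y) \<in> R2" "(y, x) \<in> R1" using xy yx by blast
    then show False
    proof cases
      case 3
      then have "(x, y) \<in> R2" using sub assms(5) by blast
      then show ?thesis using 3 as by (auto simp: asym_iff_all)
    next
      case 4
      then have "(y, x) \<in> R2" using sub assms(5) by blast
      then show ?thesis using 4 as by (auto simp: asym_iff_all)
    qed (use as in \<open>auto simp: asym_iff_all\<close>)
  qed
  moreover have "R1 \<union> R2 \<subseteq> E1 \<union> E2" "E1 \<union> E2 \<subseteq> (R1 \<union> R2) \<union> (R1 \<union> R2)\<inverse>"
    using assms(1,2) by (auto simp: solves_def)
  ultimately show ?thesis unfolding solves_def asym_iff_all by blast
qed

section \<open>Gadgets\<close>

definition implication :: "nat set \<Rightarrow> nat rel \<Rightarrow> nat \<Rightarrow> nat \<Rightarrow> nat \<Rightarrow> nat \<Rightarrow> bool" where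
  "implication V E p q r s \<longleftrightarrow> finite V \<and> E \<subseteq> V \<times> V \<and> {(p, q), (q, p), (r, s), (s, r)} \<subseteq> E \<and>
     (\<forall>R. solves F V E R \<longrightarrow> (p, q) \<in> R \<longrightarrow> (r, s) \<in> R) \<and>
     (\<exists>R. solves F V E R \<and> (p, q) \<in> R \<and> (r, s) \<in> R) \<and>
     (\<exists>R. solves F V E R \<and> (q, p) \<in> R \<and> (s, r) \<in> R)"

lemma implicationD:
  assumes "implication V E p q r s"
  shows "finite V" "E \<subseteq> V \<times> V" "{(p, q), (q, p), (r, s), (s, r)} \<subseteq> E"
    "solves F V E R \<Longrightarrow> (p, q) \<in> R \<Longrightarrow> (r, s) \<in> R"
    "\<exists>R. solves F V E R \<and> (p, q) \<in> R \<and> (r, s) \<in> R"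
    "\<exists>R. solves F V E R \<and> (q, p) \<in> R \<and> (s, r) \<in> R"
  using assms unfolding implication_def by simp_all

lemma implicationI:
  assumes "finite V" "E \<subseteq> V \<times> V" "{(p, q), (q, p), (r, s), (s, r)} \<subseteq> E"
    "\<And>R. solves F V E R \<Longrightarrow> (p, q) \<in> R \<Longrightarrow> (r, s) \<in> R"
    "\<exists>R. solves F V E R \<and> (p, q) \<in> R \<and> (r, s) \<in> R"
    "\<exists>R. solves F V E R \<and> (q, p) \<in> R \<and> (s, r) \<in> R"
  shows "implication V E p q r s"
  unfolding implication_def using assms by simp

lemma implication_irrefl:
  assumes "implication V E p q r s"
  shows "(x, x) \<notin> E" "p \<noteq> q" "r \<noteq> s"
proof -
  obtain R where "solves F V E R" using assms by (auto simp: implication_def)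
  then show *: "(x, x) \<notin> E" for x unfolding solves_def asym_iff_all by blast
  show "p \<noteq> q" "r \<noteq> s" using assms * by (auto simp: implication_def)
qed

lemma solves_flip: "solves F V E R \<Longrightarrow> (p, q) \<in> E \<Longrightarrow> (q, p) \<in> R \<longleftrightarrow> (p, q) \<notin> R"
  unfolding solves_def asym_iff_all by blast

lemma implication_contrapos:
  assumes "implication V E p q r s"
  shows "implication V E s r q p"
proof -
  have E: "(p, q) \<in> E" "(r, s) \<in> E" using assms by (auto simp: implication_def)
  then have "\<forall>R. solves F V E R \<longrightarrow> (s, r) \<in> R \<longrightarrow> (q, p) \<in> R"
    using assms solves_flip unfolding implication_def by metis
  then show ?thesis using assms unfolding implication_def by blast
qed

lemma implication_rename:
  assumes imp: "implication V E p q r s" and inj: "inj_on g V"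
  shows "implication (g ` V) (map_prod g g ` E) (g p) (g q) (g r) (g s)"
proof -
  have E: "E \<subseteq> V \<times> V" "finite V" "{(p, q), (q, p), (r, s), (s, r)} \<subseteq> E" using imp by (auto simp: implication_def)
  then have ports: "p \<in> V" "q \<in> V" "r \<in> V" "s \<in> V" by auto
  have bij: "bij_betw g V (g ` V)" using inj by (simp add: bij_betw_def)
  have unrename: "pull g V (map_prod g g ` X) = X" if "X \<subseteq> V \<times> V" for X
  proof -
    have A: "(x, y) \<in> X" if xy: "x \<in> V" "y \<in> V" "(g x, g y) \<in> map_prod g g ` X" for x y
    proof -
      obtain x' y' where x'y': "(x', y') \<in> X" "g x = g x'" "g y = g y'" using xy(3) by auto
      then have "x = x'" "y = y'" using \<open>X \<subseteq> V \<times> V\<close> inj_onD[OF inj] xy(1,2) by blast+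
      then show ?thesis using x'y'(1) by simp
    qed
    have B: "(g x, g y) \<in> map_prod g g ` X" if "(x, y) \<in> X" for x y
      using that by (rule map_prod_imageI)
    have "(x, y) \<in> pull g V (map_prod g g ` X) \<longleftrightarrow> (x, y) \<in> X" for x y
    proof -
      have "(x, y) \<in> pull g V (map_prod g g ` X) \<longleftrightarrow> x \<in> V \<and> y \<in> V \<and> (g x, g y) \<in> map_prod g g ` X"
        by (simp add: pull_def)
      moreover have "(x, y) \<in> X \<longrightarrow> x \<in> V \<and> y \<in> V" using \<open>X \<subseteq> V \<times> V\<close> by auto
      ultimately show ?thesis using A[of x y] B[of x y] by argo
    qed
    then show ?thesis by auto
  qed
  have fwd: "solves F (g ` V) (map_prod g g ` E) (map_prod g g ` R)" if R: "solves F V E R" for R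
  proof -
    have sub: "R \<subseteq> V \<times> V" using R E by (auto simp: solves_def)
    have *: "pull (the_inv_into V g) (g ` V) X = map_prod g g ` X" if "X \<subseteq> V \<times> V" for X
    proof -
      have "map_prod g g ` X \<subseteq> g ` V \<times> g ` V"
      proof
        fix z assume "z \<in> map_prod g g ` X"
        then obtain x y where "(x, y) \<in> X" "z = (g x, g y)" by auto
        then show "z \<in> g ` V \<times> g ` V" using that by auto
      qed
      from pull_pull[OF bij this] show ?thesis unfolding unrename[OF that] .
    qed
    have "bij_betw (the_inv_into V g) (g ` V) V" using bij by (rule bij_betw_the_inv_into)
    then have "solves F (g ` V) (pull (the_inv_into V g) (g ` V) E) (pull (the_inv_into V g) (g ` V) R)"
      by (intro solves_pull[OF _ _ R]) (auto simp: bij_betw_def)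
    then show ?thesis using * E(1) sub by simp
  qed
  have "(g r, g s) \<in> R" if R: "solves F (g ` V) (map_prod g g ` E) R" and pq: "(g p, g q) \<in> R" for R
  proof -
    have "solves F V E (pull g V R)"
      using solves_pull[OF inj order_refl R] unrename[OF E(1)] by simp
    moreover have "(p, q) \<in> pull g V R" using pq ports by (simp add: pull_def)
    ultimately have "(r, s) \<in> pull g V R" by (rule implicationD(4)[OF imp])
    then show ?thesis by (simp add: pull_def)
  qed
  moreover obtain R where "solves F V E R" "(p, q) \<in> R" "(r, s) \<in> R" using implicationD(5)[OF imp] by blast
  then have "\<exists>R. solves F (g ` V) (map_prod g g ` E) R \<and> (g p, g q) \<in> R \<and> (g r, g s) \<in> R"
    using fwd[of R] map_prod_imageI[of _ _ R g g] by blast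
  moreover obtain R where "solves F V E R" "(q, p) \<in> R" "(s, r) \<in> R" using implicationD(6)[OF imp] by blast
  then have "\<exists>R. solves F (g ` V) (map_prod g g ` E) R \<and> (g q, g p) \<in> R \<and> (g s, g r) \<in> R"
    using fwd[of R] map_prod_imageI[of _ _ R g g] by blast
  moreover have "map_prod g g ` E \<subseteq> g ` V \<times> g ` V" using E(1) by auto
  moreover have "{(g p, g q), (g q, g p), (g r, g s), (g s, g r)} \<subseteq> map_prod g g ` E"
    using E(3) by (auto intro: map_prod_imageI)
  ultimately show ?thesis using E(2) by (intro implicationI) auto
qed

lemma implication_compose:
  assumes 1: "implication V1 E1 p q r s" and 2: "implication V2 E2 r s u v" and V: "V1 \<inter> V2 = {r, s}"
  shows "implication (V1 \<union> V2) (E1 \<union> E2) p q u v"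
proof -
  have E: "E1 \<subseteq> V1 \<times> V1" "E2 \<subseteq> V2 \<times> V2" and rs: "{(r, s), (s, r)} \<subseteq> E1" "{(r, s), (s, r)} \<subseteq> E2"
    using 1 2 by (auto simp: implication_def)
  define P where "P = {r, s}"
  define Q where "Q = {(r, s), (s, r)}"
  have over: "X \<inter> P \<times> P \<subseteq> Q" if "X \<subseteq> E1 \<union> E2" for X
    using that implication_irrefl(1)[OF 1] implication_irrefl(1)[OF 2] unfolding P_def Q_def by blast
  have Q: "Q \<subseteq> E1" "Q \<subseteq> E2" "Q \<subseteq> P \<times> P" using rs unfolding Q_def P_def by simp_all
  have VP: "V1 \<inter> V2 = P" using V by (simp add: P_def)
  have inter1: "X \<inter> V2 \<times> V2 = X \<inter> Q" if "X \<subseteq> E1" for X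
  proof -
    have "X \<inter> V2 \<times> V2 = X \<inter> P \<times> P" using that E(1) VP by blast
    also have "\<dots> = X \<inter> Q" using over[of X] that Q(3) by blast
    finally show ?thesis .
  qed
  have inter2: "X \<inter> V1 \<times> V1 = X \<inter> Q" if "X \<subseteq> E2" for X
  proof -
    have "X \<inter> V1 \<times> V1 = X \<inter> P \<times> P" using that E(2) VP by blast
    also have "\<dots> = X \<inter> Q" using over[of X] that Q(3) by blast
    finally show ?thesis .
  qed
  have res: "(E1 \<union> E2) \<inter> V1 \<times> V1 = E1" "(E1 \<union> E2) \<inter> V2 \<times> V2 = E2"
    using inter1[OF order_refl] inter2[OF order_refl] E Q by blast+
  have imp: "(u, v) \<in> R" if R: "solves F (V1 \<union> V2) (E1 \<union> E2) R" "(p, q) \<in> R" for R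
  proof -
    have 11: "solves F V1 E1 (R \<inter> V1 \<times> V1)" and 22: "solves F V2 E2 (R \<inter> V2 \<times> V2)"
      using solves_restrict[OF R(1), of V1] solves_restrict[OF R(1), of V2] res by simp_all
    have "(p, q) \<in> R \<inter> V1 \<times> V1" using R(2) 1 by (auto simp: implication_def)
    then have "(r, s) \<in> R \<inter> V1 \<times> V1" using implicationD(4)[OF 1 11] by blast
    then have "(r, s) \<in> R \<inter> V2 \<times> V2" using V by blast
    then show ?thesis using implicationD(4)[OF 2 22] by blast
  qed
  have glue: "solves F (V1 \<union> V2) (E1 \<union> E2) (R1 \<union> R2)"
    if R1: "solves F V1 E1 R1" and R2: "solves F V2 E2 R2" and rs_iff: "(r, s) \<in> R1 \<longleftrightarrow> (r, s) \<in> R2" for R1 R2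
  proof (rule solves_glue[OF R1 R2 E])
    have sub: "R1 \<subseteq> E1" "R2 \<subseteq> E2" using R1 R2 by (auto simp: solves_def)
    have "R1 \<inter> V2 \<times> V2 = R1 \<inter> Q" "R2 \<inter> V1 \<times> V1 = R2 \<inter> Q"
      using inter1 inter2 sub by simp_all
    moreover have "(s, r) \<in> R1 \<longleftrightarrow> (s, r) \<in> R2"
      using solves_flip[OF R1, of r s] solves_flip[OF R2, of r s] rs rs_iff by blast
    then have "R1 \<inter> Q = R2 \<inter> Q" using rs_iff unfolding Q_def by blast
    ultimately show "R1 \<inter> V2 \<times> V2 = R2 \<inter> V1 \<times> V1" by simp
  qed
  show ?thesis
  proof (rule implicationI)
    obtain R1 where R1: "solves F V1 E1 R1" "(p, q) \<in> R1" "(r, s) \<in> R1" using implicationD(5)[OF 1] by blast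
    obtain R2 where R2: "solves F V2 E2 R2" "(r, s) \<in> R2" "(u, v) \<in> R2" using implicationD(5)[OF 2] by blast
    show "\<exists>R. solves F (V1 \<union> V2) (E1 \<union> E2) R \<and> (p, q) \<in> R \<and> (u, v) \<in> R"
      using glue[OF R1(1) R2(1)] R1 R2 by (intro exI[of _ "R1 \<union> R2"]) simp
  next
    obtain R1 where R1: "solves F V1 E1 R1" "(q, p) \<in> R1" "(s, r) \<in> R1" using implicationD(6)[OF 1] by blast
    obtain R2 where R2: "solves F V2 E2 R2" "(s, r) \<in> R2" "(v, u) \<in> R2" using implicationD(6)[OF 2] by blast
    have "(r, s) \<notin> R1" "(r, s) \<notin> R2"
      using solves_flip[OF R1(1), of r s] solves_flip[OF R2(1), of r s] R1(3) R2(2) rs by simp_all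
    then show "\<exists>R. solves F (V1 \<union> V2) (E1 \<union> E2) R \<and> (q, p) \<in> R \<and> (v, u) \<in> R"
      using glue[OF R1(1) R2(1)] R1 R2 by (intro exI[of _ "R1 \<union> R2"]) simp
  next
    show "E1 \<union> E2 \<subseteq> (V1 \<union> V2) \<times> (V1 \<union> V2)" using E by blast
    show "{(p, q), (q, p), (u, v), (v, u)} \<subseteq> E1 \<union> E2"
      using implicationD(3)[OF 1] implicationD(3)[OF 2] by simp
  qed (use imp implicationD(1)[OF 1] implicationD(1)[OF 2] in auto)
qed

lemma fresh_renaming:
  assumes "finite V" "finite X" "inj_on g0 S"
  shows "\<exists>g :: nat \<Rightarrow> nat. inj_on g V \<and> (\<forall>v\<in>S. g v = g0 v) \<and> (\<forall>v\<in>V - S. g v \<notin> X \<union> g0 ` (S \<inter> V))"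
proof -
  define N where "N = Suc (Max (insert 0 (X \<union> g0 ` (S \<inter> V))))"
  have N: "x < N" if "x \<in> X \<union> g0 ` (S \<inter> V)" for x
    unfolding N_def less_Suc_eq_le using assms that by (intro Max_ge) auto
  define g where "g v = (if v \<in> S then g0 v else v + N)" for v
  have fresh: "g v \<notin> X \<union> g0 ` (S \<inter> V)" if "v \<notin> S" for v
    using N[of "g v"] that by (auto simp: g_def)
  have "inj_on g V"
  proof (rule inj_onI)
    fix x y assume xy: "x \<in> V" "y \<in> V" "g x = g y"
    show "x = y"
    proof (cases "x \<in> S"; cases "y \<in> S")
      assume "x \<in> S" "y \<in> S"
      then show ?thesis using xy assms(3) by (simp add: g_def inj_on_def)
    next
      assume "x \<in> S" "y \<notin> S"
      then have "g y = g0 x" using xy(3) by (simp add: g_def)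
      then show ?thesis using fresh[OF \<open>y \<notin> S\<close>] imageI[of x "S \<inter> V" g0] \<open>x \<in> S\<close> xy(1) by auto
    next
      assume "x \<notin> S" "y \<in> S"
      then have "g x = g0 y" using xy(3) by (simp add: g_def)
      then show ?thesis using fresh[OF \<open>x \<notin> S\<close>] imageI[of y "S \<inter> V" g0] \<open>y \<in> S\<close> xy(2) by auto
    next
      assume "x \<notin> S" "y \<notin> S"
      then show ?thesis using xy by (simp add: g_def)
    qed
  qed
  then show ?thesis using fresh by (intro exI[of _ g]) (auto simp: g_def)
qed

text \<open>Composing an implication with a contraposed copy of itself makes its two ports disjoint.\<close>

lemma implication_disjoint_ports:
  assumes imp: "implication V E p q r s" and ne: "{p, q} \<noteq> {r, s}"
  shows "\<exists>V' E' r' s'. implication V' E' p q r' s' \<and> {p, q} \<inter> {r', s'} = {}"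
proof -
  have fin: "finite V" and ports: "p \<in> V" "q \<in> V" "r \<in> V" "s \<in> V" using imp by (auto simp: implication_def)
  have "inj_on (\<lambda>x. if x = s then r else s) {r, s}" by (auto simp: inj_on_def)
  from fresh_renaming[OF fin fin this] obtain g where g: "inj_on g V"
    "\<forall>v\<in>{r, s}. g v = (if v = s then r else s)" "\<forall>v\<in>V - {r, s}. g v \<notin> V" by blast
  have rs: "r \<noteq> s" "p \<noteq> q" using implication_irrefl[OF imp] by auto
  then have gg: "g r = s" "g s = r" using g(2) by auto
  have "implication (g ` V) (map_prod g g ` E) r s (g q) (g p)"
    using implication_rename[OF implication_contrapos[OF imp] g(1)] gg by simp
  moreover have "V \<inter> g ` V = {r, s}"
  proof
    show "V \<inter> g ` V \<subseteq> {r, s}" using g(3) gg by blast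
    show "{r, s} \<subseteq> V \<inter> g ` V" using ports gg by (metis IntI empty_subsetI image_eqI insert_subset)
  qed
  ultimately have "implication (V \<union> g ` V) (E \<union> map_prod g g ` E) p q (g q) (g p)"
    using implication_compose[OF imp] by blast
  moreover have "{p, q} \<inter> {g q, g p} = {}"
  proof -
    have "g p \<notin> {p, q}"
    proof (cases "p \<in> {r, s}")
      case True then show ?thesis using gg ne rs by auto
    next
      case False
      then have "g p \<notin> V" using g(3) ports by blast
      then show ?thesis using ports by auto
    qed
    moreover have "g q \<notin> {p, q}"
    proof (cases "q \<in> {r, s}")
      case True then show ?thesis using gg ne rs by auto
    next
      case False
      then have "g q \<notin> V" using g(3) ports by blast
      then show ?thesis using ports by auto
    qed
    ultimately show ?thesis by auto
  qed
  ultimately show ?thesis by blast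
qed

lemma implication_separated_ports:
  assumes imp: "implication V E p q r s" and ne: "{p, q} \<inter> {r, s} = {}"
  shows "\<exists>V' E' r' s'. implication V' E' p q r' s' \<and> {p, q} \<inter> {r', s'} = {} \<and>
    E' \<inter> ({p, q} \<times> {r', s'} \<union> {r', s'} \<times> {p, q}) = {}"
proof -
  have fin: "finite V" and E: "E \<subseteq> V \<times> V" and ports: "p \<in> V" "q \<in> V" "r \<in> V" "s \<in> V"
    using imp by (auto simp: implication_def)
  have rs: "r \<noteq> s" "p \<noteq> q" using implication_irrefl[OF imp] by auto
  have "inj_on (\<lambda>x. if x = p then r else s) {p, q}" using rs by (auto simp: inj_on_def)
  from fresh_renaming[OF fin fin this] obtain g where g: "inj_on g V"
    "\<forall>v\<in>{p, q}. g v = (if v = p then r else s)" "\<forall>v\<in>V - {p, q}. g v \<notin> V" by blast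
  have gg: "g p = r" "g q = s" using g(2) rs by auto
  have "implication (g ` V) (map_prod g g ` E) r s (g r) (g s)"
    using implication_rename[OF imp g(1)] gg by simp
  moreover have V: "V \<inter> g ` V = {r, s}"
  proof
    show "V \<inter> g ` V \<subseteq> {r, s}" using g(3) gg by blast
    show "{r, s} \<subseteq> V \<inter> g ` V" using ports gg by (metis IntI empty_subsetI image_eqI insert_subset)
  qed
  ultimately have "implication (V \<union> g ` V) (E \<union> map_prod g g ` E) p q (g r) (g s)"
    using implication_compose[OF imp] by blast
  moreover have fresh: "g r \<notin> V" "g s \<notin> V" using g(3) ports ne by auto
  then have "{p, q} \<inter> {g r, g s} = {}" using ports by auto
  moreover have "p \<notin> g ` V" "q \<notin> g ` V" using V ports ne by blast+
  then have "(E \<union> map_prod g g ` E) \<inter> ({p, q} \<times> {g r, g s} \<union> {g r, g s} \<times> {p, q}) = {}"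
    using fresh E by auto
  ultimately show ?thesis by blast
qed

definition equality :: "nat set \<Rightarrow> nat rel \<Rightarrow> nat \<Rightarrow> nat \<Rightarrow> nat \<Rightarrow> nat \<Rightarrow> bool" where
  "equality V E p q r s \<longleftrightarrow> finite V \<and> E \<subseteq> V \<times> V \<and> {(p, q), (q, p), (r, s), (s, r)} \<subseteq> E \<and>
     distinct [p, q, r, s] \<and> E \<inter> ({p, q} \<times> {r, s} \<union> {r, s} \<times> {p, q}) = {} \<and>
     (\<forall>R. solves F V E R \<longrightarrow> ((p, q) \<in> R \<longleftrightarrow> (r, s) \<in> R)) \<and>
     (\<exists>R. solves F V E R \<and> (p, q) \<in> R \<and> (r, s) \<in> R) \<and>
     (\<exists>R. solves F V E R \<and> (q, p) \<in> R \<and> (s, r) \<in> R)"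

lemma equality_of_implication:
  assumes imp: "implication V E p q r s" and ne: "{p, q} \<inter> {r, s} = {}"
    and sep: "E \<inter> ({p, q} \<times> {r, s} \<union> {r, s} \<times> {p, q}) = {}"
  shows "\<exists>V' E'. equality V' E' p q r s"
proof -
  have fin: "finite V" and E: "E \<subseteq> V \<times> V" and ports: "p \<in> V" "q \<in> V" "r \<in> V" "s \<in> V"
    and pE: "{(p, q), (q, p), (r, s), (s, r)} \<subseteq> E"
    using imp by (auto simp: implication_def)
  have rs: "r \<noteq> s" "p \<noteq> q" using implication_irrefl[OF imp] by auto
  define P where "P = {p, q, r, s}"
  define Q where "Q = {(p, q), (q, p), (r, s), (s, r)}"
  define g0 where "g0 x = (if x = p then r else if x = q then s else if x = r then p else q)" for x
  have "inj_on g0 P" using rs ne by (auto simp: inj_on_def g0_def P_def)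
  from fresh_renaming[OF fin fin this] obtain g where g: "inj_on g V"
    "\<forall>v\<in>P. g v = g0 v" "\<forall>v\<in>V - P. g v \<notin> V" by blast
  have gg: "g p = r" "g q = s" "g r = p" "g s = q" using g(2) rs ne by (auto simp: P_def g0_def)
  define W where "W = g ` V"
  define D where "D = map_prod g g ` E"
  have imp': "implication W D r s p q"
    using implication_rename[OF imp g(1)] gg by (simp add: W_def D_def)
  have V: "V \<inter> W = P"
  proof
    show "V \<inter> W \<subseteq> P"
    proof
      fix y assume "y \<in> V \<inter> W"
      then obtain v where "v \<in> V" "y = g v" "g v \<in> V" unfolding W_def by blast
      then have "v \<in> P" using g(3) by blast
      then show "y \<in> P" using gg \<open>y = g v\<close> by (auto simp: P_def)
    qed
    show "P \<subseteq> V \<inter> W" using ports gg unfolding P_def W_def by (metis IntI empty_subsetI image_eqI insert_subset)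
  qed
  have loop: "(x, x) \<notin> E" "(x, x) \<notin> D" for x
    using implication_irrefl(1)[OF imp] implication_irrefl(1)[OF imp'] by auto
  have EP: "E \<inter> P \<times> P = Q"
    using sep pE loop(1) unfolding P_def Q_def by blast
  have EP': "D \<inter> P \<times> P = Q"
  proof -
    have "(x, y) \<in> Q" if xy: "x \<in> P" "y \<in> P" "(x, y) \<in> D" for x y
    proof -
      obtain a b where ab: "(a, b) \<in> E" "x = g a" "y = g b" using xy(3) by (auto simp: D_def)
      then have "a \<in> P" "b \<in> P" using g(3) E xy(1,2) V by blast+
      then have "(a, b) \<in> Q" using EP ab(1) by blast
      then show ?thesis using ab gg by (auto simp: Q_def)
    qed
    moreover have "Q \<subseteq> D" using imp' by (auto simp: Q_def implication_def)
    moreover have "Q \<subseteq> P \<times> P" by (auto simp: Q_def P_def)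
    ultimately show ?thesis by auto
  qed
  have E': "D \<subseteq> W \<times> W" using E by (auto simp: W_def D_def)
  have over: "E \<inter> W \<times> W = Q" "D \<inter> V \<times> V = Q" using EP EP' E E' V by blast+
  have Q_sub: "Q \<subseteq> E" "Q \<subseteq> D" using EP EP' by blast+
  have res: "(E \<union> D) \<inter> V \<times> V = E" "(E \<union> D) \<inter> W \<times> W = D" using E E' over Q_sub by blast+
  have iff: "(p, q) \<in> R \<longleftrightarrow> (r, s) \<in> R" if R: "solves F (V \<union> W) (E \<union> D) R" for R
  proof -
    have 1: "solves F V E (R \<inter> V \<times> V)" and 2: "solves F W D (R \<inter> W \<times> W)"
      using solves_restrict[OF R, of V] solves_restrict[OF R, of W] res by simp_all
    have PV: "P \<subseteq> V" "P \<subseteq> W" using V by auto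
    show ?thesis
    proof
      assume "(p, q) \<in> R"
      then have "(p, q) \<in> R \<inter> V \<times> V" using PV by (auto simp: P_def)
      then show "(r, s) \<in> R" using implicationD(4)[OF imp 1] by blast
    next
      assume "(r, s) \<in> R"
      then have "(r, s) \<in> R \<inter> W \<times> W" using PV by (auto simp: P_def)
      then show "(p, q) \<in> R" using implicationD(4)[OF imp' 2] by blast
    qed
  qed
  have glue: "solves F (V \<union> W) (E \<union> D) (R1 \<union> R2)"
    if R1: "solves F V E R1" and R2: "solves F W D R2" and same: "R1 \<inter> Q = R2 \<inter> Q" for R1 R2
  proof (rule solves_glue[OF R1 R2 E E'])
    have "R1 \<subseteq> E" "R2 \<subseteq> D" using R1 R2 by (auto simp: solves_def)
    then show "R1 \<inter> W \<times> W = R2 \<inter> V \<times> V" using over same by blast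
  qed
  have QE: "(p, q) \<in> E" "(r, s) \<in> E" "(p, q) \<in> D" "(r, s) \<in> D" using Q_sub by (auto simp: Q_def)
  obtain R1 where R1: "solves F V E R1" "(p, q) \<in> R1" "(r, s) \<in> R1"
    using implicationD(5)[OF imp] by blast
  obtain R2 where R2: "solves F W D R2" "(p, q) \<in> R2" "(r, s) \<in> R2"
    using implicationD(5)[OF imp'] by blast
  have "R1 \<inter> Q = R2 \<inter> Q"
    using R1 R2 solves_flip[OF R1(1) QE(1)] solves_flip[OF R1(1) QE(2)]
      solves_flip[OF R2(1) QE(3)] solves_flip[OF R2(1) QE(4)] unfolding Q_def by blast
  then have ex1: "\<exists>R. solves F (V \<union> W) (E \<union> D) R \<and> (p, q) \<in> R \<and> (r, s) \<in> R"
    using glue[OF R1(1) R2(1)] R1 by blast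
  obtain R1 where R1: "solves F V E R1" "(q, p) \<in> R1" "(s, r) \<in> R1"
    using implicationD(6)[OF imp] by blast
  obtain R2 where R2: "solves F W D R2" "(q, p) \<in> R2" "(s, r) \<in> R2"
    using implicationD(6)[OF imp'] by blast
  have "R1 \<inter> Q = R2 \<inter> Q"
    using R1 R2 solves_flip[OF R1(1) QE(1)] solves_flip[OF R1(1) QE(2)]
      solves_flip[OF R2(1) QE(3)] solves_flip[OF R2(1) QE(4)] unfolding Q_def by blast
  then have ex2: "\<exists>R. solves F (V \<union> W) (E \<union> D) R \<and> (q, p) \<in> R \<and> (s, r) \<in> R"
    using glue[OF R1(1) R2(1)] R1 by blast
  have "(E \<union> D) \<inter> P \<times> P \<subseteq> Q" using EP EP' by blast
  then have "(E \<union> D) \<inter> ({p, q} \<times> {r, s} \<union> {r, s} \<times> {p, q}) = {}"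
    using ne by (fastforce simp: P_def Q_def)
  moreover have "distinct [p, q, r, s]" using rs ne by auto
  moreover have "Q \<subseteq> E \<union> D" "finite (V \<union> W)" "E \<union> D \<subseteq> (V \<union> W) \<times> (V \<union> W)"
    using Q_sub fin E E' by (auto simp: W_def)
  ultimately have "equality (V \<union> W) (E \<union> D) p q r s"
    unfolding equality_def using iff ex1 ex2 unfolding Q_def by blast
  then show ?thesis by blast
qed

end

subsection \<open>Existence of gadgets\<close>

lemma not_interval_closed:
  fixes S :: "'c set set"
  assumes sub: "S \<subseteq> Pow D" and S: "{} \<in> S" "D \<in> S" and W: "W \<subseteq> D" "W \<notin> S"
    and conv: "\<And>X Y Z. X \<in> S \<Longrightarrow> Y \<in> S \<Longrightarrow> X \<subseteq> Z \<Longrightarrow> Z \<subseteq> Y \<Longrightarrow> Z \<notin> S \<Longrightarrow> X = {} \<and> Y = D"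
  shows "\<exists>e\<in>D. \<exists>f\<in>D. e \<noteq> f \<and> (\<forall>X\<in>S. e \<in> X \<longrightarrow> f \<in> X)"
proof (cases "S = {{}, D}")
  case True
  then have "W \<noteq> {}" "W \<noteq> D" using W(2) by blast+
  then obtain e f where ef: "e \<in> W" "f \<in> D" "f \<notin> W" using W(1) by blast
  have "e \<in> D" "e \<noteq> f" using ef W(1) by blast+
  moreover have "f \<in> X" if "X \<in> S" "e \<in> X" for X
  proof -
    have "X = {} \<or> X = D" using that(1) True by simp
    then show ?thesis using that(2) ef(2) by blast
  qed
  ultimately show ?thesis using ef(2) by (intro bexI[of _ e] bexI[of _ f] conjI ballI impI)
next
  case False
  then obtain Z where Z: "Z \<in> S" "Z \<noteq> {}" "Z \<noteq> D" using S by blast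
  have inS: "Z' \<in> S" if "X \<in> S" "Y \<in> S" "X \<subseteq> Z'" "Z' \<subseteq> Y" "X \<noteq> {} \<or> Y \<noteq> D" for X Y Z'
    using conv[OF that(1-4)] that(5) by argo
  have ZD: "Z \<subseteq> D" using Z(1) sub by blast
  have "\<exists>d\<in>D. {d} \<notin> S"
  proof (rule ccontr)
    assume "\<not> ?thesis"
    moreover have "W \<noteq> {}" using W(2) S(1) by metis
    then obtain w where w: "w \<in> W" by blast
    ultimately have "{w} \<in> S" using W(1) by blast
    then have "W \<in> S" by (rule inS[OF _ S(2)]) (use w W(1) in auto)
    then show False using W(2) by simp
  qed
  then obtain d where d: "d \<in> D" "{d} \<notin> S" by blast
  have dZ: "d \<notin> Z"
  proof
    assume "d \<in> Z"
    then have "{d} \<in> S" by (intro inS[OF S(1) Z(1)]) (use Z(3) in auto)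
    then show False using d(2) by simp
  qed
  have insZ: "insert d Z \<in> S" by (rule inS[OF Z(1) S(2)]) (use Z(2) ZD d(1) in auto)
  have D: "insert d Z = D"
  proof (rule ccontr)
    assume "insert d Z \<noteq> D"
    then have "{d} \<in> S" by (intro inS[OF S(1) insZ]) auto
    then show False using d(2) by simp
  qed
  have "\<exists>e\<in>D. D - {e} \<notin> S"
  proof (rule ccontr)
    assume "\<not> ?thesis"
    moreover have "W \<noteq> D" using W(2) S(2) by metis
    then obtain w where w: "w \<in> D" "w \<notin> W" using W(1) by blast
    ultimately have "D - {w} \<in> S" by blast
    then have "W \<in> S" by (rule inS[OF S(1)]) (use w W(1) in auto)
    then show False using W(2) by simp
  qed
  then obtain e where e: "e \<in> D" "D - {e} \<notin> S" by blast
  have eZ: "e \<in> Z"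
  proof (rule ccontr)
    assume "e \<notin> Z"
    then have "D - {e} \<in> S" by (intro inS[OF Z(1) S(2)]) (use Z(2) ZD in auto)
    then show False using e(2) by simp
  qed
  have Ze: "Z - {e} \<in> S" by (rule inS[OF S(1) Z(1)]) (use Z(3) in auto)
  have "Z - {e} = {}"
  proof (rule ccontr)
    assume "Z - {e} \<noteq> {}"
    then have "D - {e} \<in> S" by (intro inS[OF Ze S(2)]) (use ZD in auto)
    then show False using e(2) by simp
  qed
  then have D': "D = {d, e}" using D eZ by blast
  have "e \<in> X" if "X \<in> S" "d \<in> X" for X
  proof (rule ccontr)
    assume "e \<notin> X"
    moreover have "X \<subseteq> {d, e}" using that(1) sub D' by blast
    ultimately have "X = {d}" using that(2) by blast
    then show False using that(1) d(2) by simp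
  qed
  moreover have "d \<noteq> e" using dZ eZ by metis
  ultimately show ?thesis using d(1) e(1) by (intro bexI[of _ d] bexI[of _ e] conjI ballI impI)
qed

lemma ball_edge_tuples: "(\<forall>t\<in>edge_tuples E. P t) \<longleftrightarrow> (\<forall>x y. (x, y) \<in> E \<longrightarrow> P [x, y])"
  unfolding edge_tuples_def by blast

lemma edge_tuples_iff: "[x, y] \<in> edge_tuples E \<longleftrightarrow> (x, y) \<in> E"
  by (simp add: edge_tuples_def)

context forbidden
begin

lemma tournament_subset_eq:
  assumes "tournament (V, R)" "tournament (V, Z)" "Z \<subseteq> R"
  shows "Z = R"
proof
  show "R \<subseteq> Z"
  proof
    fix z assume "z \<in> R"
    then obtain x y where xy: "z = (x, y)" "(x, y) \<in> R" by (cases z) simp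
    then have "x \<in> V" "y \<in> V" "x \<noteq> y" "(y, x) \<notin> R"
      using assms(1) unfolding tournament_iff asym_iff_all by blast+
    then have "(x, y) \<in> Z \<or> (y, x) \<in> Z" "(y, x) \<notin> Z" using assms(2,3) unfolding tournament_iff by blast+
    then show "z \<in> Z" using xy by blast
  qed
qed (rule assms(3))

lemma tournament_flip:
  assumes T: "tournament (V, T)" and ji: "(j, i) \<in> T"
  shows "tournament (V, insert (i, j) (T - {(j, i)}))"
proof -
  have *: "T \<subseteq> V \<times> V" "\<And>x y. (x, y) \<in> T \<Longrightarrow> (y, x) \<notin> T"
      "\<And>u v. u \<in> V \<Longrightarrow> v \<in> V \<Longrightarrow> u \<noteq> v \<Longrightarrow> (u, v) \<in> T \<or> (v, u) \<in> T"
    using T unfolding tournament_iff asym_iff_all by blast+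
  then have "i \<noteq> j" "i \<in> V" "j \<in> V" using ji by blast+
  then show ?thesis unfolding tournament_iff asym_iff_all
    using * ji by (intro conjI) (blast+)
qed

text \<open>The transposition of two vertices only flips the edge between them and edges meeting
  them, so a class of tournaments closed under isomorphism and intervals is trivial.\<close>

lemma interval_with_forbidden:
  assumes "finite V" "tournament (V, T0)" "free_of F (V, T0)" "tournament (V, Z)" "\<not> free_of F (V, Z)"
  shows "\<exists>x y w. tournament (V, x) \<and> free_of F (V, x) \<and> tournament (V, y) \<and> free_of F (V, y) \<and>
    tournament (V, w) \<and> w \<subseteq> x \<union> y \<and> \<not> free_of F (V, w)"
proof (rule ccontr)
  assume none: "\<not> ?thesis"
  have fin: "finite (Z - T)" for T
    using assms(1,4) unfolding tournament_iff by (meson finite_Diff finite_SigmaI finite_subset)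
  have "tournament (V, T) \<Longrightarrow> free_of F (V, T) \<Longrightarrow> False" for T
  proof (induction "card (Z - T)" arbitrary: T rule: less_induct)
    case less
    have "\<not> Z \<subseteq> T" using tournament_subset_eq[OF less.prems(1) assms(4)] less.prems(2) assms(5) by blast
    then obtain i j where ij: "(i, j) \<in> Z" "(i, j) \<notin> T" by auto
    have V: "i \<in> V" "j \<in> V" "i \<noteq> j" using ij(1) assms(4) unfolding tournament_iff asym_iff_all by blast+
    have ji: "(j, i) \<in> T" using less.prems(1) V ij(2) unfolding tournament_iff by blast
    have jiZ: "(j, i) \<notin> Z" using ij(1) assms(4) unfolding tournament_iff asym_iff_all by blast
    define \<pi> where "\<pi> x = (if x = i then j else if x = j then i else x)" for x
    have \<pi>: "inj_on \<pi> V" "\<pi> ` V \<subseteq> V" using V by (auto simp: \<pi>_def inj_on_def)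
    define T' where "T' = insert (i, j) (T - {(j, i)})"
    have T': "tournament (V, T')" unfolding T'_def using tournament_flip[OF less.prems(1) ji] .
    have 1: "tournament (V, pull \<pi> V T)"
    proof -
      have "(u, v) \<in> pull \<pi> V T \<or> (v, u) \<in> pull \<pi> V T" if "u \<in> V" "v \<in> V" "u \<noteq> v" for u v
      proof -
        have "\<pi> u \<noteq> \<pi> v" "\<pi> u \<in> V" "\<pi> v \<in> V" using \<pi> that by (auto simp: inj_on_def)
        then show ?thesis using less.prems(1) that unfolding tournament_iff pull_def by blast
      qed
      moreover have "asym (pull \<pi> V T)"
        using less.prems(1) unfolding tournament_iff asym_iff_all pull_def by blast
      moreover have "pull \<pi> V T \<subseteq> V \<times> V" by (auto simp: pull_def)
      ultimately show ?thesis unfolding tournament_iff by blast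
    qed
    have 2: "free_of F (V, pull \<pi> V T)"
      using free_of_embeds[OF embeds_pull[OF \<pi>]] less.prems(2) .
    have "(i, j) \<in> pull \<pi> V T" using V ji by (simp add: pull_def \<pi>_def)
    then have "T' \<subseteq> T \<union> pull \<pi> V T" by (auto simp: T'_def)
    then have free: "free_of F (V, T')" using none less.prems 1 2 T' by blast
    have "Z - T' \<subset> Z - T" using ij jiZ by (auto simp: T'_def)
    then have "card (Z - T') < card (Z - T)" using fin by (intro psubset_card_mono)
    then show False using less.hyps T' free by blast
  qed
  then show False using assms(2,3) by blast
qed

lemma implication_exists:
  assumes "finite (V :: nat set)" "tournament (V, T0)" "free_of F (V, T0)" "tournament (V, Z)" "\<not> free_of F (V, Z)"
  shows "\<exists>E p q r s. implication V E p q r s \<and> {p, q} \<noteq> {r, s}"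
proof -
  define good where "good x y \<longleftrightarrow> tournament (V, x) \<and> free_of F (V, x) \<and> tournament (V, y) \<and> free_of F (V, y) \<and>
    (\<exists>w. tournament (V, w) \<and> w \<subseteq> x \<union> y \<and> \<not> free_of F (V, w))" for x y
  have "\<exists>x y. good x y" using interval_with_forbidden[OF assms] unfolding good_def by blast
  then have "\<exists>z. good (fst z) (snd z)" by auto
  then obtain z where "good (fst z) (snd z)"
      "\<And>z'. good (fst z') (snd z') \<Longrightarrow> card (snd z - fst z) \<le> card (snd z' - fst z')"
    using ex_has_least_nat[of "\<lambda>z. good (fst z) (snd z)" _ "\<lambda>z. card (snd z - fst z)"] by blast
  then obtain x y where xy: "good x y" and min: "\<And>x' y'. good x' y' \<Longrightarrow> card (y - x) \<le> card (y' - x')"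
    by (metis fst_conv snd_conv)
  have x: "tournament (V, x)" "free_of F (V, x)" and y: "tournament (V, y)" "free_of F (V, y)"
    using xy by (simp_all add: good_def)
  obtain w where w: "tournament (V, w)" "w \<subseteq> x \<union> y" "\<not> free_of F (V, w)" using xy unfolding good_def by blast
  have sub: "R \<subseteq> V \<times> V" and as: "(a, b) \<in> R \<Longrightarrow> (b, a) \<notin> R"
    and tot: "a \<in> V \<Longrightarrow> b \<in> V \<Longrightarrow> a \<noteq> b \<Longrightarrow> (a, b) \<in> R \<or> (b, a) \<in> R"
    if "tournament (V, R)" for R a b
    using that unfolding tournament_iff asym_iff_all by blast+
  define D where "D = y - x"
  have finD: "finite D" unfolding D_def using sub[OF y(1)] assms(1) by (meson finite_Diff finite_SigmaI finite_subset)
  define tour where "tour X = (x \<inter> y) \<union> X \<union> (D - X)\<inverse>" for X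
  have xD: "(b, a) \<in> x" if "(a, b) \<in> D" for a b
  proof -
    have "(a, b) \<in> y" "(a, b) \<notin> x" using that by (auto simp: D_def)
    moreover from this have "a \<in> V" "b \<in> V" "a \<noteq> b" using sub[OF y(1)] as[OF y(1)] by blast+
    ultimately show ?thesis using tot[OF x(1)] by blast
  qed
  have x_not_y: "(b, a) \<in> D" if "(a, b) \<in> x" "(a, b) \<notin> y" for a b
  proof -
    have "a \<in> V" "b \<in> V" "a \<noteq> b" using that sub[OF x(1)] as[OF x(1)] by blast+
    then have "(b, a) \<in> y" using tot[OF y(1)] that by blast
    moreover have "(b, a) \<notin> x" using as[OF x(1)] that by blast
    ultimately show ?thesis by (simp add: D_def)
  qed
  have eq_tour: "R = tour (R \<inter> D)" if R: "tournament (V, R)" "R \<subseteq> x \<union> y" for R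
  proof
    show "R \<subseteq> tour (R \<inter> D)"
    proof
      fix e assume e: "e \<in> R"
      obtain a b where ab: "e = (a, b)" by (cases e)
      have "(b, a) \<in> D - (R \<inter> D)" if "(a, b) \<in> x" "(a, b) \<notin> y"
        using x_not_y[OF that] as[OF R(1)] e ab by blast
      then show "e \<in> tour (R \<inter> D)" using e ab R(2) unfolding tour_def D_def by blast
    qed
    show "tour (R \<inter> D) \<subseteq> R"
    proof
      fix e assume e: "e \<in> tour (R \<inter> D)"
      obtain a b where ab: "e = (a, b)" by (cases e)
      consider "(a, b) \<in> x" "(a, b) \<in> y" | "(a, b) \<in> R" | "(b, a) \<in> D" "(b, a) \<notin> R"
        using e ab unfolding tour_def by blast
      then show "e \<in> R"
      proof cases
        case 1
        then have "(b, a) \<notin> R" using as[OF x(1)] as[OF y(1)] R(2) by blast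
        moreover have "a \<in> V" "b \<in> V" "a \<noteq> b" using 1 sub[OF x(1)] as[OF x(1)] by blast+
        ultimately show ?thesis using tot[OF R(1)] ab by blast
      next
        case 3
        then have "a \<in> V" "b \<in> V" "a \<noteq> b" using sub[OF y(1)] as[OF y(1)] unfolding D_def by blast+
        then show ?thesis using tot[OF R(1)] 3 ab by blast
      qed (use ab in simp)
    qed
  qed
  have tour_sub: "tour X \<subseteq> x \<union> y" if "X \<subseteq> D" for X
    using that xD unfolding tour_def D_def by blast
  have tour_tournament: "tournament (V, tour X)" if X: "X \<subseteq> D" for X
  proof -
    have "tour X \<subseteq> V \<times> V" using tour_sub[OF X] sub[OF x(1)] sub[OF y(1)] by blast
    moreover have "(b, a) \<notin> tour X" if "(a, b) \<in> tour X" for a b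
    proof -
      have Dy: "(c, d) \<in> y \<and> (c, d) \<notin> x \<and> (d, c) \<in> x \<and> (d, c) \<notin> y" if "(c, d) \<in> D" for c d
        using that xD[OF that] as[OF y(1)] unfolding D_def by blast
      have xyn: "(d, c) \<notin> x \<and> (d, c) \<notin> y" if "(c, d) \<in> x" "(c, d) \<in> y" for c d
        using that as[OF x(1)] as[OF y(1)] by blast
      show ?thesis
        using that X Dy[of a b] Dy[of b a] xyn[of a b] xyn[of b a] unfolding tour_def by blast
    qed
    moreover have "(a, b) \<in> tour X \<or> (b, a) \<in> tour X" if ab: "a \<in> V" "b \<in> V" "a \<noteq> b" for a b
    proof -
      have "(a, b) \<in> x \<inter> y \<or> (b, a) \<in> x \<inter> y \<or> (a, b) \<in> D \<or> (b, a) \<in> D"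
        using tot[OF x(1) ab] tot[OF y(1) ab] as[OF x(1)] unfolding D_def by blast
      then show ?thesis unfolding tour_def by blast
    qed
    ultimately show ?thesis unfolding tournament_iff asym_iff_all by blast
  qed
  define S where "S = {X. X \<subseteq> D \<and> free_of F (V, tour X)}"
  have tour_empty: "tour {} = x"
  proof -
    have "x \<inter> D = {}" by (auto simp: D_def)
    then show ?thesis using eq_tour[OF x(1)] by simp
  qed
  have tour_D: "tour D = y"
  proof -
    have "y \<inter> D = D" by (auto simp: D_def)
    then show ?thesis using eq_tour[OF y(1)] by simp
  qed
  have "\<exists>e\<in>D. \<exists>f\<in>D. e \<noteq> f \<and> (\<forall>X\<in>S. e \<in> X \<longrightarrow> f \<in> X)"
  proof (rule not_interval_closed)
    show "S \<subseteq> Pow D" by (auto simp: S_def)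
    show "{} \<in> S" "D \<in> S" using tour_empty tour_D x(2) y(2) by (simp_all add: S_def)
    show "w \<inter> D \<subseteq> D" by simp
    show "w \<inter> D \<notin> S" using eq_tour[OF w(1,2)] w(3) by (simp add: S_def)
    fix X Y Z assume XY: "X \<in> S" "Y \<in> S" "X \<subseteq> Z" "Z \<subseteq> Y" "Z \<notin> S"
    then have D: "X \<subseteq> D" "Y \<subseteq> D" "Z \<subseteq> D" by (auto simp: S_def)
    have "tour Z \<subseteq> tour X \<union> tour Y" using XY(3,4) unfolding tour_def by blast
    then have "\<exists>w. tournament (V, w) \<and> w \<subseteq> tour X \<union> tour Y \<and> \<not> free_of F (V, w)"
      using tour_tournament[OF D(3)] XY(5) D(3) by (intro exI[of _ "tour Z"]) (simp add: S_def)
    then have "good (tour X) (tour Y)" unfolding good_def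
      using tour_tournament[OF D(1)] tour_tournament[OF D(2)] XY(1,2) by (simp add: S_def)
    then have "card D \<le> card (tour Y - tour X)" using min by (simp add: D_def)
    moreover have sub': "tour Y - tour X \<subseteq> Y - X"
      using XY(3,4) unfolding tour_def by blast
    then have "card (tour Y - tour X) \<le> card (Y - X)"
      using D finD by (intro card_mono) (auto intro: finite_subset)
    ultimately have "card D \<le> card (Y - X)" by simp
    then have "Y - X = D" using D finD by (intro card_seteq) auto
    then show "X = {} \<and> Y = D" using D XY(3,4) by blast
  qed
  then obtain e f where ef: "e \<in> D" "f \<in> D" "e \<noteq> f" "\<And>X. X \<in> S \<Longrightarrow> e \<in> X \<Longrightarrow> f \<in> X" by blast
  obtain p q r s where pq: "e = (p, q)" and rs: "f = (r, s)" by (cases e, cases f)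
  have E: "{(p, q), (q, p), (r, s), (s, r)} \<subseteq> x \<union> y"
    using ef xD pq rs unfolding D_def by blast
  have "(b, a) \<in> x" if "(a, b) \<in> y" "(a, b) \<notin> x" for a b using xD[of a b] that by (simp add: D_def)
  then have covx: "x \<union> y \<subseteq> x \<union> x\<inverse>" by auto
  have "(b, a) \<in> y" if "(a, b) \<in> x" "(a, b) \<notin> y" for a b using x_not_y[OF that] by (simp add: D_def)
  then have covy: "x \<union> y \<subseteq> y \<union> y\<inverse>" by auto
  have asx: "asym x" and asy: "asym y" using x(1) y(1) by (simp_all add: tournament_iff)
  have sx: "solves F V (x \<union> y) x" and sy: "solves F V (x \<union> y) y"
    using covx covy asx asy x(2) y(2) by (simp_all add: solves_def)
  have "implication V (x \<union> y) p q r s"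
  proof (rule implicationI)
    show "x \<union> y \<subseteq> V \<times> V" using sub x(1) y(1) by simp
    show "\<exists>R. solves F V (x \<union> y) R \<and> (p, q) \<in> R \<and> (r, s) \<in> R"
      using sy ef pq rs unfolding D_def by blast
    show "\<exists>R. solves F V (x \<union> y) R \<and> (q, p) \<in> R \<and> (s, r) \<in> R"
      using sx xD ef pq rs by blast
    fix R assume R: "solves F V (x \<union> y) R" "(p, q) \<in> R"
    have RT: "tournament (V, R)" "R \<subseteq> x \<union> y"
    proof -
      have "(a, b) \<in> R \<or> (b, a) \<in> R" if "a \<in> V" "b \<in> V" "a \<noteq> b" for a b
        using R(1) tot[OF x(1) that] unfolding solves_def by blast
      moreover show "R \<subseteq> x \<union> y" using R(1) by (simp add: solves_def)
      moreover have "asym R" using R(1) by (simp add: solves_def)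
      ultimately show "tournament (V, R)" unfolding tournament_iff using sub[OF x(1)] sub[OF y(1)] by blast
    qed
    have "R \<inter> D \<in> S" using eq_tour[OF RT] R(1) by (simp add: S_def solves_def)
    then show "(r, s) \<in> R" using ef(1) ef(4)[of "R \<inter> D"] R(2) pq rs by blast
  qed (use E assms(1) in auto)
  moreover have "{p, q} \<noteq> {r, s}"
    using ef as[OF y(1), of p q] unfolding D_def pq rs by (auto simp: doubleton_eq_iff)
  ultimately show ?thesis by blast
qed

lemma equality_exists:
  assumes "finite (V :: nat set)" "tournament (V, T0)" "free_of F (V, T0)" "tournament (V, Z)" "\<not> free_of F (V, Z)"
  shows "\<exists>W E p q r s. equality W E p q r s"
proof -
  obtain E p q r s where "implication V E p q r s" "{p, q} \<noteq> {r, s}"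
    using implication_exists[OF assms] by blast
  from implication_disjoint_ports[OF this] obtain V' E' r' s' where
    "implication V' E' p q r' s'" "{p, q} \<inter> {r', s'} = {}" by blast
  from implication_separated_ports[OF this] obtain V2 E2 r2 s2 where
    "implication V2 E2 p q r2 s2" "{p, q} \<inter> {r2, s2} = {}"
    "E2 \<inter> ({p, q} \<times> {r2, s2} \<union> {r2, s2} \<times> {p, q}) = {}" by blast
  from equality_of_implication[OF this] show ?thesis by blast
qed

subsection \<open>The Fraisse limit\<close>

lemma oriented_graph_embeds:
  assumes "embeds G H" "digraph G" "oriented_graph H"
  shows "oriented_graph G"
proof (rule embedsE[OF assms(1)])
  fix f assume f: "\<And>x y. x \<in> verts G \<Longrightarrow> y \<in> verts G \<Longrightarrow> (x, y) \<in> edges G \<longleftrightarrow> (f x, f y) \<in> edges H"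
  have "(y, x) \<notin> edges G" if "(x, y) \<in> edges G" for x y
  proof -
    have "x \<in> verts G" "y \<in> verts G" using that assms(2) unfolding digraph_def by blast+
    then show ?thesis using that f[of x y] f[of y x] assms(3) unfolding oriented_graph_def asym_iff_all by blast
  qed
  then show ?thesis using assms(2) by (simp add: oriented_graph_def asym_iff_all)
qed

lemma nat_copy:
  assumes "finite (verts G)" "digraph G"
  obtains H :: "nat digraph" where "digraph H" "verts H = {..<card (verts G)}" "embeds G H" "embeds H G"
proof -
  obtain g where g: "bij_betw g {..<card (verts G)} (verts G)"
    using ex_bij_betw_nat_finite[OF assms(1)] by (auto simp: atLeast0LessThan)
  define n where "n = card (verts G)"
  define h where "h = the_inv_into {..<n} g"
  define H where "H = ({..<n}, pull g {..<n} (edges G))"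
  have gn: "inj_on g {..<n}" "g ` {..<n} = verts G" using g by (auto simp: n_def bij_betw_def)
  have "embeds ({..<n}, pull g {..<n} (edges G)) (verts G, edges G)"
    using gn by (intro embeds_pull) auto
  then have "embeds H G" by (simp add: H_def)
  moreover have "embeds G H"
  proof (rule embedsI[of h])
    have hb: "bij_betw h (verts G) {..<n}" using g unfolding h_def n_def by (rule bij_betw_the_inv_into)
    then show "inj_on h (verts G)" by (simp add: bij_betw_def)
    have h: "h x < n" "g (h x) = x" if "x \<in> verts G" for x
      using that hb gn f_the_inv_into_f[OF gn(1), of x] by (auto simp: h_def bij_betw_def)
    show "h x \<in> verts H" if "x \<in> verts G" for x using h[OF that] by (simp add: H_def)
    show "(x, y) \<in> edges G \<longleftrightarrow> (h x, h y) \<in> edges H" if "x \<in> verts G" "y \<in> verts G" for x y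
      using h that by (simp add: H_def pull_def)
  qed
  moreover have "digraph H" by (auto simp: H_def digraph_def pull_def)
  moreover have "verts H = {..<card (verts G)}" by (simp add: H_def n_def)
  ultimately show ?thesis using that by blast
qed

lemma embeds_limit:
  fixes H :: "'v digraph" and D :: "'a digraph"
  assumes lim: "fraisse_limit F D" and H: "digraph H" "finite (verts H)"
  shows "embeds H D \<longleftrightarrow> oriented_graph H \<and> free_of F H"
proof -
  obtain K :: "nat digraph" where K: "digraph K" "verts K = {..<card (verts H)}" "embeds H K" "embeds K H"
    using nat_copy[OF H(2,1)] .
  have "embeds H D \<longleftrightarrow> embeds K D"
    by (intro iffI) (erule embeds_trans[OF K(4)], erule embeds_trans[OF K(3)])
  also have "\<dots> \<longleftrightarrow> oriented_graph K \<and> free_of F K"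
  proof -
    have "\<forall>H :: nat digraph. digraph H \<and> finite (verts H) \<longrightarrow>
        (embeds H D \<longleftrightarrow> oriented_graph H \<and> free_of F H)"
      using lim unfolding fraisse_limit_def by (elim conjE)
    moreover have "finite (verts K)" by (simp add: K(2))
    ultimately show ?thesis using K(1) by blast
  qed
  also have "\<dots> \<longleftrightarrow> oriented_graph H \<and> free_of F H"
    using oriented_graph_embeds[OF K(3) H(1)] oriented_graph_embeds[OF K(4) K(1)]
      free_of_embeds[OF K(3), of F] free_of_embeds[OF K(4), of F] by blast
  finally show ?thesis .
qed

lemma limit_oriented:
  fixes D :: "'a digraph"
  assumes lim: "fraisse_limit F D" and xy: "(x, y) \<in> edges D"
  shows "(y, x) \<notin> edges D"
proof -
  let ?H = "induced D {x, y}"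
  have "edges D \<subseteq> verts D \<times> verts D" using lim by (simp add: fraisse_limit_def digraph_def)
  then have V: "x \<in> verts D" "y \<in> verts D" using xy by auto
  have "embeds ?H D" by (rule embedsI[of id]) (use V in \<open>auto simp: induced_def\<close>)
  moreover have "digraph ?H" "finite (verts ?H)" by (auto simp: induced_def digraph_def)
  ultimately have "oriented_graph ?H" using embeds_limit[OF lim] by blast
  then show ?thesis using xy unfolding oriented_graph_def asym_iff_all induced_def by auto
qed

lemma limit_free:
  fixes D :: "'a digraph"
  assumes lim: "fraisse_limit F D" and T: "T \<in> F"
  shows "\<not> embeds T D"
proof
  assume "embeds T D"
  moreover have "digraph T" using tournament_F[OF T] by (simp add: tournament_def oriented_graph_def)
  ultimately have "free_of F T" using embeds_limit[OF lim] finite_verts_F[OF T] by blast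
  moreover have "embeds T T" by (rule embedsI[of id]) auto
  ultimately show False using T by (auto simp: free_of_def)
qed

lemma hom_with_U:
  "homomorphism h (V, [edge_tuples E, edge_tuples U]) (with_U D) \<longleftrightarrow> h ` V \<subseteq> verts D \<and>
     (\<forall>x y. (x, y) \<in> E \<longrightarrow> (h x, h y) \<in> edges D) \<and>
     (\<forall>x y. (x, y) \<in> U \<longrightarrow> (h x, h y) \<in> edges D \<or> (h y, h x) \<in> edges D)"
  unfolding homomorphism_def with_U_def
  by (simp add: All_less_Suc ball_edge_tuples edge_tuples_iff) (rule conj_cong[OF refl conj_commute])

lemma hom_limit:
  fixes D :: "'a digraph" and V :: "'v set"
  assumes lim: "fraisse_limit F D" and V: "finite V" "E \<subseteq> V \<times> V" "U \<subseteq> V \<times> V"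
  shows "(\<exists>h. homomorphism h (V, [edge_tuples E, edge_tuples U]) (with_U D)) \<longleftrightarrow>
    (\<exists>R. solution F V E (E \<union> U) R)"
proof
  assume "\<exists>h. homomorphism h (V, [edge_tuples E, edge_tuples U]) (with_U D)"
  then obtain h where h: "h ` V \<subseteq> verts D" "\<And>x y. (x, y) \<in> E \<Longrightarrow> (h x, h y) \<in> edges D"
      "\<And>x y. (x, y) \<in> U \<Longrightarrow> (h x, h y) \<in> edges D \<or> (h y, h x) \<in> edges D"
    unfolding hom_with_U by blast
  define R where "R = {(x, y). ((x, y) \<in> E \<union> U \<or> (y, x) \<in> E \<union> U) \<and> (h x, h y) \<in> edges D}"
  have "R \<subseteq> (E \<union> U) \<union> (E \<union> U)\<inverse>" unfolding R_def by blast
  moreover have "E \<union> U \<subseteq> R \<union> R\<inverse>" "E \<subseteq> R" using h(2,3) unfolding R_def by blast+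
  moreover have "asym R" unfolding asym_iff_all R_def using limit_oriented[OF lim] by blast
  moreover have "free_of F (V, R)"
    unfolding free_of_def
  proof (intro ballI notI)
    fix T assume T: "T \<in> F" and emb: "embeds T (V, R)"
    show False
    proof (rule embedsE[OF emb])
      fix f assume f: "inj_on f (verts T)" "\<And>x. x \<in> verts T \<Longrightarrow> f x \<in> verts (V, R)"
        "\<And>x y. x \<in> verts T \<Longrightarrow> y \<in> verts T \<Longrightarrow> (x, y) \<in> edges T \<longleftrightarrow> (f x, f y) \<in> edges (V, R)"
      have tot: "(x, y) \<in> edges T \<or> (y, x) \<in> edges T" if "x \<in> verts T" "y \<in> verts T" "x \<noteq> y" for x y
        using tournament_F[OF T] that unfolding tournament_def total_on_def by blast
      have R: "(h (f x), h (f y)) \<in> edges D" if "x \<in> verts T" "y \<in> verts T" "(x, y) \<in> edges T" for x y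
        using f(3)[OF that(1,2)] that(3) by (simp add: R_def)
      have noloop: "(a, a) \<notin> edges D" for a using limit_oriented[OF lim, of a a] by blast
      have loopT: "(x, x) \<notin> edges T" for x
        using tournament_F[OF T] unfolding tournament_def oriented_graph_def asym_iff_all by blast
      have "embeds T D"
      proof (rule embedsI[of "h \<circ> f"])
        show "inj_on (h \<circ> f) (verts T)"
        proof (rule inj_onI, rule ccontr)
          fix x y assume xy: "x \<in> verts T" "y \<in> verts T" "(h \<circ> f) x = (h \<circ> f) y" "x \<noteq> y"
          then show False using tot[OF xy(1,2,4)] R[OF xy(1,2)] R[OF xy(2,1)] noloop by auto
        qed
        show "(h \<circ> f) x \<in> verts D" if "x \<in> verts T" for x using f(2)[OF that] h(1) by auto
        show "(x, y) \<in> edges T \<longleftrightarrow> ((h \<circ> f) x, (h \<circ> f) y) \<in> edges D" if xy: "x \<in> verts T" "y \<in> verts T" for x y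
        proof (cases "x = y")
          case True then show ?thesis using loopT noloop by simp
        next
          case False
          then show ?thesis using tot[OF xy False] R[OF xy] R[OF xy(2,1)] limit_oriented[OF lim] by auto
        qed
      qed
      then show False using limit_free[OF lim T] by blast
    qed
  qed
  ultimately show "\<exists>R. solution F V E (E \<union> U) R" unfolding solution_def by blast
next
  assume "\<exists>R. solution F V E (E \<union> U) R"
  then obtain R where R: "R \<subseteq> (E \<union> U) \<union> (E \<union> U)\<inverse>" "E \<union> U \<subseteq> R \<union> R\<inverse>" "asym R" "E \<subseteq> R" "free_of F (V, R)"
    unfolding solution_def by blast
  have "oriented_graph (V, R)" using R(1,3) V(2,3) by (auto simp: oriented_graph_def digraph_def)
  then have "embeds (V, R) D" using embeds_limit[OF lim, of "(V, R)"] R(5) V(1)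
    by (simp add: oriented_graph_def)
  then show "\<exists>h. homomorphism h (V, [edge_tuples E, edge_tuples U]) (with_U D)"
  proof (rule embedsE)
    fix f assume f: "\<And>x. x \<in> verts (V, R) \<Longrightarrow> f x \<in> verts D"
      "\<And>x y. x \<in> verts (V, R) \<Longrightarrow> y \<in> verts (V, R) \<Longrightarrow> (x, y) \<in> edges (V, R) \<longleftrightarrow> (f x, f y) \<in> edges D"
    have fR: "(f x, f y) \<in> edges D" if "(x, y) \<in> R" for x y
    proof -
      have "x \<in> V" "y \<in> V" using that R(1) V(2,3) by blast+
      then show ?thesis using f(2)[of x y] that by simp
    qed
    have "homomorphism f (V, [edge_tuples E, edge_tuples U]) (with_U D)"
      unfolding hom_with_U using f(1) fR R(2,4) by auto
    then show ?thesis by blast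
  qed
qed

end

section \<open>Instances over arbitrary finite domains\<close>

definition enc_list :: "'v list \<Rightarrow> nat list \<Rightarrow> 'v list set list \<Rightarrow> bool list" where
  "enc_list vs ar Rs = replicate (length vs) True @ [False] @
     concat (map2 (\<lambda>k R. map (\<lambda>t. t \<in> R) (product_lists (replicate k vs))) ar Rs)"

definition index_rel :: "'v list \<Rightarrow> 'v list set \<Rightarrow> nat list set" where
  "index_rel vs R = {t. set t \<subseteq> {..<length vs} \<and> map ((!) vs) t \<in> R}"

lemma product_lists_map: "product_lists (map (map f) xss) = map (map f) (product_lists xss)"
  by (induction xss) (simp_all add: map_concat comp_def)

lemma product_lists_index:
  "product_lists (replicate k vs) = map (map ((!) vs)) (product_lists (replicate k [0..<length vs]))"
proof -
  have "replicate k vs = map (map ((!) vs)) (replicate k [0..<length vs])"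
    by (simp only: map_replicate map_nth)
  then show ?thesis by (simp only: product_lists_map)
qed

lemma enc_list_encode: "enc_list vs ar Rs = encode (length vs) ar (map (index_rel vs) Rs)"
proof -
  have "map (\<lambda>t. t \<in> R) (product_lists (replicate k vs)) =
      map (\<lambda>t. t \<in> index_rel vs R) (product_lists (replicate k [0..<length vs]))" for k and R :: "'a list set"
    unfolding product_lists_index[of k vs] map_map
    by (rule map_cong[OF refl]) (simp add: index_rel_def set_product_lists_replicate atLeast0LessThan)
  then have "map2 (\<lambda>k R. map (\<lambda>t. t \<in> R) (product_lists (replicate k vs))) ar Rs =
      map2 (\<lambda>k R. map (\<lambda>t. t \<in> R) (product_lists (replicate k [0..<length vs]))) ar (map (index_rel vs) Rs)"
    by (induction ar Rs rule: list_induct2') simp_all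
  then show ?thesis by (simp only: enc_list_def encode_def)
qed

lemma structure_of_index:
  assumes "structure_of ar (set vs, Rs)"
  shows "structure_of ar ({..<length vs}, map (index_rel vs) Rs)"
  unfolding structure_of_def fst_conv snd_conv
proof (intro conjI allI impI ballI)
  show "length (map (index_rel vs) Rs) = length ar" using structure_of_length[OF assms] by simp
  fix i t assume i: "i < length ar" and "t \<in> map (index_rel vs) Rs ! i"
  then have t: "t \<in> index_rel vs (Rs ! i)" using structure_of_length[OF assms] by simp
  then show "set t \<subseteq> {..<length vs}" by (simp add: index_rel_def)
  have "map ((!) vs) t \<in> Rs ! i" using t by (simp add: index_rel_def)
  then show "length t = ar ! i" using structure_of_mem[OF assms i] by fastforce
qed

lemma CSP_encode:
  assumes "structure_of ar ({..<n}, Rs)"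
  shows "encode n ar Rs \<in> CSP ar B \<longleftrightarrow> (\<exists>h. homomorphism h ({..<n}, Rs) B)"
proof
  assume "encode n ar Rs \<in> CSP ar B"
  then obtain n' Rs' h where "encode n ar Rs = encode n' ar Rs'" "structure_of ar ({..<n'}, Rs')"
      "homomorphism h ({..<n'}, Rs') B"
    unfolding CSP_def by blast
  moreover from this have "n = n'" "Rs = Rs'" using encode_inj assms by blast+
  ultimately show "\<exists>h. homomorphism h ({..<n}, Rs) B" by blast
next
  assume "\<exists>h. homomorphism h ({..<n}, Rs) B"
  then show "encode n ar Rs \<in> CSP ar B" unfolding CSP_def using assms by blast
qed

lemma CSP_enc_list:
  assumes "distinct vs" "structure_of ar (set vs, Rs)"
  shows "enc_list vs ar Rs \<in> CSP ar B \<longleftrightarrow> (\<exists>h. homomorphism h (set vs, Rs) B)"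
  unfolding enc_list_encode CSP_encode[OF structure_of_index[OF assms(2)]]
proof
  assume "\<exists>h. homomorphism h ({..<length vs}, map (index_rel vs) Rs) B"
  then obtain h where h: "h ` {..<length vs} \<subseteq> fst B"
      "\<And>i t. i < length Rs \<Longrightarrow> t \<in> index_rel vs (Rs ! i) \<Longrightarrow> map h t \<in> snd B ! i"
    by (auto simp: homomorphism_def)
  define ix where "ix = the_inv_into {..<length vs} ((!) vs)"
  have bij: "bij_betw ((!) vs) {..<length vs} (set vs)"
    using assms(1) by (intro bij_betw_nth) auto
  have ix: "ix v < length vs" "vs ! ix v = v" if "v \<in> set vs" for v
  proof -
    show "vs ! ix v = v" unfolding ix_def using f_the_inv_into_f_bij_betw[OF bij] that by blast
    show "ix v < length vs" unfolding ix_def using bij_betwE[OF bij_betw_the_inv_into[OF bij]] that by simp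
  qed
  have "homomorphism (h \<circ> ix) (set vs, Rs) B"
    unfolding homomorphism_def fst_conv snd_conv
  proof (intro conjI allI impI ballI)
    show "(h \<circ> ix) ` set vs \<subseteq> fst B" using h(1) ix(1) by auto
    fix i t assume i: "i < length Rs" and t: "t \<in> Rs ! i"
    have "set t \<subseteq> set vs" using structure_of_mem[OF assms(2) _ t] i structure_of_length[OF assms(2)] by simp
    then have "map ((!) vs) (map ix t) = t" "set (map ix t) \<subseteq> {..<length vs}"
      using ix by (auto simp: map_idI subset_iff)
    then have "map ix t \<in> index_rel vs (Rs ! i)" using t by (simp only: index_rel_def mem_Collect_eq)
    from h(2)[OF i this] show "map (h \<circ> ix) t \<in> snd B ! i" by simp
  qed
  then show "\<exists>h. homomorphism h (set vs, Rs) B" by blast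
next
  assume "\<exists>h. homomorphism h (set vs, Rs) B"
  then obtain h where h: "h ` set vs \<subseteq> fst B" "\<And>i t. i < length Rs \<Longrightarrow> t \<in> Rs ! i \<Longrightarrow> map h t \<in> snd B ! i"
    by (auto simp: homomorphism_def)
  have "homomorphism (h \<circ> (!) vs) ({..<length vs}, map (index_rel vs) Rs) B"
    unfolding homomorphism_def fst_conv snd_conv
  proof (intro conjI allI impI ballI)
    show "(h \<circ> (!) vs) ` {..<length vs} \<subseteq> fst B" using h(1) by auto
    fix i t assume i: "i < length (map (index_rel vs) Rs)" and "t \<in> map (index_rel vs) Rs ! i"
    then have "map ((!) vs) t \<in> Rs ! i" by (simp add: index_rel_def)
    from h(2)[OF _ this] i show "map (h \<circ> (!) vs) t \<in> snd B ! i" by simp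
  qed
  then show "\<exists>h. homomorphism h ({..<length vs}, map (index_rel vs) Rs) B" by blast
qed

lemma structure_of_edge_tuples: "structure_of [2] (V, [edge_tuples E]) \<longleftrightarrow> E \<subseteq> V \<times> V"
  by (auto simp: structure_of_def ball_edge_tuples)

lemma structure_of_edge_tuples2:
  "structure_of [2, 2] (V, [edge_tuples E, edge_tuples U]) \<longleftrightarrow> E \<subseteq> V \<times> V \<and> U \<subseteq> V \<times> V"
  by (auto simp: structure_of_def ball_edge_tuples All_less_Suc)

lemma edge_tuples_inj: "edge_tuples E = edge_tuples E' \<longleftrightarrow> E = E'"
proof
  assume "edge_tuples E = edge_tuples E'"
  then have "(x, y) \<in> E \<longleftrightarrow> (x, y) \<in> E'" for x y using edge_tuples_iff by metis
  then show "E = E'" by auto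
qed simp

lemma ex_edge_tuples:
  assumes "\<And>t. t \<in> R \<Longrightarrow> length t = 2"
  shows "R = edge_tuples {(x, y). [x, y] \<in> R}"
  unfolding edge_tuples_def using assms by (fastforce simp: length_Suc_conv numeral_2_eq_2)

lemma OC_encode:
  assumes "E \<subseteq> {..<n} \<times> {..<n}"
  shows "encode n [2] [edge_tuples E] \<in> orientation_completion F \<longleftrightarrow> (\<exists>R. solves F {..<n} E R)"
proof
  assume "encode n [2] [edge_tuples E] \<in> orientation_completion F"
  then obtain n' E' R where *: "encode n [2] [edge_tuples E] = encode n' [2] [edge_tuples E']"
      "digraph ({..<n'}, E')" "irrefl E'" "completion E' R" "free_of F ({..<n'}, R)"
    unfolding orientation_completion_def by blast
  have "n = n'" "[edge_tuples E] = [edge_tuples E']"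
    using encode_inj[OF *(1)] assms *(2) by (simp_all only: structure_of_edge_tuples digraph_def fst_conv snd_conv)
  then have "n = n'" "E = E'" by (simp_all add: edge_tuples_inj)
  then show "\<exists>R. solves F {..<n} E R" using *(3-5) solves_completion by blast
next
  assume "\<exists>R. solves F {..<n} E R"
  then obtain R where "irrefl E" "completion E R" "free_of F ({..<n}, R)" using solves_completion by blast
  moreover have "digraph ({..<n}, E)" using assms by (simp add: digraph_def)
  ultimately show "encode n [2] [edge_tuples E] \<in> orientation_completion F"
    unfolding orientation_completion_def by blast
qed

lemma solves_pull_bij:
  assumes "bij_betw g V W" "E \<subseteq> W \<times> W"
  shows "(\<exists>R. solves F V (pull g V E) R) \<longleftrightarrow> (\<exists>R. solves F W E R)"
proof -
  have "pull g V E - (pull g V E)\<inverse> = pull g V (E - E\<inverse>)" by (auto simp: pull_def)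
  then show ?thesis
    using solvable_pull[OF assms(1) _ assms(2), of "E - E\<inverse>"] assms(2) unfolding solves_solution by fastforce
qed

lemma OC_enc_list:
  assumes "distinct vs" "E \<subseteq> set vs \<times> set vs"
  shows "enc_list vs [2] [edge_tuples E] \<in> orientation_completion F \<longleftrightarrow> (\<exists>R. solves F (set vs) E R)"
proof -
  let ?V = "{..<length vs}"
  have bij: "bij_betw ((!) vs) ?V (set vs)" using assms(1) by (intro bij_betw_nth) auto
  have "index_rel vs (edge_tuples E) = edge_tuples (pull ((!) vs) ?V E)"
    unfolding index_rel_def edge_tuples_def pull_def by (fastforce simp: Cons_eq_map_conv map_eq_Cons_conv)
  moreover have "pull ((!) vs) ?V E \<subseteq> ?V \<times> ?V" by (auto simp: pull_def)
  ultimately show ?thesis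
    using OC_encode[of "pull ((!) vs) ?V E" "length vs" F] solves_pull_bij[OF bij assms(2), of F]
    by (simp only: enc_list_encode list.map)
qed

lemma CSP_decode: "x \<in> CSP ar B \<Longrightarrow> \<exists>n Rs. structure_of ar ({..<n}, Rs) \<and> x = encode n ar Rs"
  unfolding CSP_def by blast

lemma OC_decode: "x \<in> orientation_completion F \<Longrightarrow> \<exists>n Rs. structure_of [2] ({..<n}, Rs) \<and> x = encode n [2] Rs"
proof -
  assume "x \<in> orientation_completion F"
  then obtain n E where x: "x = encode n [2] [edge_tuples E]" "digraph ({..<n}, E)"
    unfolding orientation_completion_def by blast
  then have "structure_of [2] ({..<n}, [edge_tuples E])"
    by (simp only: structure_of_edge_tuples digraph_def fst_conv snd_conv)
  then show ?thesis using x(1) by blast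
qed

lemma Nil_not_CSP: "[] \<notin> CSP ar B"
  by (auto simp: CSP_def encode_bits)

lemma Nil_not_OC: "[] \<notin> orientation_completion F"
  by (auto simp: orientation_completion_def encode_bits)

section \<open>Reductions to graph problems\<close>

definition slot :: "nat \<Rightarrow> nat \<Rightarrow> nat list \<Rightarrow> nat list" where
  "slot d i \<sigma> = take d (drop i \<sigma>)"

definition tagged :: "'c list \<Rightarrow> nat \<Rightarrow> nat \<Rightarrow> ('c \<times> nat list) list" where
  "tagged tags d n = concat (map (\<lambda>a. map (Pair a) (tuples n d)) tags)"

lemma set_tagged: "set (tagged tags d n) = set tags \<times> set (tuples n d)"
  by (auto simp: tagged_def)

lemma distinct_tagged: "distinct tags \<Longrightarrow> distinct (tagged tags d n)"
proof (induction tags)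
  case (Cons a tags)
  have "distinct (map (Pair a) (tuples n d))" by (simp add: distinct_map distinct_tuples inj_on_def)
  then show ?case using Cons set_tagged[of tags d n] by (auto simp: tagged_def)
qed (simp add: tagged_def)

lemma concat_map_tagged:
  "concat (map P (tagged tags d n)) = concat (map (\<lambda>a. concat (map (\<lambda>t. P (a, t)) (tuples n d))) tags)"
  by (induction tags) (simp_all add: tagged_def comp_def)

lemma generable_tagged:
  assumes "\<And>a. a \<in> set tags \<Longrightarrow> generable ar (k + d) (G a)"
  shows "generable ar k (\<lambda>n Rs \<sigma>. concat (map (\<lambda>(a, t). G a n Rs (\<sigma> @ t)) (tagged tags d n)))"
  unfolding concat_map_tagged prod.case
  by (rule generable_concat) (rule generable_for[OF assms])

lemma generable_edges:
  assumes "\<And>a b. a \<in> set tags \<Longrightarrow> b \<in> set tags \<Longrightarrow>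
      definable ar (0 + d + d) (\<lambda>n Rs \<sigma>. ((a, slot d 0 \<sigma>), (b, slot d d \<sigma>)) \<in> E n Rs)"
  shows "generable ar 0 (\<lambda>n Rs \<sigma>. map (\<lambda>t. t \<in> edge_tuples (E n Rs)) (product_lists (replicate 2 (tagged tags d n))))"
proof -
  define G where "G a b n Rs \<sigma> = [((a, slot d 0 \<sigma>), (b, slot d d \<sigma>)) \<in> E n Rs]" for a b n Rs \<sigma>
  have "generable ar 0 (\<lambda>n Rs \<sigma>. concat (map (\<lambda>(a, t). (\<lambda>n Rs \<sigma>. concat (map (\<lambda>(b, t'). G a b n Rs (\<sigma> @ t'))
      (tagged tags d n))) n Rs (\<sigma> @ t)) (tagged tags d n)))"
    unfolding G_def by (intro generable_tagged generable_bit assms)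
  then show ?thesis
  proof (rule generable_cong)
    fix n Rs \<sigma> assume "valid ar 0 n Rs \<sigma>"
    then have \<sigma>: "\<sigma> = []" by (simp add: valid_def)
    have *: "G a b n Rs (\<sigma> @ t @ t') = [((a, t), (b, t')) \<in> E n Rs]"
      if "(a, t) \<in> set (tagged tags d n)" "(b, t') \<in> set (tagged tags d n)" for a b t t'
      using that \<sigma> by (simp add: G_def slot_def set_tagged set_tuples)
    have inner: "concat (map (\<lambda>(b, t'). G a b n Rs (\<sigma> @ t @ t')) (tagged tags d n)) =
        map (\<lambda>v. ((a, t), v) \<in> E n Rs) (tagged tags d n)" if at: "(a, t) \<in> set (tagged tags d n)" for a t
    proof -
      have m: "map (\<lambda>(b, t'). G a b n Rs (\<sigma> @ t @ t')) (tagged tags d n) =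
          map (\<lambda>v. [((a, t), v) \<in> E n Rs]) (tagged tags d n)"
        by (rule map_cong[OF refl]) (auto simp: *[OF at])
      show ?thesis unfolding m by (simp add: concat_map_singleton)
    qed
    have "concat (map (\<lambda>(a, t). concat (map (\<lambda>(b, t'). G a b n Rs (\<sigma> @ t @ t')) (tagged tags d n))) (tagged tags d n)) =
        concat (map (\<lambda>u. map (\<lambda>v. (u, v) \<in> E n Rs) (tagged tags d n)) (tagged tags d n))"
      by (rule arg_cong[where f = concat], rule map_cong[OF refl]) (auto simp: inner)
    also have "\<dots> = map (\<lambda>t. t \<in> edge_tuples (E n Rs)) (product_lists (replicate 2 (tagged tags d n)))"
      by (simp add: numeral_2_eq_2 map_concat comp_def concat_map_singleton edge_tuples_iff)
    finally show "concat (map (\<lambda>(a, t). (\<lambda>n Rs \<sigma>. concat (map (\<lambda>(b, t'). G a b n Rs (\<sigma> @ t'))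
      (tagged tags d n))) n Rs (\<sigma> @ t)) (tagged tags d n)) =
      map (\<lambda>t. t \<in> edge_tuples (E n Rs)) (product_lists (replicate 2 (tagged tags d n)))"
      by simp
  qed
qed

lemma generable_tagged_size: "generable ar 0 (\<lambda>n Rs \<sigma>. replicate (length (tagged tags d n)) True)"
proof -
  have "generable ar 0 (\<lambda>n Rs \<sigma>. concat (map (\<lambda>(a, t). (\<lambda>n Rs \<sigma>. [True]) n Rs (\<sigma> @ t)) (tagged tags d n)))"
    by (intro generable_tagged generable_bit definable_const)
  then show ?thesis
    by (rule generable_cong) (simp add: case_prod_unfold concat_map_singleton map_replicate_const)
qed

context forbidden
begin

context
  fixes tags :: "'c list" and d :: nat and ar :: "nat list" and L :: "bool list set"
    and E :: "nat \<Rightarrow> rels \<Rightarrow> ('c \<times> nat list) rel"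
  assumes tags: "distinct tags"
    and def: "\<And>k i j a b. a \<in> set tags \<Longrightarrow> b \<in> set tags \<Longrightarrow> i + d \<le> k \<Longrightarrow> j + d \<le> k \<Longrightarrow>
      definable ar k (\<lambda>n Rs \<sigma>. ((a, slot d i \<sigma>), (b, slot d j \<sigma>)) \<in> E n Rs)"
    and sub: "\<And>n Rs. structure_of ar ({..<n}, Rs) \<Longrightarrow>
      E n Rs \<subseteq> (set tags \<times> set (tuples n d)) \<times> (set tags \<times> set (tuples n d))"
    and decode: "\<And>x. x \<in> L \<Longrightarrow> \<exists>n Rs. structure_of ar ({..<n}, Rs) \<and> x = encode n ar Rs"
    and correct: "\<And>n Rs. structure_of ar ({..<n}, Rs) \<Longrightarrow>
      encode n ar Rs \<in> L \<longleftrightarrow> (\<exists>R. solves F (set tags \<times> set (tuples n d)) (E n Rs) R)"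
begin

lemma reducible_to_completion: "poly_reducible L (orientation_completion F)"
proof (rule poly_reducible_generable[OF _ decode Nil_not_OC])
  have "generable ar 0 (\<lambda>n Rs \<sigma>. replicate (length (tagged tags d n)) True @ [False] @
      map (\<lambda>t. t \<in> edge_tuples (E n Rs)) (product_lists (replicate 2 (tagged tags d n))))"
    by (intro generable_append generable_tagged_size generable_bit definable_const generable_edges def) auto
  then show "generable ar 0 (\<lambda>n Rs \<sigma>. enc_list (tagged tags d n) [2] [edge_tuples (E n Rs)])"
    by (simp add: enc_list_def)
  show "encode n ar Rs \<in> L \<longleftrightarrow> enc_list (tagged tags d n) [2] [edge_tuples (E n Rs)] \<in> orientation_completion F"
    if "structure_of ar ({..<n}, Rs)" for n Rs
    using OC_enc_list[OF distinct_tagged[OF tags, of d n], unfolded set_tagged, OF sub[OF that], of F]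
      correct[OF that] by simp
qed

lemma reducible_to_limit:
  fixes D :: "'a digraph"
  assumes lim: "fraisse_limit F D"
  shows "poly_reducible L (CSP [2, 2] (with_U D))"
proof (rule poly_reducible_generable[OF _ decode Nil_not_CSP])
  have "generable ar 0 (\<lambda>n Rs \<sigma>. replicate (length (tagged tags d n)) True @ [False] @
      map (\<lambda>t. t \<in> edge_tuples (E n Rs - (E n Rs)\<inverse>)) (product_lists (replicate 2 (tagged tags d n))) @
      map (\<lambda>t. t \<in> edge_tuples (E n Rs)) (product_lists (replicate 2 (tagged tags d n))))"
    unfolding Diff_iff converse_iff
    by (intro generable_append generable_tagged_size generable_bit definable_const generable_edges[where E = E] def
        generable_edges[where E = "\<lambda>n Rs. E n Rs - (E n Rs)\<inverse>"])
      (auto intro!: definable_conj definable_not def)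
  then show "generable ar 0 (\<lambda>n Rs \<sigma>. enc_list (tagged tags d n) [2, 2]
      [edge_tuples (E n Rs - (E n Rs)\<inverse>), edge_tuples (E n Rs)])"
    by (simp add: enc_list_def)
  fix n :: nat and Rs :: rels assume st: "structure_of ar ({..<n}, Rs)"
  let ?V = "set tags \<times> set (tuples n d)" and ?E = "E n Rs"
  have "?E - ?E\<inverse> \<subseteq> ?V \<times> ?V" "finite ?V" using sub[OF st] by auto
  note hl = hom_limit[OF lim this(2,1) sub[OF st]]
  have "?E - ?E\<inverse> \<union> ?E = ?E" by blast
  moreover have "enc_list (tagged tags d n) [2, 2] [edge_tuples (?E - ?E\<inverse>), edge_tuples ?E] \<in> CSP [2, 2] (with_U D) \<longleftrightarrow>
     (\<exists>h. homomorphism h (?V, [edge_tuples (?E - ?E\<inverse>), edge_tuples ?E]) (with_U D))"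
    using \<open>?E - ?E\<inverse> \<subseteq> ?V \<times> ?V\<close> sub[OF st]
    by (subst CSP_enc_list[OF distinct_tagged[OF tags]]) (simp_all add: structure_of_edge_tuples2 set_tagged)
  ultimately show "encode n ar Rs \<in> L \<longleftrightarrow> enc_list (tagged tags d n) [2, 2]
      [edge_tuples (?E - ?E\<inverse>), edge_tuples ?E] \<in> CSP [2, 2] (with_U D)"
    using hl correct[OF st] by (simp add: solves_solution)
qed

end

end

section \<open>Tournament codes\<close>

definition pairs :: "nat \<Rightarrow> (nat \<times> nat) list" where
  "pairs k = concat (map (\<lambda>i. map (Pair i) [Suc i..<Suc k]) [1..<Suc k])"

lemma tournament_code_pairs: "tournament_code k E = map (\<lambda>e. if e \<in> E then 1 else 0) (pairs k)"
  by (simp add: tournament_code_def pairs_def map_concat comp_def del: upt_Suc)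

lemma set_pairs: "set (pairs k) = {(i, j). 1 \<le> i \<and> i < j \<and> j \<le> k}"
proof -
  have mem: "(i, j) \<in> set (concat (map (\<lambda>i. map (Pair i) (f i)) is)) \<longleftrightarrow> i \<in> set is \<and> j \<in> set (f i)"
    for i j and f :: "nat \<Rightarrow> nat list" and "is" :: "nat list"
    by (induction "is") auto
  have "(i, j) \<in> set (pairs k) \<longleftrightarrow> i \<in> {1..<Suc k} \<and> j \<in> {Suc i..<Suc k}" for i j
    unfolding pairs_def mem set_upt by (rule refl)
  then show ?thesis by auto
qed

lemma distinct_pairs: "distinct (pairs k)"
proof -
  have "distinct (concat (map (\<lambda>i. map (Pair i) (f i)) is))"
    if "distinct is" "\<And>i. distinct (f i)" for f :: "nat \<Rightarrow> nat list" and "is" :: "nat list"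
    using that(1) by (induction "is") (auto simp: distinct_map that(2) inj_on_def)
  then show ?thesis unfolding pairs_def by simp
qed

lemma length_pairs: "length (pairs k) = k choose 2"
proof -
  have "sum_list (map (\<lambda>i. k - i) [1..<Suc k]) = k choose 2"
  proof (induction k)
    case (Suc k)
    have "sum_list (map (\<lambda>i. Suc k - i) [1..<Suc (Suc k)]) = sum_list (map (\<lambda>i. Suc k - i) [1..<Suc k])"
      by simp
    also have "map (\<lambda>i. Suc k - i) [1..<Suc k] = map (\<lambda>i. (k - i) + 1) [1..<Suc k]"
      by (rule map_cong[OF refl]) (auto simp: Suc_diff_le)
    also have "sum_list \<dots> = sum_list (map (\<lambda>i. k - i) [1..<Suc k]) + k"
      by (simp only: sum_list_addf sum_list_triv length_upt) simp
    finally show ?case unfolding Suc by (simp add: numeral_2_eq_2)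
  qed simp
  then show ?thesis by (simp add: pairs_def length_concat comp_def del: upt_Suc)
qed

definition decode_tournament :: "nat \<Rightarrow> nat list \<Rightarrow> nat rel" where
  "decode_tournament k c = {(i, j). \<exists>p<length (pairs k).
     (pairs k ! p = (i, j) \<and> c ! p = 1) \<or> (pairs k ! p = (j, i) \<and> c ! p \<noteq> 1)}"

lemma pairs_nth: "p < length (pairs k) \<Longrightarrow> pairs k ! p = (i, j) \<Longrightarrow> 1 \<le> i \<and> i < j \<and> j \<le> k"
  using nth_mem[of p "pairs k"] by (simp add: set_pairs)

lemma pairs_ex: "1 \<le> i \<Longrightarrow> i < j \<Longrightarrow> j \<le> k \<Longrightarrow> \<exists>p<length (pairs k). pairs k ! p = (i, j)"
proof -
  assume "1 \<le> i" "i < j" "j \<le> k"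
  then have "(i, j) \<in> set (pairs k)" by (simp add: set_pairs)
  then show ?thesis by (simp add: in_set_conv_nth)
qed

lemma decode_tournament_nth:
  assumes p: "p < length (pairs k)" "pairs k ! p = (i, j)"
  shows "(i, j) \<in> decode_tournament k c \<longleftrightarrow> c ! p = 1" "(j, i) \<in> decode_tournament k c \<longleftrightarrow> c ! p \<noteq> 1"
proof -
  have ij: "i < j" using pairs_nth[OF p] by simp
  have uniq: "q = p" if "q < length (pairs k)" "pairs k ! q = (i, j)" for q
    using nth_eq_iff_index_eq[OF distinct_pairs, of q k p] that p by simp
  have no: "pairs k ! q \<noteq> (j, i)" if "q < length (pairs k)" for q
    using pairs_nth[OF that, of j i] ij by auto
  show "(i, j) \<in> decode_tournament k c \<longleftrightarrow> c ! p = 1" "(j, i) \<in> decode_tournament k c \<longleftrightarrow> c ! p \<noteq> 1"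
    unfolding decode_tournament_def mem_Collect_eq prod.case using p uniq no by blast+
qed

lemma decode_tournament_cases:
  assumes "(i, j) \<in> decode_tournament k c"
  obtains p where "p < length (pairs k)" "pairs k ! p = (i, j)" "c ! p = 1"
    | p where "p < length (pairs k)" "pairs k ! p = (j, i)" "c ! p \<noteq> 1"
proof -
  have "\<exists>p<length (pairs k). (pairs k ! p = (i, j) \<and> c ! p = 1) \<or> (pairs k ! p = (j, i) \<and> c ! p \<noteq> 1)"
    using assms unfolding decode_tournament_def mem_Collect_eq prod.case .
  then show ?thesis using that by metis
qed

lemma decode_tournament_tournament: "tournament ({1..k}, decode_tournament k c)"
  unfolding tournament_iff asym_iff_all
proof (intro conjI allI impI ballI subrelI)
  fix i j assume ij: "(i, j) \<in> decode_tournament k c"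
  then show "(i, j) \<in> {1..k} \<times> {1..k}"
    by (cases rule: decode_tournament_cases) (use pairs_nth in fastforce)+
  from ij show "(j, i) \<notin> decode_tournament k c"
  proof (cases rule: decode_tournament_cases)
    case (1 p)
    then show ?thesis using decode_tournament_nth(2)[OF 1(1,2), of c] by simp
  next
    case (2 p)
    then show ?thesis using decode_tournament_nth(1)[OF 2(1,2), of c] by simp
  qed
next
  fix i j :: nat assume ij: "i \<in> {1..k}" "j \<in> {1..k}" "i \<noteq> j"
  then consider "i < j" | "j < i" using nat_neq_iff[of i j] by blast
  then show "(i, j) \<in> decode_tournament k c \<or> (j, i) \<in> decode_tournament k c"
  proof cases
    case 1
    then obtain p where p: "p < length (pairs k)" "pairs k ! p = (i, j)" using pairs_ex[of i j k] ij by auto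
    then show ?thesis using decode_tournament_nth[OF p, of c] by argo
  next
    case 2
    then obtain p where p: "p < length (pairs k)" "pairs k ! p = (j, i)" using pairs_ex[of j i k] ij by auto
    then show ?thesis using decode_tournament_nth[OF p, of c] by argo
  qed
qed

lemma tournament_ext:
  fixes k :: nat
  assumes "tournament ({1..k}, R)" "tournament ({1..k}, R')"
    and "\<And>i j. 1 \<le> i \<Longrightarrow> i < j \<Longrightarrow> j \<le> k \<Longrightarrow> (i, j) \<in> R \<longleftrightarrow> (i, j) \<in> R'"
  shows "R = R'"
proof -
  have half: "R \<subseteq> R'" if R: "tournament ({1..k}, R)" and R': "tournament ({1..k}, R')"
    and eq: "\<And>i j. 1 \<le> i \<Longrightarrow> i < j \<Longrightarrow> j \<le> k \<Longrightarrow> (i, j) \<in> R \<longleftrightarrow> (i, j) \<in> R'" for R R'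
  proof
    fix z assume z: "z \<in> R"
    obtain i j where ij: "z = (i, j)" by (cases z)
    have "i \<in> {1..k}" "j \<in> {1..k}" "i \<noteq> j" "(j, i) \<notin> R"
      using R z ij unfolding tournament_iff asym_iff_all by blast+
    moreover from this have "(i, j) \<in> R' \<or> (j, i) \<in> R'" using R' unfolding tournament_iff by blast
    moreover from calculation(3) consider "i < j" | "j < i" using nat_neq_iff[of i j] by blast
    then have "(i, j) \<in> R' \<or> (j, i) \<notin> R'"
    proof cases
      case 1
      then show ?thesis using eq[of i j] calculation(1,2) z ij by simp
    next
      case 2
      then show ?thesis using eq[of j i] calculation(1,2,4) by simp
    qed
    ultimately show "z \<in> R'" using ij by blast
  qed
  show ?thesis using half[OF assms] half[OF assms(2,1)] assms(3) by blast
qed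

lemma P_rel_iff:
  assumes "length c = k choose 2" "set c \<subseteq> {0, 1}"
  shows "c \<in> P_rel F k \<longleftrightarrow> free_of F ({1..k}, decode_tournament k c)"
proof
  have code: "tournament_code k (decode_tournament k c) = c"
  proof (rule nth_equalityI)
    show "length (tournament_code k (decode_tournament k c)) = length c"
      using assms(1) by (simp add: tournament_code_pairs length_pairs)
    fix p assume "p < length (tournament_code k (decode_tournament k c))"
    then have p: "p < length (pairs k)" by (simp add: tournament_code_pairs)
    obtain i j where ij: "pairs k ! p = (i, j)" by (cases "pairs k ! p")
    have "c ! p \<in> {0, 1}" using subsetD[OF assms(2) nth_mem[of p c]] p assms(1) by (simp add: length_pairs)
    then show "tournament_code k (decode_tournament k c) ! p = c ! p"
      using decode_tournament_nth(1)[OF p ij, of c] p ij by (auto simp: tournament_code_pairs)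
  qed
  assume "free_of F ({1..k}, decode_tournament k c)"
  then show "c \<in> P_rel F k"
    unfolding P_rel_def mem_Collect_eq using code[symmetric] decode_tournament_tournament[of k c] by blast
next
  assume "c \<in> P_rel F k"
  then obtain E where E: "c = tournament_code k E" "tournament ({1..k}, E)" "free_of F ({1..k}, E)"
    unfolding P_rel_def by blast
  have "decode_tournament k c = E"
  proof (rule tournament_ext[OF decode_tournament_tournament E(2)])
    fix i j assume "1 \<le> i" "i < j" "j \<le> k"
    then obtain p where p: "p < length (pairs k)" "pairs k ! p = (i, j)" using pairs_ex by blast
    have "c ! p = (if (i, j) \<in> E then 1 else 0)" using p by (simp add: E(1) tournament_code_pairs)
    then show "(i, j) \<in> decode_tournament k c \<longleftrightarrow> (i, j) \<in> E"
      using decode_tournament_nth(1)[OF p, of c] by (auto split: if_splits)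
  qed
  then show "free_of F ({1..k}, decode_tournament k c)" using E(3) by simp
qed

lemma hom_B01:
  "homomorphism h (V, map Q [2..<Suc (max_order F)] @ [Z0, Z1]) (B01 F) \<longleftrightarrow> h ` V \<subseteq> {0, 1} \<and>
     (\<forall>k\<in>{2..max_order F}. \<forall>t\<in>Q k. map h t \<in> P_rel F k) \<and>
     (\<forall>t\<in>Z0. map h t = [0]) \<and> (\<forall>t\<in>Z1. map h t = [1])"
proof -
  define m where "m = max_order F"
  define M where "M = length [2..<Suc m]"
  have "(\<forall>i<Suc (Suc M). \<forall>t\<in>(map Q [2..<Suc m] @ [Z0, Z1]) ! i.
      map h t \<in> (map (P_rel F) [2..<Suc m] @ [{[0]}, {[1]}]) ! i) \<longleftrightarrow>
    (\<forall>i<M. \<forall>t\<in>Q ([2..<Suc m] ! i). map h t \<in> P_rel F ([2..<Suc m] ! i)) \<and>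
    (\<forall>t\<in>Z0. map h t = [0]) \<and> (\<forall>t\<in>Z1. map h t = [1])"
    unfolding All_less_Suc by (auto simp: nth_append M_def simp del: upt_Suc)
  moreover have "(\<forall>i<M. \<forall>t\<in>Q ([2..<Suc m] ! i). map h t \<in> P_rel F ([2..<Suc m] ! i)) \<longleftrightarrow>
    (\<forall>k\<in>{2..m}. \<forall>t\<in>Q k. map h t \<in> P_rel F k)"
  proof -
    have "{2..m} = set [2..<Suc m]" by auto
    then show ?thesis unfolding M_def by (simp only: all_set_conv_all_nth)
  qed
  moreover have "length (map Q [2..<Suc m] @ [Z0, Z1]) = Suc (Suc M)" by (simp add: M_def)
  ultimately show ?thesis
    unfolding homomorphism_def B01_def m_def[symmetric] fst_conv snd_conv by simp
qed

lemma structure_B01: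
  "structure_of (B01_signature F) (V, map Q [2..<Suc (max_order F)] @ [Z0, Z1]) \<longleftrightarrow>
     (\<forall>k\<in>{2..max_order F}. \<forall>t\<in>Q k. length t = k choose 2 \<and> set t \<subseteq> V) \<and>
     (\<forall>t\<in>Z0. length t = 1 \<and> set t \<subseteq> V) \<and> (\<forall>t\<in>Z1. length t = 1 \<and> set t \<subseteq> V)"
proof -
  define m where "m = max_order F"
  define M where "M = length [2..<Suc m]"
  have "(\<forall>i<Suc (Suc M). \<forall>t\<in>(map Q [2..<Suc m] @ [Z0, Z1]) ! i.
      length t = (map (\<lambda>n. n choose 2) [2..<Suc m] @ [1, 1]) ! i \<and> set t \<subseteq> V) \<longleftrightarrow>
    (\<forall>i<M. \<forall>t\<in>Q ([2..<Suc m] ! i). length t = ([2..<Suc m] ! i) choose 2 \<and> set t \<subseteq> V) \<and>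
    (\<forall>t\<in>Z0. length t = 1 \<and> set t \<subseteq> V) \<and> (\<forall>t\<in>Z1. length t = 1 \<and> set t \<subseteq> V)"
    unfolding All_less_Suc by (auto simp: nth_append M_def simp del: upt_Suc)
  moreover have "(\<forall>i<M. \<forall>t\<in>Q ([2..<Suc m] ! i). length t = ([2..<Suc m] ! i) choose 2 \<and> set t \<subseteq> V) \<longleftrightarrow>
    (\<forall>k\<in>{2..m}. \<forall>t\<in>Q k. length t = k choose 2 \<and> set t \<subseteq> V)"
  proof -
    have "{2..m} = set [2..<Suc m]" by auto
    then show ?thesis unfolding M_def by (simp only: all_set_conv_all_nth)
  qed
  moreover have "length (map (\<lambda>n. n choose 2) [2..<Suc m] @ [1, 1]) = Suc (Suc M)" by (simp add: M_def)
  ultimately show ?thesis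
    unfolding structure_of_def B01_signature_def m_def[symmetric] fst_conv snd_conv by (simp add: M_def del: upt_Suc)
qed

text \<open>Every instance over the signature of the Boolean structure is of this form.\<close>

lemma B01_instance:
  assumes "structure_of (B01_signature F) (V, Rs)"
  defines "M \<equiv> max_order F - 1"
  shows "Rs = map (\<lambda>k. Rs ! (k - 2)) [2..<Suc (max_order F)] @ [Rs ! M, Rs ! Suc M]"
proof (rule nth_equalityI)
  have len: "length Rs = Suc (Suc M)"
    using structure_of_length[OF assms(1)] by (simp add: B01_signature_def M_def del: upt_Suc)
  then show "length Rs = length (map (\<lambda>k. Rs ! (k - 2)) [2..<Suc (max_order F)] @ [Rs ! M, Rs ! Suc M])"
    by (simp add: M_def del: upt_Suc)
  fix i assume "i < length Rs"
  then consider "i < M" | "i = M" | "i = Suc M" using len by linarith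
  then show "Rs ! i = (map (\<lambda>k. Rs ! (k - 2)) [2..<Suc (max_order F)] @ [Rs ! M, Rs ! Suc M]) ! i"
    by cases (simp_all add: nth_append M_def del: upt_Suc)
qed

section \<open>Reductions to the Boolean problem\<close>

lemma generable_product:
  assumes "generable ar (k + d * c) G"
  shows "generable ar k (\<lambda>n Rs \<sigma>. concat (map (\<lambda>ts. G n Rs (\<sigma> @ concat ts))
    (product_lists (replicate c (tuples n d)))))"
  using assms
proof (induction c arbitrary: k)
  case (Suc c)
  have "generable ar (k + d) (\<lambda>n Rs \<sigma>. concat (map (\<lambda>ts. G n Rs (\<sigma> @ concat ts))
    (product_lists (replicate c (tuples n d)))))"
    using Suc.IH[of "k + d"] Suc.prems by (simp add: add.assoc)
  then have A: "generable ar k (\<lambda>n Rs \<sigma>. concat (map (\<lambda>t. concat (map (\<lambda>ts. G n Rs ((\<sigma> @ t) @ concat ts))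
    (product_lists (replicate c (tuples n d))))) (tuples n d)))"
    by (rule generable_for)
  have *: "concat (map (\<lambda>ts. g (concat ts)) (concat (map (\<lambda>x. map ((#) x) X) Y))) =
      concat (map (\<lambda>x. concat (map (\<lambda>ts. g (x @ concat ts)) X)) Y)"
    for g :: "nat list \<Rightarrow> bool list" and X Y
    by (induction Y) (simp_all add: comp_def)
  show ?case
    by (rule generable_cong[OF A]) (simp add: *[of "\<lambda>l. G n Rs (\<sigma> @ l)" for n Rs \<sigma>])
qed simp

lemma valid_nth: "valid ar k n Rs \<sigma> \<Longrightarrow> i < k \<Longrightarrow> \<sigma> ! i < n"
  using subsetD[OF _ nth_mem[of i \<sigma>], of "{..<n}"] by (simp add: valid_def)

text \<open>The Boolean variables are the ordered pairs of vertices; only the pairs \<open>[i, j]\<close> with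
  \<open>i < j\<close> and, to refute loops, \<open>i = j\<close> are constrained.\<close>

definition clique_rel :: "nat \<Rightarrow> nat rel \<Rightarrow> nat \<Rightarrow> nat list list set" where
  "clique_rel n A k = {map (\<lambda>(i, j). [v i, v j]) (pairs k) | v.
     \<forall>(i, j)\<in>set (pairs k). v i < v j \<and> v j < n \<and> ((v i, v j) \<in> A \<or> (v j, v i) \<in> A)}"

definition zero_rel :: "nat \<Rightarrow> nat rel \<Rightarrow> nat rel \<Rightarrow> nat list list set" where
  "zero_rel n E A = {[[i, j]] | i j. i < n \<and> j < n \<and> (i < j \<and> (j, i) \<in> E \<or> i = j \<and> (i, j) \<in> A)}"

definition one_rel :: "nat \<Rightarrow> nat rel \<Rightarrow> nat rel \<Rightarrow> nat list list set" where
  "one_rel n E A = {[[i, j]] | i j. i < n \<and> j < n \<and> (i < j \<and> (i, j) \<in> E \<or> i = j \<and> (i, j) \<in> A)}"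

lemma decode_pull:
  fixes v :: "nat \<Rightarrow> nat"
  assumes R: "asym R"
    and v: "\<And>i j. 1 \<le> i \<Longrightarrow> i < j \<Longrightarrow> j \<le> k \<Longrightarrow> v i < v j \<and> ((v i, v j) \<in> R \<or> (v j, v i) \<in> R) \<and>
      (h [v i, v j] = 1 \<longleftrightarrow> (v i, v j) \<in> R)"
  shows "inj_on v {1..k}"
    and "decode_tournament k (map h (map (\<lambda>(i, j). [v i, v j]) (pairs k))) = pull v {1..k} R"
proof -
  have less: "v i < v j" if "1 \<le> i" "i < j" "j \<le> k" for i j using v[OF that] by blast
  show inj: "inj_on v {1..k}"
  proof (rule inj_onI, rule ccontr)
    fix i j assume ij: "i \<in> {1..k}" "j \<in> {1..k}" "v i = v j" "i \<noteq> j"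
    then consider "i < j" | "j < i" using nat_neq_iff[of i j] by blast
    then show False using less[of i j] less[of j i] ij by cases auto
  qed
  have as: "(y, x) \<notin> R" if "(x, y) \<in> R" for x y using R that unfolding asym_iff_all by blast
  show "decode_tournament k (map h (map (\<lambda>(i, j). [v i, v j]) (pairs k))) = pull v {1..k} R"
  proof (rule tournament_ext[OF decode_tournament_tournament])
    show "tournament ({1..k}, pull v {1..k} R)"
      unfolding tournament_iff asym_iff_all
    proof (intro conjI allI impI ballI)
      show "pull v {1..k} R \<subseteq> {1..k} \<times> {1..k}" by (auto simp: pull_def)
      show "(j, i) \<notin> pull v {1..k} R" if "(i, j) \<in> pull v {1..k} R" for i j
        using that as by (simp add: pull_def)
      fix i j assume ij: "i \<in> {1..k}" "j \<in> {1..k}" "i \<noteq> j"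
      then consider "i < j" | "j < i" using nat_neq_iff[of i j] by blast
      then show "(i, j) \<in> pull v {1..k} R \<or> (j, i) \<in> pull v {1..k} R"
        using v[of i j] v[of j i] ij by cases (auto simp: pull_def)
    qed
    fix i j assume ij: "1 \<le> i" "i < j" "j \<le> k"
    then obtain p where p: "p < length (pairs k)" "pairs k ! p = (i, j)" using pairs_ex by blast
    then show "(i, j) \<in> decode_tournament k (map h (map (\<lambda>(i, j). [v i, v j]) (pairs k))) \<longleftrightarrow>
        (i, j) \<in> pull v {1..k} R"
      using v[OF ij] ij by (simp add: decode_tournament_nth(1)[OF p] pull_def)
  qed
qed

definition pairs_of :: "nat \<Rightarrow> nat list \<Rightarrow> nat list list" where
  "pairs_of c \<sigma> = map (\<lambda>p. [\<sigma> ! (2 * p), \<sigma> ! (2 * p + 1)]) [0..<c]"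

lemma pairs_of_concat:
  assumes "\<And>t. t \<in> set ts \<Longrightarrow> length t = 2"
  shows "pairs_of (length ts) (concat ts) = ts"
proof (rule nth_equalityI)
  fix p assume "p < length (pairs_of (length ts) (concat ts))"
  then have p: "p < length ts" by (simp add: pairs_of_def)
  then have len: "length (ts ! p) = 2" using assms by simp
  have "length t = 2" if "t \<in> set (take p ts)" for t using that assms by (meson in_set_takeD)
  then have m: "map length (take p ts) = map (\<lambda>_. 2) (take p ts)" by simp
  have "sum_list (map length (take p ts)) = 2 * p" unfolding m using p by (simp add: sum_list_triv)
  then have "concat ts ! (2 * p + r) = ts ! p ! r" if "r < 2" for r
    using nth_concat[OF p, of r] len that by simp
  from this[of 0] this[of 1] have "[concat ts ! (2 * p), concat ts ! (2 * p + 1)] = ts ! p"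
    using len by (auto simp: length_Suc_conv numeral_2_eq_2)
  then show "pairs_of (length ts) (concat ts) ! p = ts ! p" using p by (simp add: pairs_of_def)
qed (simp add: pairs_of_def)

lemma clique_rel_iff:
  assumes c: "c = k choose 2" and \<sigma>: "length \<sigma> = 2 * c" "set \<sigma> \<subseteq> {..<n}"
  defines "lab u \<equiv> (if even u then fst (pairs k ! (u div 2)) else snd (pairs k ! (u div 2)))"
  shows "pairs_of c \<sigma> \<in> clique_rel n A k \<longleftrightarrow>
    (\<forall>u\<in>{..<2 * c}. \<forall>u'\<in>{..<2 * c}. lab u \<noteq> lab u' \<or> \<sigma> ! u = \<sigma> ! u') \<and>
    (\<forall>p\<in>{..<c}. \<sigma> ! (2 * p) < \<sigma> ! (2 * p + 1) \<and>
      ((\<sigma> ! (2 * p), \<sigma> ! (2 * p + 1)) \<in> A \<or> (\<sigma> ! (2 * p + 1), \<sigma> ! (2 * p)) \<in> A))"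
    (is "_ \<longleftrightarrow> ?lab \<and> ?adj")
proof
  have len: "length (pairs k) = c" by (simp add: length_pairs c)
  assume "pairs_of c \<sigma> \<in> clique_rel n A k"
  then obtain v where v: "pairs_of c \<sigma> = map (\<lambda>(i, j). [v i, v j]) (pairs k)"
      "\<forall>(i, j)\<in>set (pairs k). v i < v j \<and> v j < n \<and> ((v i, v j) \<in> A \<or> (v j, v i) \<in> A)"
    unfolding clique_rel_def by blast
  have nth: "\<sigma> ! (2 * p) = v (fst (pairs k ! p)) \<and> \<sigma> ! (2 * p + 1) = v (snd (pairs k ! p))" if "p < c" for p
  proof -
    have "pairs_of c \<sigma> ! p = map (\<lambda>(i, j). [v i, v j]) (pairs k) ! p" using v(1) by (rule arg_cong)
    then show ?thesis using that len by (simp add: pairs_of_def case_prod_unfold)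
  qed
  have "\<sigma> ! u = v (lab u)" if "u < 2 * c" for u
  proof (cases "even u")
    case True
    then show ?thesis using nth[of "u div 2"] that by (auto simp: lab_def)
  next
    case False
    then have "u = 2 * (u div 2) + 1" "u div 2 < c" using that by presburger+
    then show ?thesis using nth[of "u div 2"] False unfolding lab_def by metis
  qed
  then have ?lab by simp
  moreover have ?adj
  proof
    fix p assume "p \<in> {..<c}"
    then have p: "p < c" by simp
    then have "pairs k ! p \<in> set (pairs k)" using len by simp
    then show "\<sigma> ! (2 * p) < \<sigma> ! (2 * p + 1) \<and>
      ((\<sigma> ! (2 * p), \<sigma> ! (2 * p + 1)) \<in> A \<or> (\<sigma> ! (2 * p + 1), \<sigma> ! (2 * p)) \<in> A)"
      using v(2) nth[OF p] by (auto simp: case_prod_unfold)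
  qed
  ultimately show "?lab \<and> ?adj" ..
next
  have len: "length (pairs k) = c" by (simp add: length_pairs c)
  assume *: "?lab \<and> ?adj"
  have lab: "\<sigma> ! u = \<sigma> ! u'" if "u < 2 * c" "u' < 2 * c" "lab u = lab u'" for u u'
    using bspec[OF bspec[OF conjunct1[OF *], of u], of u'] that by simp
  note adj = conjunct2[OF *]
  define v where "v i = \<sigma> ! (SOME u. u < 2 * c \<and> lab u = i)" for i
  have v: "v (lab u) = \<sigma> ! u" if "u < 2 * c" for u
  proof -
    have "(SOME u'. u' < 2 * c \<and> lab u' = lab u) < 2 * c \<and> lab (SOME u'. u' < 2 * c \<and> lab u' = lab u) = lab u"
      by (rule someI[where x = u]) (use that in simp)
    then show ?thesis unfolding v_def by (intro lab) (use that in auto)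
  qed
  have vp: "v (fst (pairs k ! p)) = \<sigma> ! (2 * p)" "v (snd (pairs k ! p)) = \<sigma> ! (2 * p + 1)" if "p < c" for p
    using v[of "2 * p"] v[of "2 * p + 1"] that by (simp_all add: lab_def)
  have bound: "\<sigma> ! u < n" if "u < 2 * c" for u
    using subsetD[OF \<sigma>(2) nth_mem[of u \<sigma>]] \<sigma>(1) that by simp
  have "pairs_of c \<sigma> = map (\<lambda>(i, j). [v i, v j]) (pairs k)"
    by (rule nth_equalityI) (use len vp in \<open>simp_all add: pairs_of_def case_prod_unfold\<close>)
  moreover have "v i < v j \<and> v j < n \<and> ((v i, v j) \<in> A \<or> (v j, v i) \<in> A)" if ij: "(i, j) \<in> set (pairs k)" for i j
  proof -
    obtain p where p: "p < c" "pairs k ! p = (i, j)" using ij len by (auto simp: in_set_conv_nth)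
    have "v i = \<sigma> ! (2 * p)" "v j = \<sigma> ! (2 * p + 1)" using vp[OF p(1)] p(2) by simp_all
    moreover have "\<sigma> ! (2 * p + 1) < n" using bound[of "2 * p + 1"] p(1) by simp
    ultimately show ?thesis using bspec[OF adj, of p] p(1) by simp
  qed
  ultimately show "pairs_of c \<sigma> \<in> clique_rel n A k" unfolding clique_rel_def by blast
qed

lemma generable_rel:
  assumes "definable ar (0 + 2 * c) (\<lambda>n Rs \<sigma>. pairs_of c \<sigma> \<in> Q n Rs)"
  shows "generable ar 0 (\<lambda>n Rs \<sigma>. map (\<lambda>t. t \<in> Q n Rs) (product_lists (replicate c (tuples n 2))))"
proof (rule generable_cong[OF generable_product[OF generable_bit[OF assms]]])
  fix n Rs \<sigma> assume "valid ar 0 n Rs \<sigma>"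
  then have "\<sigma> = []" by (simp add: valid_def)
  moreover have "pairs_of c (concat ts) = ts" if "ts \<in> set (product_lists (replicate c (tuples n 2)))" for ts
    using pairs_of_concat[of ts] that by (auto simp: set_product_lists_replicate set_tuples)
  ultimately have m: "map (\<lambda>ts. [pairs_of c (\<sigma> @ concat ts) \<in> Q n Rs]) (product_lists (replicate c (tuples n 2)))
    = map (\<lambda>ts. [ts \<in> Q n Rs]) (product_lists (replicate c (tuples n 2)))"
    by (intro map_cong[OF refl]) simp
  show "concat (map (\<lambda>ts. [pairs_of c (\<sigma> @ concat ts) \<in> Q n Rs]) (product_lists (replicate c (tuples n 2)))) =
      map (\<lambda>t. t \<in> Q n Rs) (product_lists (replicate c (tuples n 2)))"
    unfolding m by (simp add: concat_map_singleton)
qed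

lemma enc_list_B01:
  "enc_list vs (B01_signature F) (map Q [2..<Suc (max_order F)] @ [Z0, Z1]) =
    replicate (length vs) True @ [False] @
    concat (map (\<lambda>k. map (\<lambda>t. t \<in> Q k) (product_lists (replicate (k choose 2) vs))) [2..<Suc (max_order F)]) @
    map (\<lambda>t. t \<in> Z0) (product_lists (replicate 1 vs)) @ map (\<lambda>t. t \<in> Z1) (product_lists (replicate 1 vs))"
proof -
  have "concat (map2 f (map g xs @ [a, b]) (map h xs @ [c, d])) = concat (map (\<lambda>x. f (g x) (h x)) xs) @ f a c @ f b d"
    for f :: "nat \<Rightarrow> 'a list set \<Rightarrow> bool list" and g h a b c d and xs :: "nat list"
    by (induction xs) simp_all
  then show ?thesis by (simp only: enc_list_def B01_signature_def)
qed

context forbidden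
begin

lemma boolean_instance:
  assumes EA: "E \<subseteq> A" and A: "A \<subseteq> {..<n} \<times> {..<n}"
  shows "(\<exists>h. homomorphism h (set (tuples n 2), map (clique_rel n A) [2..<Suc (max_order F)] @
      [zero_rel n E A, one_rel n E A]) (B01 F)) \<longleftrightarrow> (\<exists>R. solution F {..<n} E A R)"
proof
  assume "\<exists>R. solution F {..<n} E A R"
  then obtain R where R: "R \<subseteq> A \<union> A\<inverse>" "A \<subseteq> R \<union> R\<inverse>" "asym R" "E \<subseteq> R" "free_of F ({..<n}, R)"
    unfolding solution_def by blast
  have as: "(y, x) \<notin> R" if "(x, y) \<in> R" for x y using R(3) that unfolding asym_iff_all by blast
  define h where "h t = (if (t ! 0, t ! 1) \<in> R then 1 else (0 :: nat))" for t :: "nat list"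
  have "map h ts \<in> P_rel F k" if ts: "ts \<in> clique_rel n A k" for ts k
  proof -
    obtain v where v: "ts = map (\<lambda>(i, j). [v i, v j]) (pairs k)"
        "\<forall>(i, j)\<in>set (pairs k). v i < v j \<and> v j < n \<and> ((v i, v j) \<in> A \<or> (v j, v i) \<in> A)"
      using ts unfolding clique_rel_def by blast
    have vij: "v i < v j \<and> v j < n \<and> ((v i, v j) \<in> R \<or> (v j, v i) \<in> R) \<and> (h [v i, v j] = 1 \<longleftrightarrow> (v i, v j) \<in> R)"
      if "1 \<le> i" "i < j" "j \<le> k" for i j
    proof -
      have "(i, j) \<in> set (pairs k)" using that by (simp add: set_pairs)
      then have "v i < v j \<and> v j < n \<and> ((v i, v j) \<in> A \<or> (v j, v i) \<in> A)" using v(2) by blast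
      then show ?thesis using R(2) by (auto simp: h_def)
    qed
    have star: "v i < v j \<and> ((v i, v j) \<in> R \<or> (v j, v i) \<in> R) \<and> (h [v i, v j] = 1 \<longleftrightarrow> (v i, v j) \<in> R)"
      if "1 \<le> i" "i < j" "j \<le> k" for i j
      using vij[OF that] by blast
    have dec: "inj_on v {1..k}" "decode_tournament k (map h ts) = pull v {1..k} R"
      unfolding v(1)
      using decode_pull[where k = k and v = v and h = h and R = R, OF R(3) star] by (simp_all only:)
    have "v ` {1..k} \<subseteq> {..<n} \<or> k < 2"
    proof (cases "k < 2")
      case False
      have "v i < n" if "i \<in> {1..k}" for i
      proof (cases "i < k")
        case True then show ?thesis using vij[of i k] that by auto
      next
        case F: False
        then have "i = k" using that by simp
        then show ?thesis using vij[of 1 k] False by auto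
      qed
      then show ?thesis by auto
    qed simp
    then have "free_of F ({1..k}, decode_tournament k (map h ts))"
    proof
      assume img: "v ` {1..k} \<subseteq> {..<n}"
      show ?thesis unfolding dec(2) by (rule free_of_embeds[OF embeds_pull[OF dec(1) img] R(5)])
    next
      assume k: "k < 2"
      show ?thesis
      proof (rule free_of_cover)
        fix A' assume "A' \<subseteq> {1..k}" "2 \<le> card A'"
        then have "2 \<le> k" using card_mono[of "{1..k}" A'] by simp
        then show "\<exists>W. A' \<subseteq> W \<and> free_of F (W, decode_tournament k (map h ts) \<inter> W \<times> W)" using k by simp
      qed
    qed
    moreover have "length (map h ts) = k choose 2" by (simp add: v(1) length_pairs)
    moreover have "set (map h ts) \<subseteq> {0, 1}" by (auto simp: h_def)
    ultimately show ?thesis using P_rel_iff by blast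
  qed
  moreover have noloop: "(i, i) \<notin> A" for i using R(2) as by blast
  then have "map h t = [0]" if "t \<in> zero_rel n E A" for t
    using that R(4) as unfolding zero_rel_def h_def by auto
  moreover have "map h t = [1]" if "t \<in> one_rel n E A" for t
    using that R(4) noloop unfolding one_rel_def h_def by auto
  moreover have "h ` set (tuples n 2) \<subseteq> {0, 1}" by (auto simp: h_def)
  ultimately show "\<exists>h. homomorphism h (set (tuples n 2), map (clique_rel n A) [2..<Suc (max_order F)] @
      [zero_rel n E A, one_rel n E A]) (B01 F)"
    unfolding hom_B01 by (intro exI[of _ h] conjI ballI) (blast | simp)+
next
  assume "\<exists>h. homomorphism h (set (tuples n 2), map (clique_rel n A) [2..<Suc (max_order F)] @
      [zero_rel n E A, one_rel n E A]) (B01 F)"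
  then obtain h where "homomorphism h (set (tuples n 2), map (clique_rel n A) [2..<Suc (max_order F)] @
      [zero_rel n E A, one_rel n E A]) (B01 F)" by (rule exE)
  note hom = this[unfolded hom_B01]
  have h01: "h ` set (tuples n 2) \<subseteq> {0, 1}" using hom by (elim conjE)
  have hk: "map h t \<in> P_rel F k" if "k \<in> {2..max_order F}" "t \<in> clique_rel n A k" for k t
    using bspec[OF bspec[OF conjunct1[OF conjunct2[OF hom]] that(1)] that(2)] .
  have h0: "map h t = [0]" if "t \<in> zero_rel n E A" for t
    using bspec[OF conjunct1[OF conjunct2[OF conjunct2[OF hom]]] that] .
  have h1: "map h t = [1]" if "t \<in> one_rel n E A" for t
    using bspec[OF conjunct2[OF conjunct2[OF conjunct2[OF hom]]] that] .
  have noloop: "(i, i) \<notin> A" for i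
  proof
    assume "(i, i) \<in> A"
    moreover from this have "i < n" using A by blast
    ultimately have "[[i, i]] \<in> zero_rel n E A" "[[i, i]] \<in> one_rel n E A"
      unfolding zero_rel_def one_rel_def by blast+
    then show False using h0 h1 by fastforce
  qed
  define R where "R = {(i, j). ((i, j) \<in> A \<or> (j, i) \<in> A) \<and> (i < j \<and> h [i, j] = 1 \<or> j < i \<and> h [j, i] \<noteq> 1)}"
  have R1: "(i, j) \<in> R \<longleftrightarrow> h [i, j] = 1" "(j, i) \<in> R \<longleftrightarrow> h [i, j] \<noteq> 1"
    if "i < j" "(i, j) \<in> A \<or> (j, i) \<in> A" for i j
    using that by (auto simp: R_def)
  have as: "asym R" unfolding asym_iff_all R_def by auto
  have "A \<subseteq> R \<union> R\<inverse>"
  proof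
    fix z assume z: "z \<in> A"
    obtain i j where ij: "z = (i, j)" by (cases z)
    then have "i \<noteq> j" using z noloop by blast
    then consider "i < j" | "j < i" using nat_neq_iff[of i j] by blast
    then show "z \<in> R \<union> R\<inverse>" using R1[of i j] R1[of j i] z ij by cases auto
  qed
  moreover have "E \<subseteq> R"
  proof
    fix z assume z: "z \<in> E"
    obtain i j where ij: "z = (i, j)" by (cases z)
    have zA: "(i, j) \<in> A" using z ij EA by blast
    then have n: "i < n" "j < n" using A by auto
    have "i \<noteq> j" using zA noloop by blast
    then consider "i < j" | "j < i" using nat_neq_iff[of i j] by blast
    then show "z \<in> R"
    proof cases
      case 1
      then have "[[i, j]] \<in> one_rel n E A" using n z ij unfolding one_rel_def by blast
      then show ?thesis using h1[of "[[i, j]]"] R1[OF 1] zA ij by simp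
    next
      case 2
      then have "[[j, i]] \<in> zero_rel n E A" using n z ij unfolding zero_rel_def by blast
      then show ?thesis using h0[of "[[j, i]]"] R1[OF 2] zA ij by simp
    qed
  qed
  moreover have "R \<subseteq> A \<union> A\<inverse>" unfolding R_def by blast
  moreover have "free_of F ({..<n}, R)"
  proof (rule free_of_cover)
    fix B assume B: "B \<subseteq> {..<n}" "finite B" "2 \<le> card B" "card B \<le> max_order F"
      "\<And>u v. u \<in> B \<Longrightarrow> v \<in> B \<Longrightarrow> u \<noteq> v \<Longrightarrow> (u, v) \<in> R \<or> (v, u) \<in> R"
    define k where "k = card B"
    define v where "v i = sorted_list_of_set B ! (i - 1)" for i
    have v_in: "v i \<in> B" if "1 \<le> i" "i \<le> k" for i
      using nth_mem[of "i - 1" "sorted_list_of_set B"] that B(2) by (simp add: v_def k_def)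
    have v_less: "v i < v j" if "1 \<le> i" "i < j" "j \<le> k" for i j
      using sorted_wrt_nth_less[OF strict_sorted_list_of_set[of B], of "i - 1" "j - 1"] that B(2)
      by (simp add: v_def k_def)
    have adjR: "(v i, v j) \<in> R \<or> (v j, v i) \<in> R" if "1 \<le> i" "i < j" "j \<le> k" for i j
      using B(5)[of "v i" "v j"] v_in[of i] v_in[of j] v_less[OF that] that by simp
    have adjA: "(v i, v j) \<in> A \<or> (v j, v i) \<in> A" if "1 \<le> i" "i < j" "j \<le> k" for i j
      using adjR[OF that] \<open>R \<subseteq> A \<union> A\<inverse>\<close> by blast
    define ts where "ts = map (\<lambda>(i, j). [v i, v j]) (pairs k)"
    have all: "v i < v j \<and> v j < n \<and> ((v i, v j) \<in> A \<or> (v j, v i) \<in> A)" if "1 \<le> i" "i < j" "j \<le> k" for i j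
    proof -
      have "v j \<in> B" using v_in[of j] that by simp
      then have "v j < n" using B(1) by blast
      then show ?thesis using v_less[OF that] adjA[OF that] by blast
    qed
    have "\<forall>(i, j)\<in>set (pairs k). v i < v j \<and> v j < n \<and> ((v i, v j) \<in> A \<or> (v j, v i) \<in> A)"
    proof
      fix e assume "e \<in> set (pairs k)"
      then obtain i j where "e = (i, j)" "1 \<le> i" "i < j" "j \<le> k" by (auto simp: set_pairs)
      then show "case e of (i, j) \<Rightarrow> v i < v j \<and> v j < n \<and> ((v i, v j) \<in> A \<or> (v j, v i) \<in> A)"
        using all[of i j] by simp
    qed
    then have "ts \<in> clique_rel n A k" unfolding clique_rel_def ts_def by blast
    then have P: "map h ts \<in> P_rel F k" using hk[of k ts] B(3,4) by (simp add: k_def)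
    have star: "v i < v j \<and> ((v i, v j) \<in> R \<or> (v j, v i) \<in> R) \<and> (h [v i, v j] = 1 \<longleftrightarrow> (v i, v j) \<in> R)"
      if "1 \<le> i" "i < j" "j \<le> k" for i j
      using v_less[OF that] adjR[OF that] R1[OF v_less[OF that] adjA[OF that]] by blast
    have dec: "inj_on v {1..k}" "decode_tournament k (map h ts) = pull v {1..k} R"
      unfolding ts_def
      using decode_pull[where k = k and v = v and h = h and R = R, OF as star] by (simp_all only:)
    have "set (map h ts) \<subseteq> {0, 1}"
    proof
      fix y assume "y \<in> set (map h ts)"
      then obtain i j where ij: "(i, j) \<in> set (pairs k)" "y = h [v i, v j]" by (auto simp: ts_def)
      then have "v i \<in> B" "v j \<in> B" using v_in by (auto simp: set_pairs)
      then have "[v i, v j] \<in> set (tuples n 2)" using B(1) by (auto simp: set_tuples)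
      from subsetD[OF h01 imageI[OF this]] show "y \<in> {0, 1}" unfolding ij(2) .
    qed
    then have free: "free_of F ({1..k}, pull v {1..k} R)"
      using P P_rel_iff[of "map h ts" k F] dec(2) by (simp add: ts_def length_pairs)
    have "v ` {1..k} = B"
    proof (rule card_seteq[OF B(2)])
      show "v ` {1..k} \<subseteq> B" using v_in by auto
      show "card B \<le> card (v ` {1..k})" using card_image[OF dec(1)] by (simp add: k_def)
    qed
    then have bij: "bij_betw v {1..k} B" using dec(1) by (simp add: bij_betw_def)
    have "pull v {1..k} (R \<inter> B \<times> B) = pull v {1..k} R" using v_in by (auto simp: pull_def)
    then have "pull (the_inv_into {1..k} v) B (pull v {1..k} R) = R \<inter> B \<times> B"
      using pull_pull[OF bij, of "R \<inter> B \<times> B"] by simp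
    moreover have "bij_betw (the_inv_into {1..k} v) B {1..k}" using bij by (rule bij_betw_the_inv_into)
    then have "embeds (B, pull (the_inv_into {1..k} v) B (pull v {1..k} R)) ({1..k}, pull v {1..k} R)"
      by (intro embeds_pull) (auto simp: bij_betw_def)
    ultimately have "free_of F (B, R \<inter> B \<times> B)" using free_of_embeds[OF _ free] by simp
    then show "\<exists>W. B \<subseteq> W \<and> free_of F (W, R \<inter> W \<times> W)" by blast
  qed
  ultimately show "\<exists>R. solution F {..<n} E A R" unfolding solution_def using as by blast
qed

lemma reducible_to_boolean:
  assumes def_E: "\<And>k i j. i < k \<Longrightarrow> j < k \<Longrightarrow> definable ar k (\<lambda>n Rs \<sigma>. (\<sigma> ! i, \<sigma> ! j) \<in> E n Rs)"
    and def_A: "\<And>k i j. i < k \<Longrightarrow> j < k \<Longrightarrow> definable ar k (\<lambda>n Rs \<sigma>. (\<sigma> ! i, \<sigma> ! j) \<in> A n Rs)"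
    and sub: "\<And>n Rs. structure_of ar ({..<n}, Rs) \<Longrightarrow> E n Rs \<subseteq> A n Rs \<and> A n Rs \<subseteq> {..<n} \<times> {..<n}"
    and decode: "\<And>x. x \<in> L \<Longrightarrow> \<exists>n Rs. structure_of ar ({..<n}, Rs) \<and> x = encode n ar Rs"
    and correct: "\<And>n Rs. structure_of ar ({..<n}, Rs) \<Longrightarrow>
      encode n ar Rs \<in> L \<longleftrightarrow> (\<exists>R. solution F {..<n} (E n Rs) (A n Rs) R)"
  shows "poly_reducible L (CSP (B01_signature F) (B01 F))"
proof (rule poly_reducible_generable[OF _ decode Nil_not_CSP])
  let ?Q = "\<lambda>n Rs. map (clique_rel n (A n Rs)) [2..<Suc (max_order F)] @
      [zero_rel n (E n Rs) (A n Rs), one_rel n (E n Rs) (A n Rs)]"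
  have size: "generable ar 0 (\<lambda>n Rs \<sigma>. replicate (length (tuples n 2)) True)"
  proof -
    have "generable ar 0 (\<lambda>n Rs \<sigma>. concat (map (\<lambda>t. (\<lambda>n Rs \<sigma>. [True]) n Rs (\<sigma> @ t)) (tuples n 2)))"
      by (intro generable_for generable_bit definable_const)
    then show ?thesis by (rule generable_cong) (simp add: concat_map_singleton map_replicate_const)
  qed
  have Q: "definable ar (0 + 2 * (k choose 2)) (\<lambda>n Rs \<sigma>. pairs_of (k choose 2) \<sigma> \<in> clique_rel n (A n Rs) k)" for k
  proof -
    define c where "c = k choose 2"
    define lab where "lab u = (if even u then fst (pairs k ! (u div 2)) else snd (pairs k ! (u div 2)))" for u
    have "definable ar (0 + 2 * c) (\<lambda>n Rs \<sigma>.
      (\<forall>u\<in>{..<2 * c}. \<forall>u'\<in>{..<2 * c}. lab u \<noteq> lab u' \<or> \<sigma> ! u = \<sigma> ! u') \<and>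
      (\<forall>p\<in>{..<c}. \<sigma> ! (2 * p) < \<sigma> ! (2 * p + 1) \<and>
      ((\<sigma> ! (2 * p), \<sigma> ! (2 * p + 1)) \<in> A n Rs \<or> (\<sigma> ! (2 * p + 1), \<sigma> ! (2 * p)) \<in> A n Rs)))"
      by (intro definable_conj definable_ball definable_disj definable_const definable_eq definable_less def_A
          finite_lessThan) auto
    then show ?thesis unfolding c_def[symmetric]
      by (rule definable_cong) (simp add: clique_rel_iff[OF c_def] valid_def lab_def)
  qed
  have Z0: "definable ar (0 + 2 * 1) (\<lambda>n Rs \<sigma>. pairs_of 1 \<sigma> \<in> zero_rel n (E n Rs) (A n Rs))"
  proof -
    have "definable ar (0 + 2 * 1) (\<lambda>n Rs \<sigma>. \<sigma> ! 0 < \<sigma> ! 1 \<and> (\<sigma> ! 1, \<sigma> ! 0) \<in> E n Rs \<or>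
        \<sigma> ! 0 = \<sigma> ! 1 \<and> (\<sigma> ! 0, \<sigma> ! 1) \<in> A n Rs)"
      by (intro definable_conj definable_disj definable_eq definable_less def_A def_E) auto
    then show ?thesis
    proof (rule definable_cong)
      fix n Rs \<sigma> assume "valid ar (0 + 2 * 1) n Rs \<sigma>"
      then have "\<sigma> ! 0 < n" "\<sigma> ! 1 < n"
        by (simp_all add: valid_nth)
      then show "(\<sigma> ! 0 < \<sigma> ! 1 \<and> (\<sigma> ! 1, \<sigma> ! 0) \<in> E n Rs \<or> \<sigma> ! 0 = \<sigma> ! 1 \<and> (\<sigma> ! 0, \<sigma> ! 1) \<in> A n Rs) =
         (pairs_of 1 \<sigma> \<in> zero_rel n (E n Rs) (A n Rs))"
        by (simp add: pairs_of_def zero_rel_def)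
    qed
  qed
  have Z1: "definable ar (0 + 2 * 1) (\<lambda>n Rs \<sigma>. pairs_of 1 \<sigma> \<in> one_rel n (E n Rs) (A n Rs))"
  proof -
    have "definable ar (0 + 2 * 1) (\<lambda>n Rs \<sigma>. \<sigma> ! 0 < \<sigma> ! 1 \<and> (\<sigma> ! 0, \<sigma> ! 1) \<in> E n Rs \<or>
        \<sigma> ! 0 = \<sigma> ! 1 \<and> (\<sigma> ! 0, \<sigma> ! 1) \<in> A n Rs)"
      by (intro definable_conj definable_disj definable_eq definable_less def_A def_E) auto
    then show ?thesis
    proof (rule definable_cong)
      fix n Rs \<sigma> assume "valid ar (0 + 2 * 1) n Rs \<sigma>"
      then have "\<sigma> ! 0 < n" "\<sigma> ! 1 < n"
        by (simp_all add: valid_nth)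
      then show "(\<sigma> ! 0 < \<sigma> ! 1 \<and> (\<sigma> ! 0, \<sigma> ! 1) \<in> E n Rs \<or> \<sigma> ! 0 = \<sigma> ! 1 \<and> (\<sigma> ! 0, \<sigma> ! 1) \<in> A n Rs) =
         (pairs_of 1 \<sigma> \<in> one_rel n (E n Rs) (A n Rs))"
        by (simp add: pairs_of_def one_rel_def)
    qed
  qed
  show "generable ar 0 (\<lambda>n Rs \<sigma>. enc_list (tuples n 2) (B01_signature F) (?Q n Rs))"
    unfolding enc_list_B01
    by (intro generable_append generable_concat size generable_bit[OF definable_const]
        generable_rel[OF Q] generable_rel[OF Z0] generable_rel[OF Z1])
  fix n :: nat and Rs :: rels assume st: "structure_of ar ({..<n}, Rs)"
  have "structure_of (B01_signature F) (set (tuples n 2), ?Q n Rs)"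
    unfolding structure_B01
  proof (intro conjI ballI)
    fix k t assume "t \<in> clique_rel n (A n Rs) k"
    then obtain v where v: "t = map (\<lambda>(i, j). [v i, v j]) (pairs k)"
        "\<forall>(i, j)\<in>set (pairs k). v i < v j \<and> v j < n \<and> ((v i, v j) \<in> A n Rs \<or> (v j, v i) \<in> A n Rs)"
      unfolding clique_rel_def by blast
    show "length t = k choose 2" by (simp add: v(1) length_pairs)
    show "set t \<subseteq> set (tuples n 2)"
    proof
      fix y assume "y \<in> set t"
      then obtain i j where ij: "(i, j) \<in> set (pairs k)" "y = [v i, v j]" by (auto simp: v(1))
      then have "v i < v j \<and> v j < n" using v(2) by blast
      then show "y \<in> set (tuples n 2)" using ij(2) by (simp add: set_tuples)
    qed
  qed (auto simp: zero_rel_def one_rel_def set_tuples)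
  then show "encode n ar Rs \<in> L \<longleftrightarrow> enc_list (tuples n 2) (B01_signature F) (?Q n Rs) \<in> CSP (B01_signature F) (B01 F)"
    using CSP_enc_list[OF distinct_tuples, of "B01_signature F" n 2 "?Q n Rs" "B01 F"] boolean_instance sub[OF st]
      correct[OF st] by simp
qed

end

section \<open>Reducing the Boolean problem to graph problems\<close>

lemma take_slot:
  assumes "length \<sigma> = k" "i + d \<le> k" "c \<le> d"
  shows "take c (slot d i \<sigma>) = map ((!) \<sigma>) [i..<i + c]"
  by (rule nth_equalityI) (use assms in \<open>simp_all add: slot_def\<close>)

lemma nth_slot: "length \<sigma> = k \<Longrightarrow> i + d \<le> k \<Longrightarrow> l < d \<Longrightarrow> slot d i \<sigma> ! l = \<sigma> ! (i + l)"
  by (simp add: slot_def)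

lemma length_slot: "length \<sigma> = k \<Longrightarrow> i + d \<le> k \<Longrightarrow> length (slot d i \<sigma>) = d"
  by (simp add: slot_def)

lemma slot_tuples: "valid ar k n Rs \<sigma> \<Longrightarrow> i + d \<le> k \<Longrightarrow> slot d i \<sigma> \<in> set (tuples n d)"
  using set_take_subset[of d "drop i \<sigma>"] set_drop_subset[of i \<sigma>]
  unfolding valid_def by (auto simp: set_tuples slot_def)

lemma definable_slot_nth:
  assumes "i + d \<le> k" "j + d \<le> k" "l < d" "l' < d"
  shows "definable ar k (\<lambda>n Rs \<sigma>. slot d i \<sigma> ! l = slot d j \<sigma> ! l')"
proof -
  have "definable ar k (\<lambda>n Rs \<sigma>. \<sigma> ! (i + l) = \<sigma> ! (j + l'))" using assms by (intro definable_eq) auto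
  then show ?thesis by (rule definable_cong) (use assms in \<open>simp add: nth_slot valid_def\<close>)
qed

lemma definable_slot_eq:
  assumes "i + d \<le> k" "j + d \<le> k"
  shows "definable ar k (\<lambda>n Rs \<sigma>. slot d i \<sigma> = slot d j \<sigma>)"
proof -
  have "definable ar k (\<lambda>n Rs \<sigma>. \<forall>l\<in>{..<d}. slot d i \<sigma> ! l = slot d j \<sigma> ! l)"
    using assms by (intro definable_ball definable_slot_nth) auto
  then show ?thesis
    by (rule definable_cong) (use assms in \<open>auto simp: valid_def length_slot intro!: nth_equalityI\<close>)
qed

lemma definable_slot_rel:
  assumes "i + d \<le> k" "c \<le> d" "q < length ar" "ar ! q = c"
  shows "definable ar k (\<lambda>n Rs \<sigma>. take c (slot d i \<sigma>) \<in> Rs ! q)"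
proof -
  have "definable ar k (\<lambda>n Rs \<sigma>. map ((!) \<sigma>) [i..<i + c] \<in> Rs ! q)"
    using assms by (intro definable_atom) auto
  then show ?thesis by (rule definable_cong) (use assms in \<open>simp add: take_slot valid_def\<close>)
qed

lemma definable_slot_unary:
  assumes "i + d \<le> k" "0 < d" "q < length ar" "ar ! q = 1"
  shows "definable ar k (\<lambda>n Rs \<sigma>. [slot d i \<sigma> ! 0] \<in> Rs ! q)"
proof -
  have "definable ar k (\<lambda>n Rs \<sigma>. map ((!) \<sigma>) [i] \<in> Rs ! q)"
    using assms by (intro definable_atom) auto
  then show ?thesis by (rule definable_cong) (use assms in \<open>simp add: nth_slot valid_def\<close>)
qed

definition const_tuple :: "nat \<Rightarrow> nat list \<Rightarrow> bool" where
  "const_tuple d t \<longleftrightarrow> (\<forall>l\<in>{..<d}. t ! l = t ! 0)"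

lemma definable_const_tuple:
  assumes "i + d \<le> k" "0 < d"
  shows "definable ar k (\<lambda>n Rs \<sigma>. const_tuple d (slot d i \<sigma>))"
  unfolding const_tuple_def using assms by (intro definable_ball definable_slot_nth) auto

lemma const_replicate: "const_tuple d (replicate d x)"
  by (simp add: const_tuple_def)

lemma const_tupleD: "const_tuple d t \<Longrightarrow> length t = d \<Longrightarrow> t = replicate d (t ! 0)"
proof (rule nth_equalityI)
  fix i assume "const_tuple d t" "length t = d" "i < length t"
  then have "t ! i = t ! 0" unfolding const_tuple_def by blast
  then show "t ! i = replicate d (t ! 0) ! i" using \<open>length t = d\<close> \<open>i < length t\<close> by simp
qed simp

datatype tag = TV bool | TC nat nat | TG nat nat nat

type_synonym vertex = "tag \<times> nat list"

context forbidden
begin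

definition dim :: nat where
  "dim = Suc (max_order F choose 2)"

abbreviation m :: nat where "m \<equiv> max_order F"

lemma dim_pos: "0 < dim" by (simp add: dim_def)

lemma choose_less_dim: "k \<le> m \<Longrightarrow> k choose 2 < dim"
  unfolding dim_def using binomial_right_mono[of k m 2] by simp

lemma signature_nth:
  "k \<in> {2..m} \<Longrightarrow> k - 2 < length (B01_signature F) \<and> B01_signature F ! (k - 2) = k choose 2"
  "m - 1 < length (B01_signature F)" "B01_signature F ! (m - 1) = 1"
  "Suc (m - 1) < length (B01_signature F)" "B01_signature F ! Suc (m - 1) = 1"
  by (auto simp: B01_signature_def nth_append simp del: upt_Suc dest!: le_Suc_ex)

end

locale gadget = forbidden F for F :: "'b digraph set" +
  fixes W :: "nat set" and \<Gamma> :: "nat rel" and a b r s :: nat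
  assumes gadget: "equality W \<Gamma> a b r s"
begin

text \<open>The network of a Boolean instance: a variable \<open>x\<close> is an edge between \<open>TV False\<close> and
  \<open>TV True\<close>, tagged with the constant tuple \<open>x\<close>; a constraint on \<open>k\<close>-vertex tournaments is a
  clique of vertices \<open>TC k i\<close>; the vertices \<open>TG k p u\<close> form the interior of an equality gadget
  between the \<open>p\<close>-th edge of the clique and the corresponding variable. The first coordinates of
  the tuple of a clique or gadget vertex are the constraint. Both the graph and its orientations
  are networks.\<close>

fun net :: "(nat \<Rightarrow> nat list set) \<Rightarrow> (nat \<Rightarrow> bool \<Rightarrow> bool \<Rightarrow> bool) \<Rightarrow> (nat \<Rightarrow> nat list \<Rightarrow> nat rel) \<Rightarrow>
    (nat \<Rightarrow> nat \<Rightarrow> nat list \<Rightarrow> nat rel) \<Rightarrow> vertex \<Rightarrow> vertex \<Rightarrow> bool" where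
  "net Q X C G (TV x, t) (TV y, t') \<longleftrightarrow> t = t' \<and> const_tuple dim t \<and> X (t ! 0) x y"
| "net Q X C G (TC k i, t) (TC k' j, t') \<longleftrightarrow> k = k' \<and> t = t' \<and> take (k choose 2) t \<in> Q k \<and> (i, j) \<in> C k t"
| "net Q X C G (TG k p u, t) (TG k' p' v, t') \<longleftrightarrow>
     k = k' \<and> p = p' \<and> t = t' \<and> take (k choose 2) t \<in> Q k \<and> (u, v) \<in> G k p t"
| "net Q X C G (TG k p u, t) (TV y, t') \<longleftrightarrow> take (k choose 2) t \<in> Q k \<and> const_tuple dim t' \<and>
     t' ! 0 = t ! p \<and> (u, if y then b else a) \<in> G k p t"
| "net Q X C G (TV y, t') (TG k p u, t) \<longleftrightarrow> take (k choose 2) t \<in> Q k \<and> const_tuple dim t' \<and>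
     t' ! 0 = t ! p \<and> (if y then b else a, u) \<in> G k p t"
| "net Q X C G (TG k p u, t) (TC k' i, t') \<longleftrightarrow> k = k' \<and> t = t' \<and> take (k choose 2) t \<in> Q k \<and>
     (i = fst (pairs k ! p) \<and> (u, r) \<in> G k p t \<or> i = snd (pairs k ! p) \<and> (u, s) \<in> G k p t)"
| "net Q X C G (TC k' i, t') (TG k p u, t) \<longleftrightarrow> k = k' \<and> t = t' \<and> take (k choose 2) t \<in> Q k \<and>
     (i = fst (pairs k ! p) \<and> (r, u) \<in> G k p t \<or> i = snd (pairs k ! p) \<and> (s, u) \<in> G k p t)"
| "net Q X C G (TV x, t) (TC k i, t') \<longleftrightarrow> False"
| "net Q X C G (TC k i, t) (TV x, t') \<longleftrightarrow> False"

definition port :: "nat \<Rightarrow> nat \<Rightarrow> nat list \<Rightarrow> nat \<Rightarrow> vertex" where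
  "port k p t u = (if u = a then (TV False, replicate dim (t ! p)) else if u = b then (TV True, replicate dim (t ! p))
     else if u = r then (TC k (fst (pairs k ! p)), t) else if u = s then (TC k (snd (pairs k ! p)), t)
     else (TG k p u, t))"

definition tagset :: "tag set" where
  "tagset = range TV \<union> (\<lambda>(k, i). TC k i) ` (SIGMA k:{2..m}. {1..k}) \<union>
     (\<lambda>(k, p, u). TG k p u) ` (SIGMA k:{2..m}. {..<k choose 2} \<times> (W - {a, b, r, s}))"

definition vset :: "nat \<Rightarrow> vertex set" where
  "vset n = tagset \<times> set (tuples n dim)"

definition netrel where
  "netrel n Q X C G = {(x, y). x \<in> vset n \<and> y \<in> vset n \<and> net Q X C G x y}"

definition X0 :: "nat list set \<Rightarrow> nat list set \<Rightarrow> nat \<Rightarrow> bool \<Rightarrow> bool \<Rightarrow> bool" where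
  "X0 Z0 Z1 x y y' = (if y = y' then \<not> y \<and> [x] \<in> Z0 \<and> [x] \<in> Z1 else if y' then [x] \<notin> Z0 else [x] \<notin> Z1)"

abbreviation "C0 \<equiv> \<lambda>(k :: nat) (t :: nat list). {(i :: nat, j). i \<noteq> j}"
abbreviation "G0 \<equiv> \<lambda>(k :: nat) (p :: nat) (t :: nat list). \<Gamma>"

lemma W: "finite W" "\<Gamma> \<subseteq> W \<times> W" "(a, b) \<in> \<Gamma>" "(b, a) \<in> \<Gamma>" "(r, s) \<in> \<Gamma>" "(s, r) \<in> \<Gamma>"
    "distinct [a, b, r, s]" "\<Gamma> \<inter> ({a, b} \<times> {r, s} \<union> {r, s} \<times> {a, b}) = {}"
  using gadget unfolding equality_def by simp_all

lemma equality_iff: "solves F W \<Gamma> R \<Longrightarrow> (a, b) \<in> R \<longleftrightarrow> (r, s) \<in> R"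
  using gadget unfolding equality_def by simp

lemma \<Gamma>_irrefl: "(u, u) \<notin> \<Gamma>"
proof -
  obtain R where "solves F W \<Gamma> R" using gadget unfolding equality_def by (elim conjE exE)
  then show ?thesis unfolding solves_def asym_iff_all by blast
qed

lemma finite_tagset: "finite tagset"
proof -
  have "finite (SIGMA k:{2..m}. {..<k choose 2} \<times> (W - {a, b, r, s}))"
    using W(1) by (intro finite_SigmaI finite_cartesian_product) auto
  moreover have "finite (SIGMA k:{2..m}. {1..k})" by (intro finite_SigmaI) auto
  ultimately show ?thesis unfolding tagset_def by simp
qed

lemma tagset_iff:
  "TV x \<in> tagset" "TC k i \<in> tagset \<longleftrightarrow> k \<in> {2..m} \<and> i \<in> {1..k}"
  "TG k p u \<in> tagset \<longleftrightarrow> k \<in> {2..m} \<and> p < k choose 2 \<and> u \<in> W - {a, b, r, s}"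
  unfolding tagset_def by (auto simp: image_iff)

lemma pairs_bounds:
  assumes "p < k choose 2"
  shows "1 \<le> fst (pairs k ! p)" "fst (pairs k ! p) < snd (pairs k ! p)" "snd (pairs k ! p) \<le> k"
  using pairs_nth[of p k "fst (pairs k ! p)" "snd (pairs k ! p)"] assms by (simp_all add: length_pairs)

lemma port_vset:
  assumes "k \<in> {2..m}" "p < k choose 2" "t \<in> set (tuples n dim)" "u \<in> W"
  shows "port k p t u \<in> vset n"
proof -
  have t: "length t = dim" "set t \<subseteq> {..<n}" using assms(3) by (simp_all add: set_tuples)
  have "k choose 2 < dim" using assms(1) choose_less_dim by simp
  then have "t ! p \<in> set t" using t(1) assms(2) by simp
  then have "t ! p < n" using t(2) by blast
  then have "replicate dim (t ! p) \<in> set (tuples n dim)" by (simp add: set_tuples set_replicate_conv_if)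
  then show ?thesis using assms pairs_bounds[OF assms(2)] by (simp add: port_def vset_def tagset_iff)
qed

lemma inj_port: "p < k choose 2 \<Longrightarrow> inj_on (port k p t) W"
  using W(7) pairs_bounds(2)[of p k] by (intro inj_onI) (simp add: port_def split: if_splits)

lemma net_port:
  assumes p: "p < k choose 2" and Q: "take (k choose 2) t \<in> Q k" and sub: "G k p t \<subseteq> \<Gamma>"
  shows "u \<in> {a, b} \<Longrightarrow> v \<in> {a, b} \<Longrightarrow>
      net Q X C G (port k p t u) (port k p t v) \<longleftrightarrow> X (t ! p) (u = b) (v = b)"
    and "net Q X C G (port k p t r) (port k p t s) \<longleftrightarrow> (fst (pairs k ! p), snd (pairs k ! p)) \<in> C k t"
    and "net Q X C G (port k p t s) (port k p t r) \<longleftrightarrow> (snd (pairs k ! p), fst (pairs k ! p)) \<in> C k t"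
    and "net Q X C G (port k p t r) (port k p t r) \<longleftrightarrow> (fst (pairs k ! p), fst (pairs k ! p)) \<in> C k t"
    and "net Q X C G (port k p t s) (port k p t s) \<longleftrightarrow> (snd (pairs k ! p), snd (pairs k ! p)) \<in> C k t"
    and "u \<notin> {a, b} \<or> v \<notin> {a, b} \<Longrightarrow> u \<notin> {r, s} \<or> v \<notin> {r, s} \<Longrightarrow>
      net Q X C G (port k p t u) (port k p t v) \<longleftrightarrow> (u, v) \<in> G k p t"
proof -
  have d0: "replicate dim x ! 0 = x" for x :: nat using dim_pos by simp
  have ne: "a \<noteq> b" "a \<noteq> r" "a \<noteq> s" "b \<noteq> r" "b \<noteq> s" "r \<noteq> s"
    "b \<noteq> a" "r \<noteq> a" "s \<noteq> a" "r \<noteq> b" "s \<noteq> b" "s \<noteq> r" using W(7) by auto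
  have P: "fst (pairs k ! p) \<noteq> snd (pairs k ! p)" "snd (pairs k ! p) \<noteq> fst (pairs k ! p)"
    using pairs_bounds(2)[OF p] by simp_all
  note simps = port_def d0 const_replicate ne P Q
  show "u \<in> {a, b} \<Longrightarrow> v \<in> {a, b} \<Longrightarrow>
      net Q X C G (port k p t u) (port k p t v) \<longleftrightarrow> X (t ! p) (u = b) (v = b)"
    by (elim insertE emptyE) (simp_all add: simps)
  show "net Q X C G (port k p t r) (port k p t s) \<longleftrightarrow> (fst (pairs k ! p), snd (pairs k ! p)) \<in> C k t"
    "net Q X C G (port k p t s) (port k p t r) \<longleftrightarrow> (snd (pairs k ! p), fst (pairs k ! p)) \<in> C k t"
    "net Q X C G (port k p t r) (port k p t r) \<longleftrightarrow> (fst (pairs k ! p), fst (pairs k ! p)) \<in> C k t"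
    "net Q X C G (port k p t s) (port k p t s) \<longleftrightarrow> (snd (pairs k ! p), snd (pairs k ! p)) \<in> C k t"
    by (simp_all add: simps)
  have no: "(c, e) \<notin> G k p t" "(e, c) \<notin> G k p t" if "c \<in> {a, b}" "e \<in> {r, s}" for c e
    using sub W(8) that by blast+
  note no' = no[of a r] no[of a s] no[of b r] no[of b s]
  assume uv: "u \<notin> {a, b} \<or> v \<notin> {a, b}" "u \<notin> {r, s} \<or> v \<notin> {r, s}"
  consider "u = a" | "u = b" | "u = r" | "u = s" | "u \<noteq> a" "u \<noteq> b" "u \<noteq> r" "u \<noteq> s" by blast
  then show "net Q X C G (port k p t u) (port k p t v) \<longleftrightarrow> (u, v) \<in> G k p t"
  proof cases
    case 1
    then consider "v = r" | "v = s" | "v \<noteq> a" "v \<noteq> b" "v \<noteq> r" "v \<noteq> s" using uv by auto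
    then show ?thesis by cases (use 1 no' in \<open>simp_all add: simps\<close>)
  next
    case 2
    then consider "v = r" | "v = s" | "v \<noteq> a" "v \<noteq> b" "v \<noteq> r" "v \<noteq> s" using uv by auto
    then show ?thesis by cases (use 2 no' in \<open>simp_all add: simps\<close>)
  next
    case 3
    then consider "v = a" | "v = b" | "v \<noteq> a" "v \<noteq> b" "v \<noteq> r" "v \<noteq> s" using uv by auto
    then show ?thesis by cases (use 3 no' in \<open>simp_all add: simps\<close>)
  next
    case 4
    then consider "v = a" | "v = b" | "v \<noteq> a" "v \<noteq> b" "v \<noteq> r" "v \<noteq> s" using uv by auto
    then show ?thesis by cases (use 4 no' in \<open>simp_all add: simps\<close>)
  next
    case 5
    consider "v = a" | "v = b" | "v = r" | "v = s" | "v \<noteq> a" "v \<noteq> b" "v \<noteq> r" "v \<noteq> s" by blast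
    then show ?thesis by cases (use 5 in \<open>simp_all add: simps\<close>)
  qed
qed

lemma net_port_neighbour:
  assumes y: "y \<in> vset n" and adj: "net Q X C G (TG k p u, t) y \<or> net Q X C G y (TG k p u, t)"
    and G: "G k p t \<subseteq> \<Gamma>"
  shows "y \<in> port k p t ` W"
proof -
  have ports: "a \<in> W" "b \<in> W" "r \<in> W" "s \<in> W" using W(2-6) by auto
  have ne: "a \<noteq> b" "a \<noteq> r" "a \<noteq> s" "b \<noteq> r" "b \<noteq> s" "r \<noteq> s"
    "b \<noteq> a" "r \<noteq> a" "s \<noteq> a" "r \<noteq> b" "s \<noteq> b" "s \<noteq> r" using W(7) by auto
  obtain c t' where y': "y = (c, t')" by (cases y)
  have t': "length t' = dim" using y by (simp add: y' vset_def set_tuples)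
  show ?thesis
  proof (cases c)
    case (TV z)
    then have "const_tuple dim t'" "t' ! 0 = t ! p" using adj by (auto simp: y')
    then have "t' = replicate dim (t ! p)" using const_tupleD[OF _ t'] by simp
    then have "y = port k p t (if z then b else a)" using TV ne by (simp add: y' port_def)
    then show ?thesis using ports by simp
  next
    case (TC k' i)
    then have "k' = k" "t' = t" "i = fst (pairs k ! p) \<or> i = snd (pairs k ! p)" using adj by (auto simp: y')
    then have "y = port k p t r \<or> y = port k p t s" using TC ne by (auto simp: y' port_def)
    then show ?thesis using ports by auto
  next
    case (TG k' p' v)
    then have eq: "k' = k" "p' = p" "t' = t" using adj by (auto simp: y')
    have v: "v \<in> W" "v \<noteq> a" "v \<noteq> b" "v \<noteq> r" "v \<noteq> s" using y TG by (simp_all add: y' vset_def tagset_iff)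
    then have "y = port k p t v" using TG eq by (simp add: y' port_def)
    then show ?thesis using v(1) by simp
  qed
qed

context
  fixes n :: nat and Q :: "nat \<Rightarrow> nat list set" and Z0 Z1 :: "nat list set"
  assumes Q: "\<And>k t. k \<in> {2..m} \<Longrightarrow> t \<in> Q k \<Longrightarrow> length t = k choose 2 \<and> set t \<subseteq> {..<n}"
    and Z0: "\<And>t. t \<in> Z0 \<Longrightarrow> length t = 1 \<and> set t \<subseteq> {..<n}"
    and Z1: "\<And>t. t \<in> Z1 \<Longrightarrow> length t = 1 \<and> set t \<subseteq> {..<n}"
begin

abbreviation "N0 \<equiv> netrel n Q (X0 Z0 Z1) C0 G0"

lemma hom_of_solves:
  assumes R: "solves F (vset n) N0 R"
  shows "\<exists>h. homomorphism h ({..<n}, map Q [2..<Suc m] @ [Z0, Z1]) (B01 F)"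
proof -
  have sub: "R \<subseteq> N0" and cov: "N0 \<subseteq> R \<union> R\<inverse>" and asym: "asym R" and free: "free_of F (vset n, R)"
    using R by (simp_all add: solves_def)
  have as: "(y, x) \<notin> R" if "(x, y) \<in> R" for x y using asym that unfolding asym_iff_all by blast
  have RN: "net Q (X0 Z0 Z1) C0 G0 x y" if "(x, y) \<in> R" for x y using that sub unfolding netrel_def by blast
  have NR: "(x, y) \<in> R \<or> (y, x) \<in> R" if "x \<in> vset n" "y \<in> vset n" "net Q (X0 Z0 Z1) C0 G0 x y" for x y
  proof -
    have "(x, y) \<in> N0" using that by (simp add: netrel_def)
    then show ?thesis using cov by blast
  qed
  define V where "V y x = (TV y, replicate dim x)" for y and x :: nat
  have d0: "replicate dim x ! 0 = x" for x :: nat using dim_pos by simp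
  have netV: "net Q (X0 Z0 Z1) C0 G0 (V y x) (V y' x) \<longleftrightarrow> X0 Z0 Z1 x y y'" for x y y'
    by (simp add: V_def const_replicate d0)
  have Vin: "V y x \<in> vset n" if "x < n" for y x using that 
    by (simp add: V_def vset_def tagset_iff set_tuples set_replicate_conv_if)
  have ok: "\<not> ([x] \<in> Z0 \<and> [x] \<in> Z1)" if "x < n" for x
  proof
    assume "[x] \<in> Z0 \<and> [x] \<in> Z1"
    then have "net Q (X0 Z0 Z1) C0 G0 (V False x) (V False x)" by (simp add: netV X0_def)
    then show False using NR[OF Vin Vin] that as by blast
  qed
  define h where "h x = (if (V False x, V True x) \<in> R then 1 else (0 :: nat))" for x
  have "map h t0 \<in> P_rel F k" if k: "k \<in> {2..m}" and t0: "t0 \<in> Q k" for k t0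
  proof -
    have len: "length t0 = k choose 2" and t0n: "set t0 \<subseteq> {..<n}" using Q[OF k t0] by auto
    have "2 \<le> k" using k by simp
    then have "k choose 2 > 0" by simp
    then have "t0 ! 0 \<in> set t0" using len by simp
    then have t00: "t0 ! 0 < n" using t0n by blast
    define t where "t = t0 @ replicate (dim - (k choose 2)) (t0 ! 0)"
    have t: "take (k choose 2) t \<in> Q k" "t \<in> set (tuples n dim)"
      using len t0 t0n t00 choose_less_dim[of k] k by (auto simp: t_def set_tuples)
    have tp: "t ! p = t0 ! p" if "p < k choose 2" for p using that len by (simp add: t_def nth_append)
    define cl where "cl i = (TC k i, t)" for i
    have clV: "cl i \<in> vset n" if "i \<in> {1..k}" for i using that k t(2) by (simp add: cl_def vset_def tagset_iff)
    have clN: "net Q (X0 Z0 Z1) C0 G0 (cl i) (cl j) \<longleftrightarrow> i \<noteq> j" for i j using t(1) by (simp add: cl_def)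
    have inj: "inj_on cl {1..k}" by (rule inj_onI) (simp add: cl_def)
    define E' where "E' = pull cl {1..k} R"
    have E': "tournament ({1..k}, E')"
      unfolding tournament_iff asym_iff_all
    proof (intro conjI allI impI ballI)
      show "E' \<subseteq> {1..k} \<times> {1..k}" by (auto simp: E'_def pull_def)
      show "(j, i) \<notin> E'" if "(i, j) \<in> E'" for i j using that as by (simp add: E'_def pull_def)
      fix i j assume "i \<in> {1..k}" "j \<in> {1..k}" "i \<noteq> j"
      then show "(i, j) \<in> E' \<or> (j, i) \<in> E'" using NR[OF clV clV] clN by (simp add: E'_def pull_def)
    qed
    have free': "free_of F ({1..k}, E')"
      unfolding E'_def by (rule free_of_embeds[OF embeds_pull[OF inj] free]) (use clV in blast)
    have gad: "h (t0 ! p) = 1 \<longleftrightarrow> (fst (pairs k ! p), snd (pairs k ! p)) \<in> E'" if p: "p < k choose 2" for p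
    proof -
      let ?g = "port k p t"
      note np = net_port[OF p, of t Q G0, OF t(1) order_refl]
      have x: "t ! p < n"
      proof -
        have "t0 ! p \<in> set t0" using p len by simp
        then show ?thesis using t0n tp[OF p] by auto
      qed
      have gV: "?g u \<in> vset n" if "u \<in> W" for u using port_vset[OF k p t(2) that] .
      have ports: "a \<in> W" "b \<in> W" "r \<in> W" "s \<in> W" using W(2-6) by auto
      have ne: "a \<noteq> b" "b \<noteq> a" "r \<noteq> s" "s \<noteq> r" using W(7) by auto
      have P: "fst (pairs k ! p) \<noteq> snd (pairs k ! p)" "snd (pairs k ! p) \<noteq> fst (pairs k ! p)"
        using pairs_bounds(2)[OF p] by simp_all
      have "solves F W \<Gamma> (pull ?g W R)"
        unfolding solves_def
      proof (intro conjI)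
        show "asym (pull ?g W R)" unfolding asym_iff_all using as by (simp add: pull_def)
        show "free_of F (W, pull ?g W R)"
          by (rule free_of_embeds[OF embeds_pull[OF inj_port[OF p]] free]) (use gV in blast)
        show "pull ?g W R \<subseteq> \<Gamma>"
        proof (rule subrelI)
          fix u v assume "(u, v) \<in> pull ?g W R"
          then have nt: "net Q (X0 Z0 Z1) C0 G0 (?g u) (?g v)" using RN by (simp add: pull_def)
          consider "u \<in> {a, b}" "v \<in> {a, b}" | "u \<in> {r, s}" "v \<in> {r, s}"
            | "u \<notin> {a, b} \<or> v \<notin> {a, b}" "u \<notin> {r, s} \<or> v \<notin> {r, s}" by blast
          then show "(u, v) \<in> \<Gamma>"
          proof cases
            case 1
            then have "X0 Z0 Z1 (t ! p) (u = b) (v = b)" using nt np(1)[OF 1] by simp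
            then have "(u = b) \<noteq> (v = b)"
              using ok[OF x] by (cases "u = b"; cases "v = b") (simp_all add: X0_def)
            then show ?thesis using 1 W(3,4) by auto
          next
            case 2
            then have "u \<noteq> v" using nt np(4,5) by auto
            then show ?thesis using 2 W(5,6) by auto
          next
            case 3
            then show ?thesis using nt np(6)[OF 3] by simp
          qed
        qed
        show "\<Gamma> \<subseteq> pull ?g W R \<union> (pull ?g W R)\<inverse>"
        proof (rule subrelI)
          fix u v assume uv: "(u, v) \<in> \<Gamma>"
          then have uvW: "u \<in> W" "v \<in> W" using W(2) by auto
          have "u \<noteq> v" using uv \<Gamma>_irrefl by blast
          have "net Q (X0 Z0 Z1) C0 G0 (?g u) (?g v) \<or> net Q (X0 Z0 Z1) C0 G0 (?g v) (?g u)"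
          proof -
            consider "u \<in> {a, b}" "v \<in> {a, b}" | "u \<in> {r, s}" "v \<in> {r, s}"
              | "u \<notin> {a, b} \<or> v \<notin> {a, b}" "u \<notin> {r, s} \<or> v \<notin> {r, s}" by blast
            then show ?thesis
            proof cases
              case 1
              then have "(u = b) \<noteq> (v = b)" using \<open>u \<noteq> v\<close> by auto
              then show ?thesis using np(1)[OF 1] np(1)[OF 1(2,1)] ok[OF x] by (auto simp: X0_def)
            next
              case 2
              then show ?thesis using np(2,3) P \<open>u \<noteq> v\<close> by auto
            next
              case 3
              then show ?thesis using np(6)[OF 3] uv by simp
            qed
          qed
          then have "(?g u, ?g v) \<in> R \<or> (?g v, ?g u) \<in> R" using NR gV uvW by blast
          then show "(u, v) \<in> pull ?g W R \<union> (pull ?g W R)\<inverse>" using uvW by (auto simp: pull_def)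
        qed
      qed
      from equality_iff[OF this] have "(?g a, ?g b) \<in> R \<longleftrightarrow> (?g r, ?g s) \<in> R" using ports by (simp add: pull_def)
      moreover have "?g a = V False (t0 ! p)" "?g b = V True (t0 ! p)"
        using ne tp[OF p] by (simp_all add: port_def V_def)
      moreover have "?g r = cl (fst (pairs k ! p))" "?g s = cl (snd (pairs k ! p))"
        using W(7) by (auto simp: port_def cl_def)
      moreover have "fst (pairs k ! p) \<in> {1..k}" "snd (pairs k ! p) \<in> {1..k}"
        using pairs_bounds[OF p] by auto
      ultimately show ?thesis by (simp add: h_def E'_def pull_def case_prod_unfold)
    qed
    have "decode_tournament k (map h t0) = E'"
    proof (rule tournament_ext[OF decode_tournament_tournament E'])
      fix i j assume "1 \<le> i" "i < j" "j \<le> k"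
      then obtain p where p: "p < length (pairs k)" "pairs k ! p = (i, j)" using pairs_ex by blast
      then have pk: "p < k choose 2" by (simp add: length_pairs)
      show "(i, j) \<in> decode_tournament k (map h t0) \<longleftrightarrow> (i, j) \<in> E'"
        using gad[OF pk] p pk len by (simp add: decode_tournament_nth(1)[OF p])
    qed
    then show ?thesis using P_rel_iff[of "map h t0" k F] free' len by (auto simp: h_def)
  qed
  moreover have "map h t = [0]" if t: "t \<in> Z0" for t
  proof -
    obtain x where x: "t = [x]" "x < n" using Z0[OF t] by (auto simp: length_Suc_conv)
    have "\<not> net Q (X0 Z0 Z1) C0 G0 (V False x) (V True x)" using t x by (simp add: netV X0_def)
    then have "(V False x, V True x) \<notin> R" using RN[of "V False x" "V True x"] by blast
    then show ?thesis using x by (simp add: h_def)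
  qed
  moreover have "map h t = [1]" if t: "t \<in> Z1" for t
  proof -
    obtain x where x: "t = [x]" "x < n" using Z1[OF t] by (auto simp: length_Suc_conv)
    have "\<not> net Q (X0 Z0 Z1) C0 G0 (V True x) (V False x)" using t x by (simp add: netV X0_def)
    moreover have "net Q (X0 Z0 Z1) C0 G0 (V False x) (V True x)" using ok[OF x(2)] t x by (simp add: netV X0_def)
    ultimately have "(V False x, V True x) \<in> R"
      using RN[of "V True x" "V False x"] NR[OF Vin[OF x(2)] Vin[OF x(2)], of False True] by blast
    then show ?thesis using x by (simp add: h_def)
  qed
  moreover have "h ` {..<n} \<subseteq> {0, 1}" by (auto simp: h_def)
  ultimately show ?thesis unfolding hom_B01 by (intro exI[of _ h] conjI ballI) (blast | simp)+
qed

end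

end

context gadget
begin

context
  fixes n :: nat and Q :: "nat \<Rightarrow> nat list set" and Z0 Z1 :: "nat list set" and h :: "nat \<Rightarrow> nat"
  assumes Q: "\<And>k t. k \<in> {2..m} \<Longrightarrow> t \<in> Q k \<Longrightarrow> length t = k choose 2 \<and> set t \<subseteq> {..<n}"
    and hom: "homomorphism h ({..<n}, map Q [2..<Suc m] @ [Z0, Z1]) (B01 F)"
begin

lemma hom_values: "x < n \<Longrightarrow> h x = 0 \<or> h x = 1"
  using hom[unfolded hom_B01] by blast

lemma hom_P: "k \<in> {2..m} \<Longrightarrow> t \<in> Q k \<Longrightarrow> map h t \<in> P_rel F k"
  using bspec[OF bspec[OF conjunct1[OF conjunct2[OF hom[unfolded hom_B01]]]]] .

lemma hom_Z: "[x] \<in> Z0 \<Longrightarrow> h x = 0" "[x] \<in> Z1 \<Longrightarrow> h x = 1"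
  using bspec[OF conjunct1[OF conjunct2[OF conjunct2[OF hom[unfolded hom_B01]]]], of "[x]"]
    bspec[OF conjunct2[OF conjunct2[OF conjunct2[OF hom[unfolded hom_B01]]]], of "[x]"] by simp_all

definition Sol :: "bool \<Rightarrow> nat rel" where
  "Sol c = (SOME R. solves F W \<Gamma> R \<and> ((a, b) \<in> R \<longleftrightarrow> c))"

lemma Sol: "solves F W \<Gamma> (Sol c)" "(a, b) \<in> Sol c \<longleftrightarrow> c"
proof -
  have "\<exists>R. solves F W \<Gamma> R \<and> (a, b) \<in> R" "\<exists>R. solves F W \<Gamma> R \<and> (b, a) \<in> R"
    using gadget unfolding equality_def by blast+
  then have "\<exists>R. solves F W \<Gamma> R \<and> ((a, b) \<in> R \<longleftrightarrow> c)"
  proof (cases c)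
    case False
    obtain R where R: "solves F W \<Gamma> R" "(b, a) \<in> R" using \<open>\<exists>R. solves F W \<Gamma> R \<and> (b, a) \<in> R\<close> by blast
    then have "(a, b) \<notin> R" using solves_flip[OF R(1) W(3)] by simp
    then show ?thesis using R(1) False by blast
  qed simp
  then have "solves F W \<Gamma> (Sol c) \<and> ((a, b) \<in> Sol c \<longleftrightarrow> c)" unfolding Sol_def by (rule someI_ex)
  then show "solves F W \<Gamma> (Sol c)" "(a, b) \<in> Sol c \<longleftrightarrow> c" by simp_all
qed

lemma Sol_sub: "Sol c \<subseteq> \<Gamma>" and Sol_cov: "\<Gamma> \<subseteq> Sol c \<union> (Sol c)\<inverse>" and Sol_free: "free_of F (W, Sol c)"
  using Sol(1)[of c] by (simp_all add: solves_def)

lemma Sol_asym: "(u, v) \<in> Sol c \<Longrightarrow> (v, u) \<notin> Sol c"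
  using Sol(1)[of c] unfolding solves_def asym_iff_all by blast

lemma Sol_cover: "(u, v) \<in> \<Gamma> \<Longrightarrow> (u, v) \<in> Sol c \<or> (v, u) \<in> Sol c"
  using Sol_cov by blast

lemma Sol_ports: "(b, a) \<in> Sol c \<longleftrightarrow> \<not> c" "(r, s) \<in> Sol c \<longleftrightarrow> c" "(s, r) \<in> Sol c \<longleftrightarrow> \<not> c"
  using Sol(2)[of c] equality_iff[OF Sol(1)[of c]] solves_flip[OF Sol(1)[of c] W(3)]
    solves_flip[OF Sol(1)[of c] W(5)] by simp_all

definition X1 :: "nat \<Rightarrow> bool \<Rightarrow> bool \<Rightarrow> bool" where
  "X1 x y y' \<longleftrightarrow> y \<noteq> y' \<and> (y' \<longleftrightarrow> h x = 1)"

definition C1 :: "nat \<Rightarrow> nat list \<Rightarrow> nat rel" where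
  "C1 k t = decode_tournament k (map h (take (k choose 2) t))"

definition G1 :: "nat \<Rightarrow> nat \<Rightarrow> nat list \<Rightarrow> nat rel" where
  "G1 k p t = Sol (h (t ! p) = 1)"

abbreviation "net0 \<equiv> net Q (X0 Z0 Z1) C0 G0"
abbreviation "net1 \<equiv> net Q X1 C1 G1"
abbreviation "N1 \<equiv> netrel n Q X1 C1 G1"

lemma C1: "tournament ({1..k}, C1 k t)"
  unfolding C1_def by (rule decode_tournament_tournament)

lemma C1_asym: "(i, j) \<in> C1 k t \<Longrightarrow> (j, i) \<notin> C1 k t"
  using C1[of k t] unfolding tournament_iff asym_iff_all by blast

lemma C1_free:
  assumes "k \<in> {2..m}" "take (k choose 2) t \<in> Q k"
  shows "free_of F ({1..k}, C1 k t)"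
proof -
  have len: "length (take (k choose 2) t) = k choose 2" and sub: "set (take (k choose 2) t) \<subseteq> {..<n}"
    using Q[OF assms] by auto
  have "set (map h (take (k choose 2) t)) \<subseteq> {0, 1}"
  proof
    fix y assume "y \<in> set (map h (take (k choose 2) t))"
    then obtain x where "x \<in> set (take (k choose 2) t)" "y = h x" unfolding set_map by blast
    moreover from this have "x < n" using sub by blast
    ultimately show "y \<in> {0, 1}" using hom_values[of x] by simp
  qed
  with len show ?thesis
    unfolding C1_def using P_rel_iff[of "map h (take (k choose 2) t)" k F] hom_P[OF assms] by simp
qed

lemma net1_net0:
  assumes "x \<in> vset n" "net1 x y"
  shows "net0 x y"
proof -
  have X: "X0 Z0 Z1 x y y'" if "X1 x y y'" for x y y'
    using that hom_Z[of x] by (auto simp: X0_def X1_def)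
  have C: "i \<noteq> j" if "(i, j) \<in> C1 k t" for i j k t using C1_asym that by blast
  have G: "(u, v) \<in> \<Gamma>" if "(u, v) \<in> G1 k p t" for u v k p t using Sol_sub that unfolding G1_def by blast
  obtain c t c' t' where xy: "x = (c, t)" "y = (c', t')" by (cases x, cases y)
  show ?thesis
    using assms(2) unfolding xy by (cases c; cases c') (auto dest: X C G)
qed

lemma net0_net1:
  assumes "x \<in> vset n" "y \<in> vset n" "net0 x y"
  shows "net1 x y \<or> net1 y x"
proof -
  have X: "X1 x y y' \<or> X1 x y' y" if "X0 Z0 Z1 x y y'" for x y y'
    using that hom_Z[of x] by (cases "y = y'") (auto simp: X0_def X1_def)
  have C: "(i, j) \<in> C1 k t \<or> (j, i) \<in> C1 k t" if "i \<noteq> j" "i \<in> {1..k}" "j \<in> {1..k}" for i j k t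
    using C1[of k t] that unfolding tournament_iff by blast
  have G: "(u, v) \<in> G1 k p t \<or> (v, u) \<in> G1 k p t" if "(u, v) \<in> \<Gamma>" for u v k p t
    unfolding G1_def using Sol_cover[OF that] .
  obtain c t c' t' where xy: "x = (c, t)" "y = (c', t')" by (cases x, cases y)
  have V: "c \<in> tagset" "c' \<in> tagset" using assms(1,2) by (simp_all add: xy vset_def)
  show ?thesis
  proof (cases c; cases c')
    fix z z' assume c: "c = TV z" "c' = TV z'"
    then show ?thesis using assms(3) X[of "t ! 0" z z'] by (auto simp: xy)
  next
    fix z k i assume c: "c = TV z" "c' = TC k i"
    then show ?thesis using assms(3) by (simp add: xy)
  next
    fix z k p u assume c: "c = TV z" "c' = TG k p u"
    then show ?thesis using assms(3) G[of "if z then b else a" u k p t'] by (simp add: xy del: split_paired_All; argo)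
  next
    fix k i z assume c: "c = TC k i" "c' = TV z"
    then show ?thesis using assms(3) by (simp add: xy)
  next
    fix k i k' j assume c: "c = TC k i" "c' = TC k' j"
    then show ?thesis using assms(3) V C[of i j k t] by (auto simp: xy tagset_iff)
  next
    fix k i k' p u assume c: "c = TC k i" "c' = TG k' p u"
    then show ?thesis using assms(3) G[of r u k p t] G[of s u k p t] by (auto simp: xy)
  next
    fix k p u z assume c: "c = TG k p u" "c' = TV z"
    then show ?thesis using assms(3) G[of u "if z then b else a" k p t] by (simp add: xy del: split_paired_All; argo)
  next
    fix k p u k' i assume c: "c = TG k p u" "c' = TC k' i"
    then show ?thesis using assms(3) G[of u r k p t] G[of u s k p t] by (auto simp: xy)
  next
    fix k p u k' p' v assume c: "c = TG k p u" "c' = TG k' p' v"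
    then show ?thesis using assms(3) G[of u v k p t] by (auto simp: xy)
  qed
qed

lemma net1_asym:
  assumes "x \<in> vset n" "y \<in> vset n" "net1 x y"
  shows "\<not> net1 y x"
proof -
  have G: "(v, u) \<notin> G1 k p t" if "(u, v) \<in> G1 k p t" for u v k p t
    using Sol_asym that unfolding G1_def .
  obtain c t c' t' where xy: "x = (c, t)" "y = (c', t')" by (cases x, cases y)
  have V: "c \<in> tagset" "c' \<in> tagset" using assms(1,2) by (simp_all add: xy vset_def)
  have P: "fst (pairs k ! p) \<noteq> snd (pairs k ! p)" if "TG k p u \<in> tagset" for k p u
    using that pairs_bounds(2)[of p k] by (simp add: tagset_iff)
  show ?thesis
    using assms(3) V unfolding xy
    by (cases c; cases c') (auto dest: C1_asym G P simp: X1_def split: if_splits)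
qed

lemma pull_port:
  assumes k: "k \<in> {2..m}" and p: "p < k choose 2" and t: "t \<in> set (tuples n dim)" "take (k choose 2) t \<in> Q k"
  shows "pull (port k p t) W N1 = G1 k p t"
proof -
  have G1s: "G1 k p t \<subseteq> \<Gamma>" unfolding G1_def by (rule Sol_sub)
  note np = net_port[where Q = Q and X = X1 and C = C1 and G = G1 and k = k and p = p and t = t, OF p t(2) G1s]
  have len: "length (take (k choose 2) t) = k choose 2" using Q[OF k t(2)] by simp
  have pp: "p < length (pairs k)" "pairs k ! p = (fst (pairs k ! p), snd (pairs k ! p))"
    using p by (simp_all add: length_pairs)
  have hp: "map h (take (k choose 2) t) ! p = h (t ! p)" using p len by simp
  have C: "(fst (pairs k ! p), snd (pairs k ! p)) \<in> C1 k t \<longleftrightarrow> h (t ! p) = 1"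
    "(snd (pairs k ! p), fst (pairs k ! p)) \<in> C1 k t \<longleftrightarrow> h (t ! p) \<noteq> 1"
    unfolding C1_def using decode_tournament_nth[OF pp, of "map h (take (k choose 2) t)"] hp by simp_all
  have Cl: "(i, i) \<notin> C1 k t" for i using C1_asym by blast
  have ports: "(a, b) \<in> G1 k p t \<longleftrightarrow> h (t ! p) = 1" "(b, a) \<in> G1 k p t \<longleftrightarrow> h (t ! p) \<noteq> 1"
    "(r, s) \<in> G1 k p t \<longleftrightarrow> h (t ! p) = 1" "(s, r) \<in> G1 k p t \<longleftrightarrow> h (t ! p) \<noteq> 1"
    unfolding G1_def using Sol(2) Sol_ports by simp_all
  have loop: "(u, u) \<notin> G1 k p t" for u unfolding G1_def using Sol_asym by blast
  have ne: "a \<noteq> b" using W(7) by simp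
  have "net1 (port k p t u) (port k p t v) \<longleftrightarrow> (u, v) \<in> G1 k p t" for u v
  proof -
    consider "u \<in> {a, b}" "v \<in> {a, b}" | "u \<in> {r, s}" "v \<in> {r, s}"
      | "u \<notin> {a, b} \<or> v \<notin> {a, b}" "u \<notin> {r, s} \<or> v \<notin> {r, s}" by blast
    then show ?thesis
    proof cases
      case 1
      then show ?thesis using np(1)[OF 1] ports loop ne by (auto simp: X1_def)
    next
      case 2
      then show ?thesis using np(2-5) ports loop C Cl by auto
    next
      case 3
      then show ?thesis by (rule np(6))
    qed
  qed
  moreover have "u \<in> W \<and> v \<in> W" if "(u, v) \<in> G1 k p t" for u v
    using that Sol_sub W(2) unfolding G1_def by blast
  ultimately have "(u, v) \<in> pull (port k p t) W N1 \<longleftrightarrow> (u, v) \<in> G1 k p t" for u v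
    using port_vset[OF k p t(1)] by (auto simp: pull_def netrel_def)
  then show ?thesis by auto
qed

lemma free_block:
  assumes "inj_on g V" "free_of F (V, pull g V R)"
  shows "free_of F (g ` V, R \<inter> g ` V \<times> g ` V)"
proof -
  have bij: "bij_betw g V (g ` V)" using assms(1) by (simp add: bij_betw_def)
  have "pull g V (R \<inter> g ` V \<times> g ` V) = pull g V R" by (auto simp: pull_def)
  then have "pull (the_inv_into V g) (g ` V) (pull g V R) = R \<inter> g ` V \<times> g ` V"
    using pull_pull[OF bij, of "R \<inter> g ` V \<times> g ` V"] by simp
  moreover have "bij_betw (the_inv_into V g) (g ` V) V" using bij by (rule bij_betw_the_inv_into)
  then have "embeds (g ` V, pull (the_inv_into V g) (g ` V) (pull g V R)) (V, pull g V R)"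
    by (intro embeds_pull) (auto simp: bij_betw_def)
  ultimately show ?thesis using free_of_embeds[OF _ assms(2)] by simp
qed

lemma solves_of_hom: "solves F (vset n) (netrel n Q (X0 Z0 Z1) C0 G0) N1"
  unfolding solves_def
proof (intro conjI)
  show "N1 \<subseteq> netrel n Q (X0 Z0 Z1) C0 G0" using net1_net0 unfolding netrel_def by blast
  show "netrel n Q (X0 Z0 Z1) C0 G0 \<subseteq> N1 \<union> N1\<inverse>" using net0_net1 unfolding netrel_def by blast
  show "asym N1" unfolding asym_iff_all netrel_def using net1_asym by blast
  show "free_of F (vset n, N1)"
  proof (rule free_of_cover)
    fix A assume A: "A \<subseteq> vset n" "2 \<le> card A"
      "\<And>u v. u \<in> A \<Longrightarrow> v \<in> A \<Longrightarrow> u \<noteq> v \<Longrightarrow> (u, v) \<in> N1 \<or> (v, u) \<in> N1"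
    have adj: "net1 u v \<or> net1 v u" if "u \<in> A" "v \<in> A" "u \<noteq> v" for u v
      using A(3)[OF that] unfolding netrel_def by blast
    consider (G) k p u t where "(TG k p u, t) \<in> A" | (C) k i t where "(TC k i, t) \<in> A" "\<And>k p u t. (TG k p u, t) \<notin> A"
      | (V) "\<And>k p u t. (TG k p u, t) \<notin> A" "\<And>k i t. (TC k i, t) \<notin> A" by blast
    then show "\<exists>W. A \<subseteq> W \<and> free_of F (W, N1 \<inter> W \<times> W)"
    proof cases
      case G
      then have "(TG k p u, t) \<in> vset n" using A(1) by blast
      then have kp: "k \<in> {2..m}" "p < k choose 2" "t \<in> set (tuples n dim)" and u: "u \<in> W" "u \<noteq> a" "u \<noteq> b" "u \<noteq> r" "u \<noteq> s"
        by (simp_all add: vset_def tagset_iff)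
      have pu: "port k p t u = (TG k p u, t)" using u by (simp add: port_def)
      have G1s: "G1 k p t \<subseteq> \<Gamma>" unfolding G1_def by (rule Sol_sub)
      have sub: "A \<subseteq> port k p t ` W"
      proof
        fix y assume y: "y \<in> A"
        show "y \<in> port k p t ` W"
        proof (cases "y = (TG k p u, t)")
          case True
          then show ?thesis using pu u(1) by (metis imageI)
        next
          case False
          then show ?thesis using net_port_neighbour[where Q = Q and X = X1 and C = C1 and G = G1, OF subsetD[OF A(1) y] _ G1s] adj[OF G y] by blast
        qed
      qed
      have "A \<noteq> {(TG k p u, t)}" using A(2) by auto
      then obtain y where y: "y \<in> A" "y \<noteq> (TG k p u, t)" using G by blast
      obtain c t' where y': "y = (c, t')" by (cases y)
      have "take (k choose 2) t \<in> Q k" using adj[OF G y(1)] y(2) unfolding y' by (cases c) auto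
      then have "pull (port k p t) W N1 = G1 k p t" using pull_port kp by blast
      then have "free_of F (port k p t ` W, N1 \<inter> port k p t ` W \<times> port k p t ` W)"
        using free_block[OF inj_port[OF kp(2)], of t N1] Sol_free unfolding G1_def by simp
      then show ?thesis using sub by blast
    next
      case C
      then have "(TC k i, t) \<in> vset n" using A(1) by blast
      then have k: "k \<in> {2..m}" "i \<in> {1..k}" "t \<in> set (tuples n dim)" by (simp_all add: vset_def tagset_iff)
      let ?g = "\<lambda>i. (TC k i, t)"
      have nb: "\<exists>j. y = ?g j \<and> j \<in> {1..k} \<and> take (k choose 2) t \<in> Q k" if y: "y \<in> A" "y \<noteq> (TC k i, t)" for y
      proof -
        obtain c t' where y': "y = (c, t')" by (cases y)
        have V: "c \<in> tagset" using y(1) A(1) by (auto simp: y' vset_def)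
        show ?thesis using adj[OF C(1) y(1)] y C(2) V unfolding y' by (cases c) (auto simp: tagset_iff)
      qed
      have "A \<noteq> {(TC k i, t)}" using A(2) by auto
      then obtain y where y: "y \<in> A" "y \<noteq> (TC k i, t)" using C(1) by blast
      then have Qt: "take (k choose 2) t \<in> Q k" using nb by blast
      have "A \<subseteq> ?g ` {1..k}" using nb k(2) by blast
      moreover have "pull ?g {1..k} N1 = C1 k t"
      proof -
        have "(x, y) \<in> pull ?g {1..k} N1 \<longleftrightarrow> (x, y) \<in> C1 k t" for x y
          using C1[of k t] Qt k unfolding tournament_iff by (auto simp: pull_def netrel_def vset_def tagset_iff)
        then show ?thesis by auto
      qed
      then have "free_of F (?g ` {1..k}, N1 \<inter> ?g ` {1..k} \<times> ?g ` {1..k})"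
        using C1_free[OF k(1) Qt] by (intro free_block) (auto simp: inj_on_def)
      ultimately show ?thesis by blast
    next
      case V
      have "A \<noteq> {}" using A(2) by auto
      then obtain x where x: "x \<in> A" by blast
      obtain c t where "x = (c, t)" by (cases x)
      then obtain z where xz: "x = (TV z, t)" using V x by (cases c) auto
      have xt: "length t = dim" using A(1) x by (auto simp: xz vset_def set_tuples)
      let ?g = "\<lambda>u. (TV (u = b), t)"
      have nb: "y \<in> ?g ` {a, b}" if y: "y \<in> A" for y
      proof -
        obtain c t' where "y = (c, t')" by (cases y)
        then obtain z' where y': "y = (TV z', t')" using V y by (cases c) auto
        have "t' = t" using adj[OF x y] by (cases "x = y") (auto simp: xz y')
        then show ?thesis using W(7) by (cases z') (auto simp: y')
      qed
      have "A \<noteq> {x}" using A(2) by auto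
      then obtain y where y: "y \<in> A" "y \<noteq> x" using x by blast
      then obtain z' where y': "y = (TV z', t)" using nb[OF y(1)] by auto
      have ct: "const_tuple dim t" using adj[OF x y(1)] y(2) by (auto simp: xz y')
      have tV: "(TV w, t) \<in> vset n" for w using A(1) x by (auto simp: xz vset_def tagset_iff)
      let ?S = "Sol (h (t ! 0) = 1)"
      have ne: "a \<noteq> b" using W(7) by simp
      have loop: "(u, u) \<notin> ?S" for u using Sol_asym by blast
      have "pull ?g {a, b} N1 = pull id {a, b} ?S"
      proof -
        have "(u, v) \<in> pull ?g {a, b} N1 \<longleftrightarrow> (u, v) \<in> pull id {a, b} ?S" for u v
          using ne ct tV Sol(2) Sol_ports loop by (auto simp: pull_def netrel_def X1_def)
        then show ?thesis by auto
      qed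
      moreover have "free_of F ({a, b}, pull id {a, b} ?S)"
        by (rule free_of_embeds[OF embeds_pull Sol_free]) (use W in auto)
      ultimately have "free_of F (?g ` {a, b}, N1 \<inter> ?g ` {a, b} \<times> ?g ` {a, b})"
        using ne by (intro free_block) (auto simp: inj_on_def)
      then show ?thesis using nb by blast
    qed
  qed
qed

end

end

context gadget
begin

abbreviation big :: "nat \<Rightarrow> rels \<Rightarrow> vertex rel" where
  "big n Rs \<equiv> netrel n (\<lambda>k. Rs ! (k - 2)) (X0 (Rs ! (m - 1)) (Rs ! Suc (m - 1))) C0 G0"

lemma definable_big:
  assumes c: "c \<in> tagset" "c' \<in> tagset" and ij: "i + dim \<le> k" "j + dim \<le> k"
  shows "definable (B01_signature F) k (\<lambda>n Rs \<sigma>. ((c, slot dim i \<sigma>), (c', slot dim j \<sigma>)) \<in> big n Rs)"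
proof -
  have q: "definable (B01_signature F) k (\<lambda>n Rs \<sigma>. take (q choose 2) (slot dim i \<sigma>) \<in> Rs ! (q - 2))"
    if "q \<in> {2..m}" "i + dim \<le> k" for q i
    using signature_nth(1)[OF that(1)] choose_less_dim[of q] that by (intro definable_slot_rel) auto
  have z: "definable (B01_signature F) k (\<lambda>n Rs \<sigma>. [slot dim i \<sigma> ! 0] \<in> Rs ! (m - 1))"
    "definable (B01_signature F) k (\<lambda>n Rs \<sigma>. [slot dim i \<sigma> ! 0] \<in> Rs ! Suc (m - 1))"
    using ij dim_pos signature_nth by (intro definable_slot_unary; simp)+
  have l: "p < dim" if "p < q choose 2" "q \<in> {2..m}" for p q
    using choose_less_dim[of q] that by simp
  note rules = definable_conj definable_disj definable_slot_eq definable_const_tuple definable_slot_nth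
    definable_not q z ij dim_pos definable_const
  have N: "definable (B01_signature F) k (\<lambda>n Rs \<sigma>.
      net (\<lambda>k. Rs ! (k - 2)) (X0 (Rs ! (m - 1)) (Rs ! Suc (m - 1))) C0 G0 (c, slot dim i \<sigma>) (c', slot dim j \<sigma>))"
  proof (cases c; cases c')
    fix x y assume cc: "c = TV x" "c' = TV y"
    have "definable (B01_signature F) k
       (\<lambda>n Rs \<sigma>. X0 (Rs ! (m - 1)) (Rs ! Suc (m - 1)) (slot dim i \<sigma> ! 0) x y)"
      unfolding X0_def by (cases x; cases y; simp del: One_nat_def; intro rules)
    then show ?thesis unfolding cc net.simps by (intro definable_conj definable_slot_eq definable_const_tuple ij dim_pos)
  next
    fix x q u assume cc: "c = TV x" "c' = TC q u"
    show ?thesis unfolding cc net.simps by (rule definable_const)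
  next
    fix x q p u assume cc: "c = TV x" "c' = TG q p u"
    then have "q \<in> {2..m}" "p < q choose 2" using c by (simp_all add: tagset_iff)
    then show ?thesis unfolding cc net.simps using l by (intro rules) auto
  next
    fix q u x assume cc: "c = TC q u" "c' = TV x"
    show ?thesis unfolding cc net.simps by (rule definable_const)
  next
    fix q u q' v assume cc: "c = TC q u" "c' = TC q' v"
    then have "q \<in> {2..m}" using c by (simp add: tagset_iff)
    then show ?thesis unfolding cc net.simps by (intro rules)
  next
    fix q u q' p v assume cc: "c = TC q u" "c' = TG q' p v"
    then have "q' \<in> {2..m}" using c by (simp add: tagset_iff)
    then show ?thesis unfolding cc net.simps by (intro rules)
  next
    fix q p u x assume cc: "c = TG q p u" "c' = TV x"
    then have "q \<in> {2..m}" "p < q choose 2" using c by (simp_all add: tagset_iff)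
    then show ?thesis unfolding cc net.simps using l by (intro rules) auto
  next
    fix q p u q' v assume cc: "c = TG q p u" "c' = TC q' v"
    then have "q \<in> {2..m}" using c by (simp add: tagset_iff)
    then show ?thesis unfolding cc net.simps by (intro rules)
  next
    fix q p u q' p' v assume cc: "c = TG q p u" "c' = TG q' p' v"
    then have "q \<in> {2..m}" using c by (simp add: tagset_iff)
    then show ?thesis unfolding cc net.simps by (intro rules)
  qed
  show ?thesis
    by (rule definable_cong[OF N]) (use c slot_tuples ij in \<open>auto simp: netrel_def vset_def\<close>)
qed

lemma big_correct:
  assumes "structure_of (B01_signature F) ({..<n}, Rs)"
  shows "encode n (B01_signature F) Rs \<in> CSP (B01_signature F) (B01 F) \<longleftrightarrow> (\<exists>R. solves F (vset n) (big n Rs) R)"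
proof -
  let ?Q = "\<lambda>k. Rs ! (k - 2)" and ?Z0 = "Rs ! (m - 1)" and ?Z1 = "Rs ! Suc (m - 1)"
  have Rs: "Rs = map ?Q [2..<Suc m] @ [?Z0, ?Z1]" using B01_instance[OF assms] .
  have "structure_of (B01_signature F) ({..<n}, map ?Q [2..<Suc m] @ [?Z0, ?Z1])"
    using assms by (subst (asm) Rs)
  note st = this[unfolded structure_B01]
  have Q: "length t = k choose 2 \<and> set t \<subseteq> {..<n}" if "k \<in> {2..m}" "t \<in> ?Q k" for k t
    using bspec[OF bspec[OF conjunct1[OF st] that(1)] that(2)] .
  have Z0: "length t = 1 \<and> set t \<subseteq> {..<n}" if "t \<in> ?Z0" for t
    using bspec[OF conjunct1[OF conjunct2[OF st]] that] .
  have Z1: "length t = 1 \<and> set t \<subseteq> {..<n}" if "t \<in> ?Z1" for t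
    using bspec[OF conjunct2[OF conjunct2[OF st]] that] .
  have "(\<exists>h. homomorphism h ({..<n}, map ?Q [2..<Suc m] @ [?Z0, ?Z1]) (B01 F)) \<longleftrightarrow>
      (\<exists>R. solves F (vset n) (big n Rs) R)"
  proof
    assume "\<exists>h. homomorphism h ({..<n}, map ?Q [2..<Suc m] @ [?Z0, ?Z1]) (B01 F)"
    then obtain h where h: "homomorphism h ({..<n}, map ?Q [2..<Suc m] @ [?Z0, ?Z1]) (B01 F)" ..
    show "\<exists>R. solves F (vset n) (big n Rs) R" by (rule exI, rule solves_of_hom[OF Q h])
  next
    assume "\<exists>R. solves F (vset n) (big n Rs) R"
    then obtain R where R: "solves F (vset n) (big n Rs) R" ..
    show "\<exists>h. homomorphism h ({..<n}, map ?Q [2..<Suc m] @ [?Z0, ?Z1]) (B01 F)"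
      by (rule hom_of_solves[OF Q Z0 Z1 R])
  qed
  then show ?thesis unfolding CSP_encode[OF assms] using Rs by metis
qed

lemma boolean_reducible:
  shows "poly_reducible (CSP (B01_signature F) (B01 F)) (orientation_completion F)"
    and "fraisse_limit F D \<Longrightarrow> poly_reducible (CSP (B01_signature F) (B01 F)) (CSP [2, 2] (with_U (D :: 'a digraph)))"
proof -
  obtain tags where tags: "set tags = tagset" "distinct tags"
    using finite_distinct_list[OF finite_tagset] by blast
  have sub: "big n Rs \<subseteq> (set tags \<times> set (tuples n dim)) \<times> (set tags \<times> set (tuples n dim))" for n Rs
    unfolding netrel_def vset_def tags(1) by blast
  have def: "definable (B01_signature F) k (\<lambda>n Rs \<sigma>. ((c, slot dim i \<sigma>), (c', slot dim j \<sigma>)) \<in> big n Rs)"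
    if "c \<in> set tags" "c' \<in> set tags" "i + dim \<le> k" "j + dim \<le> k" for k i j c c'
    using definable_big that unfolding tags(1) .
  have correct: "encode n (B01_signature F) Rs \<in> CSP (B01_signature F) (B01 F) \<longleftrightarrow>
      (\<exists>R. solves F (set tags \<times> set (tuples n dim)) (big n Rs) R)"
    if "structure_of (B01_signature F) ({..<n}, Rs)" for n Rs
    using big_correct[OF that] unfolding vset_def tags(1) .
  show "poly_reducible (CSP (B01_signature F) (B01 F)) (orientation_completion F)"
    by (rule reducible_to_completion[OF tags(2) def sub CSP_decode correct])
  show "poly_reducible (CSP (B01_signature F) (B01 F)) (CSP [2, 2] (with_U D))" if "fraisse_limit F D"
    by (rule reducible_to_limit[OF tags(2) def sub CSP_decode correct that])
qed

end

lemma definable_ex: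
  assumes "definable ar (Suc k) P"
  shows "definable ar k (\<lambda>n Rs \<sigma>. \<exists>v<n. P n Rs (\<sigma> @ [v]))"
proof -
  obtain p where p: "wf_prog (Suc k) p" "\<And>n Rs \<sigma> b ys. valid ar (Suc k) n Rs \<sigma> \<Longrightarrow>
     sem (encode n ar Rs) n p \<sigma> (b, 0, ys) = (P n Rs \<sigma>, 0, ys)"
    using assms unfolding definable_def by blast
  have "sem (encode n ar Rs) n (Then (SetFlag False) (For (IfFlag Stay p))) \<sigma> (b, 0, ys) =
      (\<exists>v<n. P n Rs (\<sigma> @ [v]), 0, ys)" if v: "valid ar k n Rs \<sigma>" for n Rs \<sigma> b ys
  proof -
    have "j \<le> n \<Longrightarrow> fold (\<lambda>i. sem (encode n ar Rs) n (IfFlag Stay p) (\<sigma> @ [i])) [0..<j] (False, 0, ys) =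
        (\<exists>v<j. P n Rs (\<sigma> @ [v]), 0, ys)" for j
    proof (induction j)
      case (Suc j)
      have "valid ar (Suc k) n Rs (\<sigma> @ [j])" using v Suc.prems by (simp add: valid_def)
      then show ?case using Suc p(2) by (auto simp: less_Suc_eq)
    qed simp
    then show ?thesis by simp
  qed
  then show ?thesis unfolding definable_def using p(1)
    by (intro exI[of _ "Then (SetFlag False) (For (IfFlag Stay p))"]) auto
qed

context forbidden
begin

lemma pad_tuple:
  assumes "k \<in> {2..m}" "length t0 = k choose 2" "set t0 \<subseteq> {..<n}"
  shows "\<exists>t\<in>set (tuples n dim). take (k choose 2) t = t0"
proof -
  have "2 \<le> k" using assms(1) by simp
  then have "k choose 2 > 0" by simp
  then have "t0 ! 0 \<in> set t0" using assms(2) by simp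
  then have "t0 ! 0 < n" using assms(3) by blast
  moreover have "k choose 2 < dim" using choose_less_dim assms(1) by simp
  ultimately show ?thesis using assms
    by (intro bexI[of _ "t0 @ replicate (dim - (k choose 2)) (t0 ! 0)"]) (auto simp: set_tuples)
qed

lemma solves_empty: "solves F V {} {}"
  unfolding solves_def
proof (intro conjI)
  show "free_of F (V, {})"
  proof (rule free_of_cover)
    fix A assume "2 \<le> card A" and adj: "\<And>u v. u \<in> A \<Longrightarrow> v \<in> A \<Longrightarrow> u \<noteq> v \<Longrightarrow> (u, v) \<in> {} \<or> (v, u) \<in> {}"
    then have "\<exists>u v. u \<in> A \<and> v \<in> A \<and> u \<noteq> v"
      by (metis card_2_iff' card_le_Suc_iff numeral_2_eq_2 card.empty is_singletonI' is_singleton_altdef One_nat_def Suc_n_not_le_n zero_neq_numeral not_numeral_le_zero empty_iff ex_in_conv)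
    then show "\<exists>W. A \<subseteq> W \<and> free_of F (W, {} \<inter> W \<times> W)" using adj by blast
  qed
qed (auto simp: asym_iff_all)

text \<open>If on every vertex number all or none of the tournaments are free, an instance is refuted
  only by conflicting constants or by a constraint that no assignment satisfies.\<close>

context
  assumes trivial: "\<And>k. k \<in> {2..m} \<Longrightarrow> (\<forall>T. tournament ({1..k}, T) \<longrightarrow> free_of F ({1..k}, T)) \<or>
      (\<forall>T. tournament ({1..k}, T) \<longrightarrow> \<not> free_of F ({1..k}, T))"
begin

definition Bad :: "nat set" where
  "Bad = {k \<in> {2..m}. \<forall>T. tournament ({1..k}, T) \<longrightarrow> \<not> free_of F ({1..k}, T)}"

definition bad :: "rels \<Rightarrow> nat list \<Rightarrow> bool" where
  "bad Rs t \<longleftrightarrow> (const_tuple dim t \<and> [t ! 0] \<in> Rs ! (m - 1) \<and> [t ! 0] \<in> Rs ! Suc (m - 1)) \<or>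
     (\<exists>k\<in>Bad. take (k choose 2) t \<in> Rs ! (k - 2))"

definition loops :: "nat \<Rightarrow> rels \<Rightarrow> (unit \<times> nat list) rel" where
  "loops n Rs = {(x, y). x = y \<and> snd x \<in> set (tuples n dim) \<and> bad Rs (snd x)}"

lemma loops_correct:
  assumes st: "structure_of (B01_signature F) ({..<n}, Rs)"
  shows "encode n (B01_signature F) Rs \<in> CSP (B01_signature F) (B01 F) \<longleftrightarrow>
    (\<exists>R. solves F (set [()] \<times> set (tuples n dim)) (loops n Rs) R)"
proof -
  let ?Q = "\<lambda>k. Rs ! (k - 2)" and ?Z0 = "Rs ! (m - 1)" and ?Z1 = "Rs ! Suc (m - 1)"
  have Rs: "Rs = map ?Q [2..<Suc m] @ [?Z0, ?Z1]" using B01_instance[OF st] .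
  have "structure_of (B01_signature F) ({..<n}, map ?Q [2..<Suc m] @ [?Z0, ?Z1])"
    using st by (subst (asm) Rs)
  note st' = this[unfolded structure_B01]
  have Q: "length t = k choose 2" "set t \<subseteq> {..<n}" if "k \<in> {2..m}" "t \<in> ?Q k" for k t
    using bspec[OF bspec[OF conjunct1[OF st'] that(1)] that(2)] by simp_all
  have Z0: "\<exists>x<n. t = [x]" if "t \<in> ?Z0" for t
    using bspec[OF conjunct1[OF conjunct2[OF st']] that] by (auto simp: length_Suc_conv)
  have Z1: "\<exists>x<n. t = [x]" if "t \<in> ?Z1" for t
    using bspec[OF conjunct2[OF conjunct2[OF st']] that] by (auto simp: length_Suc_conv)
  have d0: "replicate dim x ! 0 = x" for x :: nat using dim_pos by simp
  have "(\<exists>R. solves F (set [()] \<times> set (tuples n dim)) (loops n Rs) R) \<longleftrightarrow> loops n Rs = {}"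
  proof
    assume "\<exists>R. solves F (set [()] \<times> set (tuples n dim)) (loops n Rs) R"
    then obtain R where "loops n Rs \<subseteq> R \<union> R\<inverse>" "asym R" unfolding solves_def by blast
    moreover have "x = y" if "(x, y) \<in> loops n Rs" for x y using that by (simp add: loops_def)
    ultimately have "(x, y) \<notin> loops n Rs" for x y unfolding asym_iff_all by blast
    then show "loops n Rs = {}" by auto
  next
    assume "loops n Rs = {}"
    then show "\<exists>R. solves F (set [()] \<times> set (tuples n dim)) (loops n Rs) R" using solves_empty by metis
  qed
  also have "\<dots> \<longleftrightarrow> (\<forall>t\<in>set (tuples n dim). \<not> bad Rs t)" unfolding loops_def by auto
  also have "\<dots> \<longleftrightarrow> (\<exists>h. homomorphism h ({..<n}, map ?Q [2..<Suc m] @ [?Z0, ?Z1]) (B01 F))"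
  proof
    assume nb: "\<forall>t\<in>set (tuples n dim). \<not> bad Rs t"
    define h where "h x = (if [x] \<in> ?Z1 then 1 else (0 :: nat))" for x
    have "map h t \<in> P_rel F k" if k: "k \<in> {2..m}" and t: "t \<in> ?Q k" for k t
    proof -
      obtain t' where t': "t' \<in> set (tuples n dim)" "take (k choose 2) t' = t" using pad_tuple[OF k Q[OF k t]] by blast
      have "k \<notin> Bad"
      proof
        assume "k \<in> Bad"
        then have "bad Rs t'" unfolding bad_def using t t'(2) by blast
        then show False using nb t'(1) by blast
      qed
      then have "\<forall>T. tournament ({1..k}, T) \<longrightarrow> free_of F ({1..k}, T)"
        using trivial[OF k] k unfolding Bad_def by blast
      then have "free_of F ({1..k}, decode_tournament k (map h t))" using decode_tournament_tournament by blast
      moreover have "set (map h t) \<subseteq> {0, 1}" by (auto simp: h_def)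
      ultimately show ?thesis using P_rel_iff[of "map h t" k F] Q(1)[OF k t] by simp
    qed
    moreover have "map h t = [0]" if t: "t \<in> ?Z0" for t
    proof -
      obtain x where x: "x < n" "t = [x]" using Z0[OF t] by blast
      have "replicate dim x \<in> set (tuples n dim)" using x(1) by (simp add: set_tuples set_replicate_conv_if)
      then have "\<not> bad Rs (replicate dim x)" using nb by blast
      then have "[x] \<notin> ?Z1" using t x(2) unfolding bad_def d0 using const_replicate by blast
      then show ?thesis using x(2) by (simp add: h_def)
    qed
    moreover have "map h t = [1]" if t: "t \<in> ?Z1" for t
      using Z1[OF t] t by (auto simp: h_def)
    moreover have "h ` {..<n} \<subseteq> {0, 1}" by (auto simp: h_def)
    ultimately show "\<exists>h. homomorphism h ({..<n}, map ?Q [2..<Suc m] @ [?Z0, ?Z1]) (B01 F)"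
      unfolding hom_B01 by (intro exI[of _ h] conjI ballI) (blast | simp)+
  next
    assume "\<exists>h. homomorphism h ({..<n}, map ?Q [2..<Suc m] @ [?Z0, ?Z1]) (B01 F)"
    then obtain h where "homomorphism h ({..<n}, map ?Q [2..<Suc m] @ [?Z0, ?Z1]) (B01 F)" ..
    note hom = this[unfolded hom_B01]
    show "\<forall>t\<in>set (tuples n dim). \<not> bad Rs t"
    proof (intro ballI notI)
      fix t assume "bad Rs t"
      then consider "[t ! 0] \<in> ?Z0" "[t ! 0] \<in> ?Z1" | k where "k \<in> Bad" "take (k choose 2) t \<in> ?Q k"
        unfolding bad_def by blast
      then show False
      proof cases
        case 1
        then show False
          using bspec[OF conjunct1[OF conjunct2[OF conjunct2[OF hom]]] 1(1)]
            bspec[OF conjunct2[OF conjunct2[OF conjunct2[OF hom]]] 1(2)] by simp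
      next
        case 2
        have k: "k \<in> {2..m}" using 2(1) by (simp add: Bad_def)
        let ?c = "map h (take (k choose 2) t)"
        have "?c \<in> P_rel F k"
          using bspec[OF bspec[OF conjunct1[OF conjunct2[OF hom]] k] 2(2)] .
        then obtain T where "tournament ({1..k}, T)" "free_of F ({1..k}, T)" unfolding P_rel_def by blast
        then show False using 2(1) unfolding Bad_def by blast
      qed
    qed
  qed
  finally show ?thesis unfolding CSP_encode[OF st] using Rs by metis
qed

lemma trivial_reducible:
  shows "poly_reducible (CSP (B01_signature F) (B01 F)) (orientation_completion F)"
    and "fraisse_limit F D \<Longrightarrow> poly_reducible (CSP (B01_signature F) (B01 F)) (CSP [2, 2] (with_U (D :: 'a digraph)))"
proof -
  have q: "definable (B01_signature F) k (\<lambda>n Rs \<sigma>. take (q choose 2) (slot dim i \<sigma>) \<in> Rs ! (q - 2))"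
    if "q \<in> Bad" "i + dim \<le> k" for q i k
  proof -
    have "q \<in> {2..m}" using that(1) by (simp add: Bad_def)
    then show ?thesis using signature_nth(1) choose_less_dim[of q] that by (intro definable_slot_rel) auto
  qed
  have "finite Bad" by (simp add: Bad_def)
  have z: "definable (B01_signature F) k (\<lambda>n Rs \<sigma>. [slot dim i \<sigma> ! 0] \<in> Rs ! (m - 1))"
    "definable (B01_signature F) k (\<lambda>n Rs \<sigma>. [slot dim i \<sigma> ! 0] \<in> Rs ! Suc (m - 1))" if "i + dim \<le> k" for i k
    using that dim_pos signature_nth by (intro definable_slot_unary; simp)+
  have def: "definable (B01_signature F) k (\<lambda>n Rs \<sigma>. ((c, slot dim i \<sigma>), (c', slot dim j \<sigma>)) \<in> loops n Rs)"
    if "c \<in> set [()]" "c' \<in> set [()]" "i + dim \<le> k" "j + dim \<le> k" for k i j c c'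
  proof -
    have "definable (B01_signature F) k (\<lambda>n Rs \<sigma>. slot dim i \<sigma> = slot dim j \<sigma> \<and> bad Rs (slot dim i \<sigma>))"
      unfolding bad_def
      by (intro definable_conj definable_disj definable_slot_eq definable_const_tuple definable_bex
          \<open>finite Bad\<close> q z that dim_pos)
    then show ?thesis by (rule definable_cong) (use slot_tuples that in \<open>auto simp: loops_def\<close>)
  qed
  have sub: "loops n Rs \<subseteq> (set [()] \<times> set (tuples n dim)) \<times> (set [()] \<times> set (tuples n dim))" for n Rs
    by (auto simp: loops_def)
  have "distinct [()]" by simp
  show "poly_reducible (CSP (B01_signature F) (B01 F)) (orientation_completion F)"
    by (rule reducible_to_completion[OF \<open>distinct [()]\<close> def sub CSP_decode loops_correct])
  show "poly_reducible (CSP (B01_signature F) (B01 F)) (CSP [2, 2] (with_U D))" if "fraisse_limit F D"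
    by (rule reducible_to_limit[OF \<open>distinct [()]\<close> def sub CSP_decode loops_correct that])
qed

end

lemma boolean_to_graphs:
  shows "poly_reducible (CSP (B01_signature F) (B01 F)) (orientation_completion F)"
    and "fraisse_limit F D \<Longrightarrow> poly_reducible (CSP (B01_signature F) (B01 F)) (CSP [2, 2] (with_U (D :: 'a digraph)))"
proof -
  let ?all = "\<lambda>k. \<forall>T. tournament ({1..k}, T) \<longrightarrow> free_of F ({1..k}, T)"
  let ?none = "\<lambda>k. \<forall>T. tournament ({1..k}, T) \<longrightarrow> \<not> free_of F ({1..k}, T)"
  define uniform where "uniform k \<longleftrightarrow> ?all k \<or> ?none k" for k :: nat
  have "poly_reducible (CSP (B01_signature F) (B01 F)) (orientation_completion F) \<and>
    (fraisse_limit F D \<longrightarrow> poly_reducible (CSP (B01_signature F) (B01 F)) (CSP [2, 2] (with_U D)))"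
  proof (cases "\<forall>k\<in>{2..m}. uniform k")
    case True
    have "?all k \<or> ?none k" if "k \<in> {2..m}" for k
      using bspec[OF True that] unfolding uniform_def .
    note red = trivial_reducible[OF this]
    show ?thesis by (intro conjI impI red)
  next
    case False
    then obtain k where k: "\<not> uniform k" by blast
    have "\<not> ?none k" using k unfolding uniform_def de_Morgan_disj by (rule conjunct2)
    then obtain T0 where T0: "tournament ({1..k}, T0)" "free_of F ({1..k}, T0)" by blast
    have "\<not> ?all k" using k unfolding uniform_def de_Morgan_disj by (rule conjunct1)
    then obtain Z where Z: "tournament ({1..k}, Z)" "\<not> free_of F ({1..k}, Z)" by blast
    obtain W E a b r s where "equality W E a b r s"
      using equality_exists[OF finite_atLeastAtMost T0 Z] by blast
    then interpret gadget F W E a b r s by unfold_locales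
    show ?thesis by (intro conjI impI boolean_reducible)
  qed
  then show "poly_reducible (CSP (B01_signature F) (B01 F)) (orientation_completion F)"
    "fraisse_limit F D \<Longrightarrow> poly_reducible (CSP (B01_signature F) (B01 F)) (CSP [2, 2] (with_U D))" by blast+
qed

section \<open>Reductions between the graph problems\<close>

lemma unit_graph:
  assumes def: "\<And>k i j. i < k \<Longrightarrow> j < k \<Longrightarrow> definable ar k (\<lambda>n Rs \<sigma>. (\<sigma> ! i, \<sigma> ! j) \<in> E n Rs)"
    and sub: "\<And>n Rs. structure_of ar ({..<n}, Rs) \<Longrightarrow> E n Rs \<subseteq> {..<n} \<times> {..<n}"
    and decode: "\<And>x. x \<in> L \<Longrightarrow> \<exists>n Rs. structure_of ar ({..<n}, Rs) \<and> x = encode n ar Rs"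
    and correct: "\<And>n Rs. structure_of ar ({..<n}, Rs) \<Longrightarrow>
      encode n ar Rs \<in> L \<longleftrightarrow> (\<exists>R. solves F {..<n} (E n Rs) R)"
  shows "poly_reducible L (orientation_completion F)"
    and "fraisse_limit F D \<Longrightarrow> poly_reducible L (CSP [2, 2] (with_U (D :: 'a digraph)))"
proof -
  define E' where "E' n Rs = {(((), [x]), ((), [y])) | x y. (x, y) \<in> E n Rs}" for n Rs
  have def': "definable ar k (\<lambda>n Rs \<sigma>. ((c, slot 1 i \<sigma>), (c', slot 1 j \<sigma>)) \<in> E' n Rs)"
    if "c \<in> set [()]" "c' \<in> set [()]" "i + 1 \<le> k" "j + 1 \<le> k" for k i j c c'
  proof -
    have "definable ar k (\<lambda>n Rs \<sigma>. (\<sigma> ! i, \<sigma> ! j) \<in> E n Rs)" using that by (intro def) auto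
    then show ?thesis
    proof (rule definable_cong)
      fix n Rs \<sigma> assume "valid ar k n Rs \<sigma>"
      then have "slot 1 i \<sigma> = [\<sigma> ! i]" "slot 1 j \<sigma> = [\<sigma> ! j]"
        using that by (simp_all add: slot_def valid_def take_Suc hd_drop_conv_nth)
      then show "((\<sigma> ! i, \<sigma> ! j) \<in> E n Rs) = (((c, slot 1 i \<sigma>), (c', slot 1 j \<sigma>)) \<in> E' n Rs)"
        by (simp add: E'_def)
    qed
  qed
  have sub': "E' n Rs \<subseteq> (set [()] \<times> set (tuples n 1)) \<times> (set [()] \<times> set (tuples n 1))"
    if "structure_of ar ({..<n}, Rs)" for n Rs
    using sub[OF that] by (auto simp: E'_def set_tuples)
  have correct': "encode n ar Rs \<in> L \<longleftrightarrow> (\<exists>R. solves F (set [()] \<times> set (tuples n 1)) (E' n Rs) R)"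
    if st: "structure_of ar ({..<n}, Rs)" for n Rs
  proof -
    let ?g = "\<lambda>x. ((), [x])"
    have "bij_betw ?g {..<n} (set [()] \<times> set (tuples n 1))"
      by (auto simp: bij_betw_def inj_on_def set_tuples length_Suc_conv)
    moreover have "pull ?g {..<n} (E' n Rs) = E n Rs" using sub[OF st] by (auto simp: pull_def E'_def)
    ultimately show ?thesis using solves_pull_bij[of ?g "{..<n}" _ "E' n Rs" F] sub'[OF st] correct[OF st] by metis
  qed
  have "distinct [()]" by simp
  show "poly_reducible L (orientation_completion F)"
    by (rule reducible_to_completion[OF \<open>distinct [()]\<close> def' sub' decode correct'])
  show "poly_reducible L (CSP [2, 2] (with_U D))" if "fraisse_limit F D"
    by (rule reducible_to_limit[OF \<open>distinct [()]\<close> def' sub' decode correct' that])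
qed

lemma definable_edge:
  assumes "i < k" "j < k" "q < length ar" "ar ! q = 2"
  shows "definable ar k (\<lambda>n Rs \<sigma>. [\<sigma> ! i, \<sigma> ! j] \<in> Rs ! q)"
  using definable_atom[of q ar "[i, j]" k] assms by simp

abbreviation edge_rel :: "nat list set \<Rightarrow> nat rel" where
  "edge_rel R \<equiv> {(x, y). [x, y] \<in> R}"

lemma completion_instance:
  assumes st: "structure_of [2] ({..<n}, Rs)"
  shows "edge_rel (Rs ! 0) \<subseteq> {..<n} \<times> {..<n}"
    and "encode n [2] Rs \<in> orientation_completion F \<longleftrightarrow> (\<exists>R. solves F {..<n} (edge_rel (Rs ! 0)) R)"
proof -
  have mem: "length t = 2 \<and> set t \<subseteq> {..<n}" if "t \<in> Rs ! 0" for t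
    using structure_of_mem[OF st, of 0 t] that by simp
  show sub: "edge_rel (Rs ! 0) \<subseteq> {..<n} \<times> {..<n}" using mem by fastforce
  have "length Rs = 1" using structure_of_length[OF st] by simp
  then have "Rs = [Rs ! 0]" by (cases Rs) auto
  moreover have "Rs ! 0 = edge_tuples (edge_rel (Rs ! 0))" using ex_edge_tuples mem by blast
  ultimately have "Rs = [edge_tuples (edge_rel (Rs ! 0))]" by metis
  then show "encode n [2] Rs \<in> orientation_completion F \<longleftrightarrow> (\<exists>R. solves F {..<n} (edge_rel (Rs ! 0)) R)"
    using OC_encode[OF sub, of F] by metis
qed

lemma limit_instance:
  fixes D :: "'a digraph"
  assumes st: "structure_of [2, 2] ({..<n}, Rs)" and lim: "fraisse_limit F D"
  shows "edge_rel (Rs ! 0) \<subseteq> {..<n} \<times> {..<n}" "edge_rel (Rs ! 1) \<subseteq> {..<n} \<times> {..<n}"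
    and "encode n [2, 2] Rs \<in> CSP [2, 2] (with_U D) \<longleftrightarrow>
      (\<exists>R. solution F {..<n} (edge_rel (Rs ! 0)) (edge_rel (Rs ! 0) \<union> edge_rel (Rs ! 1)) R)"
proof -
  have mem: "length t = 2 \<and> set t \<subseteq> {..<n}" if "t \<in> Rs ! i" "i < 2" for t i
    using structure_of_mem[OF st, of i t] that by (auto simp: less_2_cases_iff)
  show sub: "edge_rel (Rs ! 0) \<subseteq> {..<n} \<times> {..<n}" "edge_rel (Rs ! 1) \<subseteq> {..<n} \<times> {..<n}"
    using mem[of _ 0] mem[of _ 1] by fastforce+
  have "length Rs = Suc (Suc 0)" using structure_of_length[OF st] by simp
  then have "Rs = [Rs ! 0, Rs ! 1]" by (auto simp: length_Suc_conv)
  moreover have "Rs ! 0 = edge_tuples (edge_rel (Rs ! 0))" "Rs ! 1 = edge_tuples (edge_rel (Rs ! 1))"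
    using mem by (intro ex_edge_tuples; simp)+
  ultimately have "Rs = [edge_tuples (edge_rel (Rs ! 0)), edge_tuples (edge_rel (Rs ! 1))]" by metis
  then show "encode n [2, 2] Rs \<in> CSP [2, 2] (with_U D) \<longleftrightarrow>
      (\<exists>R. solution F {..<n} (edge_rel (Rs ! 0)) (edge_rel (Rs ! 0) \<union> edge_rel (Rs ! 1)) R)"
    using CSP_encode[OF st, of "with_U D"] hom_limit[OF lim finite_lessThan sub] by metis
qed

lemma completion_to_limit: "fraisse_limit F D \<Longrightarrow> poly_reducible (orientation_completion F) (CSP [2, 2] (with_U (D :: 'a digraph)))"
  by (rule unit_graph(2)[where E = "\<lambda>n Rs. edge_rel (Rs ! 0)" and ar = "[2]"])
    (auto simp: definable_edge completion_instance OC_decode)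

lemma completion_to_boolean: "poly_reducible (orientation_completion F) (CSP (B01_signature F) (B01 F))"
proof (rule reducible_to_boolean[where ar = "[2]" and A = "\<lambda>n Rs. edge_rel (Rs ! 0)"
      and E = "\<lambda>n Rs. edge_rel (Rs ! 0) - (edge_rel (Rs ! 0))\<inverse>"])
  show "definable [2] k (\<lambda>n Rs \<sigma>. (\<sigma> ! i, \<sigma> ! j) \<in> edge_rel (Rs ! 0) - (edge_rel (Rs ! 0))\<inverse>)"
    if "i < k" "j < k" for k i j
  proof -
    have "definable [2] k (\<lambda>n Rs \<sigma>. [\<sigma> ! i, \<sigma> ! j] \<in> Rs ! 0 \<and> \<not> [\<sigma> ! j, \<sigma> ! i] \<in> Rs ! 0)"
      using that by (intro definable_conj definable_not definable_edge) auto
    then show ?thesis by (rule definable_cong) simp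
  qed
  show "definable [2] k (\<lambda>n Rs \<sigma>. (\<sigma> ! i, \<sigma> ! j) \<in> edge_rel (Rs ! 0))" if "i < k" "j < k" for k i j
    using definable_edge[of i k j 0 "[2]"] that by simp
qed (use completion_instance OC_decode in \<open>auto simp: solves_solution\<close>)

lemma limit_to_boolean:
  assumes lim: "fraisse_limit F (D :: 'a digraph)"
  shows "poly_reducible (CSP [2, 2] (with_U D)) (CSP (B01_signature F) (B01 F))"
proof (rule reducible_to_boolean[where ar = "[2, 2]" and E = "\<lambda>n Rs. edge_rel (Rs ! 0)"
      and A = "\<lambda>n Rs. edge_rel (Rs ! 0) \<union> edge_rel (Rs ! 1)"])
  show "definable [2, 2] k (\<lambda>n Rs \<sigma>. (\<sigma> ! i, \<sigma> ! j) \<in> edge_rel (Rs ! 0))" if "i < k" "j < k" for k i j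
    using definable_edge[of i k j 0 "[2, 2]"] that by simp
  show "definable [2, 2] k (\<lambda>n Rs \<sigma>. (\<sigma> ! i, \<sigma> ! j) \<in> edge_rel (Rs ! 0) \<union> edge_rel (Rs ! 1))"
    if "i < k" "j < k" for k i j
  proof -
    have "definable [2, 2] k (\<lambda>n Rs \<sigma>. [\<sigma> ! i, \<sigma> ! j] \<in> Rs ! 0 \<or> [\<sigma> ! i, \<sigma> ! j] \<in> Rs ! 1)"
      using that by (intro definable_disj definable_edge) auto
    then show ?thesis by (rule definable_cong) simp
  qed
  show "edge_rel (Rs ! 0) \<subseteq> edge_rel (Rs ! 0) \<union> edge_rel (Rs ! 1) \<and>
      edge_rel (Rs ! 0) \<union> edge_rel (Rs ! 1) \<subseteq> {..<n} \<times> {..<n}"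
    if "structure_of [2, 2] ({..<n}, Rs)" for n Rs
    using limit_instance(1,2)[OF that lim] by blast
qed (use limit_instance(3)[OF _ lim] CSP_decode in blast)+

text \<open>A loop makes the completion problem unsolvable; it is placed at every vertex with a
  constraint loop or with an incident edge that is forced in both directions.\<close>

lemma solution_solves_iff:
  assumes "E \<subseteq> V \<times> V" "U \<subseteq> V \<times> V"
  defines "H \<equiv> {(x, y). x \<in> V \<and> y \<in> V \<and> (if x = y then (x, x) \<in> U \<or> (\<exists>z\<in>V. (x, z) \<in> E \<and> (z, x) \<in> E)
      else (x, y) \<in> E \<or> ((x, y) \<in> U \<or> (y, x) \<in> U) \<and> (y, x) \<notin> E)}"
  shows "solution F V E (E \<union> U) R \<longleftrightarrow> solves F V H R"
proof
  assume "solution F V E (E \<union> U) R"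
  then have R: "R \<subseteq> (E \<union> U) \<union> (E \<union> U)\<inverse>" "E \<union> U \<subseteq> R \<union> R\<inverse>" "asym R" "E \<subseteq> R" "free_of F (V, R)"
    unfolding solution_def by simp_all
  have as: "(y, x) \<notin> R" if "(x, y) \<in> R" for x y using R(3) that unfolding asym_iff_all by blast
  have loop: "(x, x) \<notin> E \<union> U" for x using R(2) as by blast
  have conf: "(y, x) \<notin> E" if "(x, y) \<in> E" for x y using R(4) as that by blast
  have "(x, y) \<in> H" if xy: "(x, y) \<in> R" for x y
  proof -
    have "x \<in> V" "y \<in> V" "x \<noteq> y" using R(1) assms(1,2) xy as by blast+
    moreover have "(y, x) \<notin> E" using R(4) as xy by blast
    ultimately show ?thesis using R(1) xy unfolding H_def by auto
  qed
  moreover have "(x, y) \<in> R \<or> (y, x) \<in> R" if xy: "(x, y) \<in> H" for x y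
  proof -
    have "x \<noteq> y" using xy loop conf unfolding H_def by auto
    then have "(x, y) \<in> E \<union> U \<or> (y, x) \<in> E \<union> U" using xy unfolding H_def by auto
    then show ?thesis using R(2) by blast
  qed
  ultimately show "solves F V H R" unfolding solves_def using R(3,5) by auto
next
  assume "solves F V H R"
  then have R: "R \<subseteq> H" "H \<subseteq> R \<union> R\<inverse>" "asym R" "free_of F (V, R)" unfolding solves_def by simp_all
  have as: "(y, x) \<notin> R" if "(x, y) \<in> R" for x y using R(3) that unfolding asym_iff_all by blast
  have loopH: "(x, x) \<notin> H" for x using R(2) as by blast
  have conf: "(y, x) \<notin> E" if "(x, y) \<in> E" for x y
    using loopH[of x] that assms(1) unfolding H_def by auto
  have loop: "(x, x) \<notin> E" "(x, x) \<notin> U" for x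
    using conf[of x x] loopH[of x] assms(2) unfolding H_def by auto
  have EH: "(x, y) \<in> H" "(y, x) \<notin> H" if "(x, y) \<in> E" for x y
    using that conf[OF that] loop assms(1) unfolding H_def by auto
  have UH: "(x, y) \<in> H \<or> (y, x) \<in> H" if "(x, y) \<in> U" for x y
    using that loop assms(2) unfolding H_def by auto
  have "R \<subseteq> (E \<union> U) \<union> (E \<union> U)\<inverse>"
  proof (rule subrelI)
    fix x y assume "(x, y) \<in> R"
    then have "(x, y) \<in> H" "x \<noteq> y" using R(1) as by blast+
    then show "(x, y) \<in> (E \<union> U) \<union> (E \<union> U)\<inverse>" unfolding H_def by auto
  qed
  moreover have "E \<union> U \<subseteq> R \<union> R\<inverse>"
  proof (rule subrelI)
    fix x y assume "(x, y) \<in> E \<union> U"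
    then have "(x, y) \<in> H \<or> (y, x) \<in> H" using EH(1)[of x y] UH[of x y] by blast
    then show "(x, y) \<in> R \<union> R\<inverse>" using R(2) by blast
  qed
  moreover have "E \<subseteq> R"
  proof (rule subrelI)
    fix x y assume "(x, y) \<in> E"
    from EH[OF this] show "(x, y) \<in> R" using R(1,2) by blast
  qed
  ultimately show "solution F V E (E \<union> U) R" unfolding solution_def using R(3,4) by blast
qed

lemma limit_to_completion:
  assumes lim: "fraisse_limit F (D :: 'a digraph)"
  shows "poly_reducible (CSP [2, 2] (with_U D)) (orientation_completion F)"
proof -
  define H where "H n Rs = {(x, y). x \<in> {..<n} \<and> y \<in> {..<n} \<and>
      (if x = y then (x, x) \<in> edge_rel (Rs ! 1) \<or> (\<exists>z\<in>{..<n}. (x, z) \<in> edge_rel (Rs ! 0) \<and> (z, x) \<in> edge_rel (Rs ! 0))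
      else (x, y) \<in> edge_rel (Rs ! 0) \<or> ((x, y) \<in> edge_rel (Rs ! 1) \<or> (y, x) \<in> edge_rel (Rs ! 1)) \<and>
        (y, x) \<notin> edge_rel (Rs ! 0))}" for n :: nat and Rs :: rels
  show ?thesis
  proof (rule unit_graph(1)[where E = H and ar = "[2, 2]"])
    show "definable [2, 2] k (\<lambda>n Rs \<sigma>. (\<sigma> ! i, \<sigma> ! j) \<in> H n Rs)" if ij: "i < k" "j < k" for k i j
    proof -
      have "definable [2, 2] (Suc k) (\<lambda>n Rs \<sigma>. [\<sigma> ! i, \<sigma> ! k] \<in> Rs ! 0 \<and> [\<sigma> ! k, \<sigma> ! i] \<in> Rs ! 0)"
        using ij by (intro definable_conj definable_edge) auto
      from definable_ex[OF this] have ex: "definable [2, 2] k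
          (\<lambda>n Rs \<sigma>. \<exists>z<n. [\<sigma> ! i, z] \<in> Rs ! 0 \<and> [z, \<sigma> ! i] \<in> Rs ! 0)"
        by (rule definable_cong) (use ij in \<open>simp add: valid_def nth_append\<close>)
      have "definable [2, 2] k (\<lambda>n Rs \<sigma>.
          \<sigma> ! i = \<sigma> ! j \<and> ([\<sigma> ! i, \<sigma> ! i] \<in> Rs ! 1 \<or> (\<exists>z<n. [\<sigma> ! i, z] \<in> Rs ! 0 \<and> [z, \<sigma> ! i] \<in> Rs ! 0)) \<or>
          \<not> \<sigma> ! i = \<sigma> ! j \<and> ([\<sigma> ! i, \<sigma> ! j] \<in> Rs ! 0 \<or> ([\<sigma> ! i, \<sigma> ! j] \<in> Rs ! 1 \<or> [\<sigma> ! j, \<sigma> ! i] \<in> Rs ! 1) \<and>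
            \<not> [\<sigma> ! j, \<sigma> ! i] \<in> Rs ! 0))"
        using ij by (intro definable_conj definable_disj definable_not definable_eq definable_edge ex) auto
      then show ?thesis
      proof (rule definable_cong)
        fix n Rs \<sigma> assume "valid [2, 2] k n Rs \<sigma>"
        then have "\<sigma> ! i < n" "\<sigma> ! j < n" using ij by (simp_all add: valid_nth)
        then show "(\<sigma> ! i = \<sigma> ! j \<and> ([\<sigma> ! i, \<sigma> ! i] \<in> Rs ! 1 \<or> (\<exists>z<n. [\<sigma> ! i, z] \<in> Rs ! 0 \<and> [z, \<sigma> ! i] \<in> Rs ! 0)) \<or>
          \<not> \<sigma> ! i = \<sigma> ! j \<and> ([\<sigma> ! i, \<sigma> ! j] \<in> Rs ! 0 \<or> ([\<sigma> ! i, \<sigma> ! j] \<in> Rs ! 1 \<or> [\<sigma> ! j, \<sigma> ! i] \<in> Rs ! 1) \<and>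
            \<not> [\<sigma> ! j, \<sigma> ! i] \<in> Rs ! 0)) = ((\<sigma> ! i, \<sigma> ! j) \<in> H n Rs)"
          unfolding H_def by (cases "\<sigma> ! i = \<sigma> ! j") auto
      qed
    qed
    show "H n Rs \<subseteq> {..<n} \<times> {..<n}" for n Rs by (auto simp: H_def)
    fix n :: nat and Rs :: rels assume st: "structure_of [2, 2] ({..<n}, Rs)"
    show "encode n [2, 2] Rs \<in> CSP [2, 2] (with_U D) \<longleftrightarrow> (\<exists>R. solves F {..<n} (H n Rs) R)"
      unfolding limit_instance(3)[OF st lim] solution_solves_iff[OF limit_instance(1,2)[OF st lim]] H_def ..
  qed (rule CSP_decode)
qed

end

theorem theorem4p8:
  fixes F :: "'b digraph set" and D :: "'a digraph"
  assumes "finite F"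
    and "\<And>T. T \<in> F \<Longrightarrow> tournament T \<and> finite (verts T) \<and> 2 \<le> card (verts T)"
    and "fraisse_limit F D"
  shows "poly_equivalent (orientation_completion F) (CSP (B01_signature F) (B01 F)) \<and>
    poly_equivalent (CSP (B01_signature F) (B01 F)) (CSP [2, 2] (with_U D)) \<and>
    poly_equivalent (orientation_completion F) (CSP [2, 2] (with_U D))"
proof -
  interpret forbidden F by unfold_locales (use assms(1,2) in blast)+
  show ?thesis unfolding poly_equivalent_def
    using completion_to_boolean boolean_to_graphs(1) boolean_to_graphs(2)[OF assms(3)] limit_to_boolean[OF assms(3)]
      completion_to_limit[OF assms(3)] limit_to_completion[OF assms(3)] assms(3) by blast
qed

end
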